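(* Let $k$ be a field and let $\Delta$ be a simplicial complex on the vertex set $[n]=\{1,\dots,n\}$. Let $A=k[\Delta]$ be its Stanley--Reisner ring, of Krull dimension $d\ge 2$. Suppose that $\operatorname{indeg} A=\operatorname{rt}(A)=d$. If $e(A)\le 2d-1$, then $A$ has $d$-linear resolution. In particular, $a(A)<0$.
   Context: A simplicial complex $\Delta$ on $[n]$ is a family of subsets of $[n]$ (faces) closed under taking subsets, with $\{i\}\in\Delta$ for all $i\in[n]$. The Stanley--Reisner ring is $k[\Delta]=S/I_\Delta$, where $S=k[X_1,\dots,X_n]$ with $\deg X_i=1$ and $I_\Delta$ is generated by all squarefree monomials $X_{i_1}\cdots X_{i_p}$ with $\{i_1,\dots,i_p\}\notin\Delta$. The dimension of a face $F$ is $|F|-1$, facets are maximal faces, and $\dim k[\Delta]=\dim\Delta+1=d$. The multiplicity $e(A)$ equals the number of facets $F$ of $\Delta$ with $\dim F=d-1$. Let $\beta_{i,j}(A)$ be the graded Betti numbers of $A$ over $S$ (from the graded minimal free resolution of $A$ over $S$). The initial degree is $\operatorname{indeg} A=\min\{j:\beta_{1,j}(A)\ne 0\}$, the relation type is $\operatorname{rt}(A)=\max\{j:\beta_{1,j}(A)\neq 0\}$, and the Castelnuovo--Mumford regularity is $\operatorname{reg} A=\max\{j-i:\beta_{i,j}(A)\ne 0\}$. One always has $\operatorname{reg} A\ge \operatorname{indeg} A-1$; $A$ has linear resolution if equality holds, and $A$ has $q$-linear resolution if moreover $\operatorname{indeg} A=q$. The $a$-invariant is $a(A)=\sup\{p\in\mathbb{Z}:[H^d_{\mathfrak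 m}(A)]_p\ne 0\}$, where $\mathfrak m=(X_1,\dots,X_n)A$ and $H^d_{\mathfrak m}$ is local cohomology. *)

theory Defs
  imports
    "HOL-Algebra.QuotRing"
    "HOL-Algebra.Module"
    "HOL-Algebra.Embedded_Algebras"
    "HOL-Library.Poly_Mapping"
    "HOL-Library.Extended_Real"
begin

section \<open>Graded polynomial rings\<close>

text \<open>A monomial is an exponent vector; the type has countably many variables, and the carrier
  of \<open>poly_ring n\<close> selects the polynomials in \<open>X\<^sub>1, \<dots>, X\<^sub>n\<close>.\<close>

type_synonym 'k mpoly = "(nat \<Rightarrow>\<^sub>0 nat) \<Rightarrow>\<^sub>0 'k"

definition Var :: "nat \<Rightarrow> 'k::comm_ring_1 mpoly" where
  "Var i = Poly_Mapping.single (Poly_Mapping.single i 1) 1"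

definition poly_ring :: "nat \<Rightarrow> 'k::comm_ring_1 mpoly ring" where
  "poly_ring n =
    \<lparr>carrier = {p. \<forall>m\<in>Poly_Mapping.keys p. Poly_Mapping.keys m \<subseteq> {1..n}},
     mult = (*), one = 1, zero = 0, add = (+)\<rparr>"

definition mon_degree :: "(nat \<Rightarrow>\<^sub>0 nat) \<Rightarrow> nat" where
  "mon_degree m = (\<Sum>i\<in>Poly_Mapping.keys m. Poly_Mapping.lookup m i)"

text \<open>The graded component \<open>S\<^sub>e\<close>; it is zero for \<open>e < 0\<close>.\<close>

definition homogeneous_part :: "nat \<Rightarrow> int \<Rightarrow> 'k::comm_ring_1 mpoly set" where
  "homogeneous_part n e =
    {p \<in> carrier (poly_ring n). \<forall>m\<in>Poly_Mapping.keys p. int (mon_degree m) = e}"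

definition irrelevant_ideal :: "nat \<Rightarrow> 'k::comm_ring_1 mpoly set" where
  "irrelevant_ideal n = Idl\<^bsub>poly_ring n\<^esub> (Var ` {1..n})"


section \<open>Stanley--Reisner rings\<close>

definition simplicial_complex :: "nat \<Rightarrow> nat set set \<Rightarrow> bool" where
  "simplicial_complex n \<Delta> \<longleftrightarrow>
    \<Delta> \<subseteq> Pow {1..n} \<and> (\<forall>F\<in>\<Delta>. \<forall>G. G \<subseteq> F \<longrightarrow> G \<in> \<Delta>) \<and> (\<forall>i\<in>{1..n}. {i} \<in> \<Delta>)"

definition stanley_reisner_ideal :: "nat \<Rightarrow> nat set set \<Rightarrow> 'k::comm_ring_1 mpoly set" where
  "stanley_reisner_ideal n \<Delta> =
    Idl\<^bsub>poly_ring n\<^esub> {(\<Prod>i\<in>F. Var i) |F. F \<subseteq> {1..n} \<and> F \<notin> \<Delta>}"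

text \<open>The quotient \<open>R/I\<close> as an \<open>R\<close>-algebra: the record is at the same time the ring
  \<open>R Quot I\<close> and an \<open>R\<close>-module.\<close>

definition quotient_algebra :: "('a, 'b) ring_scheme \<Rightarrow> 'a set \<Rightarrow> ('a, 'a set) module" where
  "quotient_algebra R I =
    ring.extend (R Quot I) (module.fields (\<lambda>r X. (I +>\<^bsub>R\<^esub> r) \<otimes>\<^bsub>R Quot I\<^esub> X))"

definition stanley_reisner_ring ::
    "nat \<Rightarrow> nat set set \<Rightarrow> ('k::comm_ring_1 mpoly, 'k mpoly set) module" where
  "stanley_reisner_ring n \<Delta> = quotient_algebra (poly_ring n) (stanley_reisner_ideal n \<Delta>)"


section \<open>Krull dimension\<close>

text \<open>The zero ring gets dimension \<open>0\<close> here.\<close>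

definition krull_dim :: "('a, 'b) ring_scheme \<Rightarrow> enat" where
  "krull_dim R =
    Sup {enat l |l. \<exists>P. (\<forall>i\<le>l. primeideal (P i) R) \<and> (\<forall>i<l. P i \<subset> P (Suc i))}"


section \<open>Hilbert function and multiplicity\<close>

text \<open>From here on, \<open>A\<close> stands for a quotient of \<open>S = k[X\<^sub>1, \<dots>, X\<^sub>n]\<close> by a homogeneous ideal,
  regarded as an \<open>S\<close>-algebra.  Its graded component \<open>A\<^sub>e\<close> is the image of \<open>S\<^sub>e\<close> under the
  structure map \<open>p \<mapsto> p \<cdot> 1\<close>; for a proper ideal, \<open>A\<^sub>0\<close> is the copy of the field \<open>k\<close> in \<open>A\<close>.\<close>

definition graded_part :: "nat \<Rightarrow> ('k::comm_ring_1 mpoly, 'a) module \<Rightarrow> int \<Rightarrow> 'a set" where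
  "graded_part n A e = (\<lambda>p. p \<odot>\<^bsub>A\<^esub> \<one>\<^bsub>A\<^esub>) ` homogeneous_part n e"

definition hilbert_function :: "nat \<Rightarrow> ('k::comm_ring_1 mpoly, 'a) module \<Rightarrow> nat \<Rightarrow> nat" where
  "hilbert_function n A t =
    (THE h. ring.dimension A h (graded_part n A 0) (graded_part n A (int t)))"

text \<open>For \<open>d = dim A \<ge> 1\<close>, the Hilbert polynomial has leading term \<open>e(A) t\<^sup>d\<^sup>-\<^sup>1 / (d - 1)!\<close>.\<close>

definition hilbert_multiplicity :: "nat \<Rightarrow> ('k::comm_ring_1 mpoly, 'a) module \<Rightarrow> real" where
  "hilbert_multiplicity n A =
    (let d = the_enat (krull_dim A)
     in fact (d - 1) * lim (\<lambda>t. real (hilbert_function n A t) / real t ^ (d - 1)))"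


section \<open>Graded Betti numbers\<close>

definition module_hom_set ::
    "('r, 'q) ring_scheme \<Rightarrow> ('r, 'a) module \<Rightarrow> ('r, 'b) module \<Rightarrow> ('a \<Rightarrow> 'b) set" where
  "module_hom_set R M N =
    {h \<in> carrier M \<rightarrow> carrier N.
      (\<forall>x\<in>carrier M. \<forall>y\<in>carrier M. h (x \<oplus>\<^bsub>M\<^esub> y) = h x \<oplus>\<^bsub>N\<^esub> h y) \<and>
      (\<forall>r\<in>carrier R. \<forall>x\<in>carrier M. h (r \<odot>\<^bsub>M\<^esub> x) = r \<odot>\<^bsub>N\<^esub> h x)}"

text \<open>The graded free module \<open>\<Oplus>\<^sub>j S(-j)\<^sup>b\<^sup>(\<^sup>j\<^sup>)\<close>, with basis the pairs \<open>(j, l)\<close>, \<open>l < b j\<close>, where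
  \<open>(j, l)\<close> has degree \<open>j\<close>.  The fields \<open>mult\<close> and \<open>one\<close> of the record are irrelevant for a module.\<close>

definition graded_free ::
    "nat \<Rightarrow> (nat \<Rightarrow> nat) \<Rightarrow> ('k::comm_ring_1 mpoly, nat \<times> nat \<Rightarrow>\<^sub>0 'k mpoly) module" where
  "graded_free n b =
    \<lparr>carrier = {f. \<forall>(j, l)\<in>Poly_Mapping.keys f. l < b j \<and>
       Poly_Mapping.lookup f (j, l) \<in> carrier (poly_ring n)},
     mult = (\<lambda>_ _. 0), one = 0, zero = 0, add = (+),
     smult = (\<lambda>p. Poly_Mapping.map ((*) p))\<rparr>"

definition graded_free_part ::
    "nat \<Rightarrow> (nat \<Rightarrow> nat) \<Rightarrow> int \<Rightarrow> (nat \<times> nat \<Rightarrow>\<^sub>0 'k::comm_ring_1 mpoly) set" where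
  "graded_free_part n b e =
    {f \<in> carrier (graded_free n b). \<forall>(j, l)\<in>Poly_Mapping.keys f.
       Poly_Mapping.lookup f (j, l) \<in> homogeneous_part n (e - int j)}"

text \<open>A minimal graded free resolution
  \<open>\<dots> \<rightarrow> F\<^sub>2 \<rightarrow> F\<^sub>1 \<rightarrow> F\<^sub>0 \<rightarrow> A \<rightarrow> 0\<close> with \<open>F\<^sub>i = \<Oplus>\<^sub>j S(-j)\<^sup>\<beta>\<^sup>(\<^sup>i\<^sup>,\<^sup>j\<^sup>)\<close>, where \<open>\<phi> i\<close> maps \<open>F\<^sub>i\<^sub>+\<^sub>1\<close> to \<open>F\<^sub>i\<close>.
  All maps preserve degrees, and minimality says that \<open>\<phi> i\<close> maps into \<open>\<mm> F\<^sub>i\<close>, i.e. to vectors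
  whose coordinates lie in \<open>\<mm> = (X\<^sub>1, \<dots>, X\<^sub>n)\<close>.  As \<open>A\<close> is generated in degree \<open>0\<close>, only shifts
  \<open>j \<ge> 0\<close> occur.  Finiteness of length and ranks is automatic and not required.\<close>

definition minimal_graded_free_resolution ::
    "nat \<Rightarrow> ('k::comm_ring_1 mpoly, 'a) module \<Rightarrow> (nat \<Rightarrow> nat \<Rightarrow> nat)
      \<Rightarrow> ((nat \<times> nat \<Rightarrow>\<^sub>0 'k mpoly) \<Rightarrow> 'a)
      \<Rightarrow> (nat \<Rightarrow> (nat \<times> nat \<Rightarrow>\<^sub>0 'k mpoly) \<Rightarrow> (nat \<times> nat \<Rightarrow>\<^sub>0 'k mpoly)) \<Rightarrow> bool" where
  "minimal_graded_free_resolution n A \<beta> \<epsilon> \<phi> \<longleftrightarrow>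
    (let F = (\<lambda>i. graded_free n (\<beta> i)) in
      \<epsilon> \<in> module_hom_set (poly_ring n) (F 0) A \<and>
      (\<forall>e. \<epsilon> ` graded_free_part n (\<beta> 0) e \<subseteq> graded_part n A e) \<and>
      \<epsilon> ` carrier (F 0) = carrier A \<and>
      a_kernel (F 0) A \<epsilon> = \<phi> 0 ` carrier (F 1) \<and>
      (\<forall>i. \<phi> i \<in> module_hom_set (poly_ring n) (F (Suc i)) (F i) \<and>
        (\<forall>e. \<phi> i ` graded_free_part n (\<beta> (Suc i)) e \<subseteq> graded_free_part n (\<beta> i) e) \<and>
        a_kernel (F (Suc i)) (F i) (\<phi> i) = \<phi> (Suc i) ` carrier (F (Suc (Suc i))) \<and>
        (\<forall>f\<in>carrier (F (Suc i)). \<forall>c. Poly_Mapping.lookup (\<phi> i f) c \<in> irrelevant_ideal n)))"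

text \<open>Minimal graded free resolutions exist and are unique up to isomorphism, so the choice is
  immaterial.\<close>

definition betti :: "nat \<Rightarrow> ('k::comm_ring_1 mpoly, 'a) module \<Rightarrow> nat \<Rightarrow> nat \<Rightarrow> nat" where
  "betti n A = (SOME \<beta>. \<exists>\<epsilon> \<phi>. minimal_graded_free_resolution n A \<beta> \<epsilon> \<phi>)"

text \<open>If there are no relations at all, then \<open>initial_degree n A = \<infinity>\<close> and \<open>relation_type n A = 0\<close>.\<close>

definition initial_degree :: "nat \<Rightarrow> ('k::comm_ring_1 mpoly, 'a) module \<Rightarrow> enat" where
  "initial_degree n A = Inf {enat j |j. betti n A 1 j \<noteq> 0}"

definition relation_type :: "nat \<Rightarrow> ('k::comm_ring_1 mpoly, 'a) module \<Rightarrow> enat" where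
  "relation_type n A = Sup {enat j |j. betti n A 1 j \<noteq> 0}"

definition regularity :: "nat \<Rightarrow> ('k::comm_ring_1 mpoly, 'a) module \<Rightarrow> ereal" where
  "regularity n A = Sup {ereal (real j - real i) |i j. betti n A i j \<noteq> 0}"

definition has_linear_resolution :: "nat \<Rightarrow> ('k::comm_ring_1 mpoly, 'a) module \<Rightarrow> bool" where
  "has_linear_resolution n A \<longleftrightarrow> regularity n A = ereal_of_enat (initial_degree n A) - 1"

definition has_q_linear_resolution ::
    "nat \<Rightarrow> nat \<Rightarrow> ('k::comm_ring_1 mpoly, 'a) module \<Rightarrow> bool" where
  "has_q_linear_resolution n q A \<longleftrightarrow> has_linear_resolution n A \<and> initial_degree n A = enat q"


section \<open>Localization at an element\<close>

text \<open>\<open>fraction R f a m\<close> is the fraction \<open>a / f\<^sup>m\<close>, as the class of all pairs \<open>(b, l)\<close>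
  with \<open>b / f\<^sup>l = a / f\<^sup>m\<close>.\<close>

definition fraction :: "('a, 'b) ring_scheme \<Rightarrow> 'a \<Rightarrow> 'a \<Rightarrow> nat \<Rightarrow> ('a \<times> nat) set" where
  "fraction R f a m =
    {(b, l). b \<in> carrier R \<and>
      (\<exists>r::nat. f [^]\<^bsub>R\<^esub> r \<otimes>\<^bsub>R\<^esub> (b \<otimes>\<^bsub>R\<^esub> f [^]\<^bsub>R\<^esub> m) = f [^]\<^bsub>R\<^esub> r \<otimes>\<^bsub>R\<^esub> (a \<otimes>\<^bsub>R\<^esub> f [^]\<^bsub>R\<^esub> l))}"

definition localization :: "('a, 'b) ring_scheme \<Rightarrow> 'a \<Rightarrow> ('a \<times> nat) set ring" where
  "localization R f =
    \<lparr>carrier = {fraction R f a m |a m. a \<in> carrier R},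
     mult = (\<lambda>X Y. \<Union>(a, m)\<in>X. \<Union>(b, l)\<in>Y. fraction R f (a \<otimes>\<^bsub>R\<^esub> b) (m + l)),
     one = fraction R f \<one>\<^bsub>R\<^esub> 0,
     zero = fraction R f \<zero>\<^bsub>R\<^esub> 0,
     add = (\<lambda>X Y. \<Union>(a, m)\<in>X. \<Union>(b, l)\<in>Y.
       fraction R f (a \<otimes>\<^bsub>R\<^esub> f [^]\<^bsub>R\<^esub> l \<oplus>\<^bsub>R\<^esub> b \<otimes>\<^bsub>R\<^esub> f [^]\<^bsub>R\<^esub> m) (m + l))\<rparr>"

text \<open>The canonical map \<open>R\<^sub>f \<rightarrow> R\<^sub>f\<^sub>g\<close>, \<open>a / f\<^sup>m \<mapsto> a g\<^sup>m / (f g)\<^sup>m\<close>.\<close>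

definition localization_map ::
    "('a, 'b) ring_scheme \<Rightarrow> 'a \<Rightarrow> 'a \<Rightarrow> ('a \<times> nat) set \<Rightarrow> ('a \<times> nat) set" where
  "localization_map R f g X = (\<Union>(a, m)\<in>X. fraction R (f \<otimes>\<^bsub>R\<^esub> g) (a \<otimes>\<^bsub>R\<^esub> g [^]\<^bsub>R\<^esub> m) m)"


section \<open>Local cohomology\<close>

text \<open>Local cohomology with support in \<open>\<mm> = (X\<^sub>1, \<dots>, X\<^sub>n)A\<close> is the cohomology of the Cech complex
  with terms \<open>C\<^sup>i = \<Oplus>\<^sub>\<sigma> A\<^bsub>x\<^sub>\<sigma>\<^esub>\<close>, where \<open>\<sigma>\<close> runs over the \<open>i\<close>-subsets of \<open>{1, \<dots>, n}\<close> and \<open>x\<^sub>\<sigma>\<close> is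
  the product of the \<open>X\<^sub>j\<close>, \<open>j \<in> \<sigma>\<close>.  The fraction \<open>a / x\<^sub>\<sigma>\<^sup>m\<close> has degree \<open>deg a - m |\<sigma>|\<close>.\<close>

definition var_prod :: "('k::comm_ring_1 mpoly, 'a) module \<Rightarrow> nat set \<Rightarrow> 'a" where
  "var_prod A \<sigma> = (\<Prod>i\<in>\<sigma>. Var i) \<odot>\<^bsub>A\<^esub> \<one>\<^bsub>A\<^esub>"

definition index_sets :: "nat \<Rightarrow> nat \<Rightarrow> nat set set" where
  "index_sets n i = {\<sigma>. \<sigma> \<subseteq> {1..n} \<and> card \<sigma> = i}"

definition localization_part ::
    "nat \<Rightarrow> ('k::comm_ring_1 mpoly, 'a) module \<Rightarrow> nat set \<Rightarrow> int \<Rightarrow> ('a \<times> nat) set set" where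
  "localization_part n A \<sigma> p =
    {fraction A (var_prod A \<sigma>) a m |a m. a \<in> graded_part n A (p + int (m * card \<sigma>))}"

text \<open>The additive group of Cech cochains of cohomological degree \<open>i\<close> and internal degree \<open>p\<close>.\<close>

definition cech_cochains ::
    "nat \<Rightarrow> ('k::comm_ring_1 mpoly, 'a) module \<Rightarrow> nat \<Rightarrow> int \<Rightarrow> (nat set \<Rightarrow> ('a \<times> nat) set) monoid"
  where
  "cech_cochains n A i p =
    \<lparr>carrier = (\<Pi>\<^sub>E \<sigma>\<in>index_sets n i. localization_part n A \<sigma> p),
     mult = (\<lambda>c c'. \<lambda>\<sigma>\<in>index_sets n i. c \<sigma> \<oplus>\<^bsub>localization A (var_prod A \<sigma>)\<^esub> c' \<sigma>),
     one = (\<lambda>\<sigma>\<in>index_sets n i. \<zero>\<^bsub>localization A (var_prod A \<sigma>)\<^esub>)\<rparr>"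

text \<open>The coboundary \<open>C\<^sup>i \<rightarrow> C\<^sup>i\<^sup>+\<^sup>1\<close>; the sign of the component \<open>\<tau> - {j} \<rightarrow> \<tau>\<close> is \<open>-1\<close> to the number
  of elements of \<open>\<tau>\<close> below \<open>j\<close>.\<close>

definition cech_coboundary ::
    "nat \<Rightarrow> ('k::comm_ring_1 mpoly, 'a) module \<Rightarrow> nat
      \<Rightarrow> (nat set \<Rightarrow> ('a \<times> nat) set) \<Rightarrow> (nat set \<Rightarrow> ('a \<times> nat) set)" where
  "cech_coboundary n A i c =
    (\<lambda>\<tau>\<in>index_sets n (Suc i).
      finsum (localization A (var_prod A \<tau>))
        (\<lambda>j. let y = localization_map A (var_prod A (\<tau> - {j})) (var_prod A {j}) (c (\<tau> - {j}))
             in if even (card {l\<in>\<tau>. l < j}) then y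
                else \<ominus>\<^bsub>localization A (var_prod A \<tau>)\<^esub> y)
        \<tau>)"

definition cech_cocycles ::
    "nat \<Rightarrow> ('k::comm_ring_1 mpoly, 'a) module \<Rightarrow> nat \<Rightarrow> int \<Rightarrow> (nat set \<Rightarrow> ('a \<times> nat) set) monoid"
  where
  "cech_cocycles n A i p = (cech_cochains n A i p)
    \<lparr>carrier := kernel (cech_cochains n A i p) (cech_cochains n A (Suc i) p)
       (cech_coboundary n A i)\<rparr>"

definition cech_coboundaries ::
    "nat \<Rightarrow> ('k::comm_ring_1 mpoly, 'a) module \<Rightarrow> nat \<Rightarrow> int \<Rightarrow> (nat set \<Rightarrow> ('a \<times> nat) set) set"
  where
  "cech_coboundaries n A i p =
    (case i of 0 \<Rightarrow> {\<one>\<^bsub>cech_cochains n A 0 p\<^esub>}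
     | Suc i' \<Rightarrow> cech_coboundary n A i' ` carrier (cech_cochains n A i' p))"

text \<open>The graded component \<open>[H\<^sup>i\<^sub>\<mm>(A)]\<^sub>p\<close>.\<close>

definition local_cohomology ::
    "nat \<Rightarrow> ('k::comm_ring_1 mpoly, 'a) module \<Rightarrow> nat \<Rightarrow> int \<Rightarrow> (nat set \<Rightarrow> ('a \<times> nat) set) set monoid"
  where
  "local_cohomology n A i p = cech_cocycles n A i p Mod cech_coboundaries n A i p"

definition a_invariant :: "nat \<Rightarrow> ('k::comm_ring_1 mpoly, 'a) module \<Rightarrow> ereal" where
  "a_invariant n A =
    Sup {ereal (real_of_int p) |p. let H = local_cohomology n A (the_enat (krull_dim A)) p
                                   in carrier H \<noteq> {\<one>\<^bsub>H\<^esub>}}"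

end

theory Submission
  imports Defs
begin

text \<open>By Krull dimension and relation type, faces have at most \<open>d\<close> elements and no \<open>d + 1\<close> vertices have
  all their \<open>d\<close>-subsets in \<open>\<Delta>\<close>.  A nonempty family of \<open>d\<close>-sets without such a full boundary, in which
  every ridge of a member lies in at least two members, has at least \<open>2d\<close> members.  As \<open>e(A) \<le> 2d - 1\<close> counts the
  \<open>d\<close>-element faces, they can be removed one at a time together with a free ridge, so \<open>\<Delta>\<close> is a disjoint
  union of intervals \<open>[G, F]\<close> with \<open>|G| < d\<close> and \<open>A\<close> is filtered by the modules \<open>k[F](-|G|)\<close>.  Their \<open>i\<close>-th
  Koszul homology sits in degree \<open>i + |G|\<close>, which gives \<open>Tor\<^sub>i(A, k)\<^sub>j = 0\<close> for \<open>j \<ge> i + d\<close>.  The same collapse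
  kills the cohomology of \<open>\<Delta>\<close> in dimension \<open>d - 1\<close>, and hence the top local cohomology of \<open>A\<close> in degree
  \<open>0\<close>; in positive degrees it vanishes for every complex.\<close>

section \<open>Polynomials and monomial ideals\<close>

text \<open>The bound 2d is sharp: for d >= 2, suspending the boundary of a simplex on d vertices
  gives 2d sets of size d with no free ridge and no full boundary. This is why e(A) stops at 2d - 1.
  The condition |G| < d is what matters in an interval: the Koszul homology of k[F](-|G|) is
  generated by x_G times exterior variables outside F, and |G| < d puts it below degree i + d. A
  face with d elements must therefore leave together with a proper subface, which is why a free
  ridge is needed; smaller faces may leave alone. The relation type enters through minimal nonfaces:
  one with d + 1 elements would produce a relation of degree d + 1. The initial degree supplies a
  relation of degree d, so that the bound on the regularity is attained. \<open>betti\<close> is a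
  choice among minimal resolutions. One resolution has to be constructed, and then everything must
  be derived from an arbitrary one; the comparison with the Koszul complex is made by lifting
  homogeneous vectors.\<close>

abbreviation "lookup \<equiv> Poly_Mapping.lookup"
abbreviation "keys \<equiv> Poly_Mapping.keys"
abbreviation "single \<equiv> Poly_Mapping.single"
abbreviation "polys n \<equiv> carrier (poly_ring n)"

type_synonym mon = "nat \<Rightarrow>\<^sub>0 nat"

lemma mon_degree_superset:
  assumes "finite A" "keys m \<subseteq> A"
  shows "mon_degree m = (\<Sum>i\<in>A. lookup m i)"
  unfolding mon_degree_def using assms
  by (intro sum.mono_neutral_left) (auto simp: in_keys_iff)

lemma keys_plus_nat: "keys (a + b) = keys a \<union> keys (b :: mon)"
  by (auto simp: in_keys_iff lookup_add)

lemma mon_degree_plus: "mon_degree (a + b) = mon_degree a + mon_degree b"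
  by (subst (1 2 3) mon_degree_superset[of "keys a \<union> keys b"])
    (auto simp: keys_plus_nat lookup_add sum.distrib)

lemma mon_degree_single [simp]: "mon_degree (single i e) = e"
  by (simp add: mon_degree_def)

lemma mon_degree_zero [simp]: "mon_degree 0 = 0"
  by (simp add: mon_degree_def)

lemma mon_degree_eq_0_iff [simp]: "mon_degree m = 0 \<longleftrightarrow> m = 0"
  by (auto simp: mon_degree_def in_keys_iff intro!: poly_mapping_eqI)

text \<open>The exponent vector of the squarefree monomial x_F.\<close>

definition ind_mon :: "nat set \<Rightarrow> mon" where
  "ind_mon F = (\<Sum>i\<in>F. single i 1)"

lemma lookup_ind_mon: "finite F \<Longrightarrow> lookup (ind_mon F) i = (if i \<in> F then 1 else 0)"
  by (simp add: ind_mon_def lookup_sum lookup_single when_def sum.delta)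

lemma keys_ind_mon [simp]: "finite F \<Longrightarrow> keys (ind_mon F) = F"
  by (auto simp: in_keys_iff lookup_ind_mon split: if_splits)

lemma mon_degree_ind_mon [simp]: "finite F \<Longrightarrow> mon_degree (ind_mon F) = card F"
  by (simp add: mon_degree_def lookup_ind_mon)

lemma ind_mon_le:
  assumes "finite F" "F \<subseteq> keys m"
  obtains m' where "m = ind_mon F + m'"
proof
  show "m = ind_mon F + (m - ind_mon F)"
    using assms by (auto intro!: poly_mapping_eqI simp: lookup_add lookup_minus lookup_ind_mon in_keys_iff Suc_le_eq)
qed

lemma single_le:
  assumes "l \<in> keys (m :: mon)"
  shows "m = single l 1 + (m - single l 1)"
  using assms
  by (auto intro!: poly_mapping_eqI simp: lookup_add lookup_minus lookup_single in_keys_iff Suc_le_eq when_def)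

lemma prod_Var: "finite F \<Longrightarrow> (\<Prod>i\<in>F. Var i) = single (ind_mon F) (1 :: 'k :: comm_ring_1)"
  by (induction F rule: finite_induct) (auto simp: ind_mon_def Var_def mult_single)

lemma lookup_single_times_add:
  "lookup (single g c * p) (g + a) = c * lookup p (a :: mon)"
  for c :: "'k :: comm_ring_1"
proof -
  have "lookup (single g c * p) (g + a)
      = (\<Sum>l. lookup (single g c) l * (\<Sum>q. lookup p q when g + a = l + q))"
    by (rule lookup_mult)
  also have "\<dots> = (\<Sum>l. (c * (\<Sum>q. lookup p q when g + a = g + q)) when l = g)"
    by (intro Sum_any.cong) (auto simp: lookup_single when_def)
  also have "\<dots> = c * (\<Sum>q. lookup p q when q = a)"
    by (simp add: eq_commute)
  finally show ?thesis by simp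
qed

lemma lookup_single_times_not:
  assumes "\<And>a. m \<noteq> g + a"
  shows "lookup (single g c * p) m = (0 :: 'k :: comm_ring_1)"
  by (simp add: lookup_mult lookup_single when_mult assms)

lemma lookup_Var_times:
  "lookup (Var l * p) a =
    (if l \<in> keys a then lookup p (a - single l 1) else (0 :: 'k :: comm_ring_1))"
proof (cases "l \<in> keys a")
  case True
  show ?thesis
    unfolding Var_def using True
    by (subst single_le[OF True], subst lookup_single_times_add) simp
next
  case False
  then show ?thesis unfolding Var_def
    by (auto intro!: lookup_single_times_not simp: keys_plus_nat)
qed

lemma poly_sum_monomials: "p = (\<Sum>m\<in>keys p. single m (lookup p m))"
  by (rule poly_mapping_eqI)
    (auto simp: lookup_sum lookup_single when_def sum.delta in_keys_iff)

lemma poly_ring_simps [simp]: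
  "mult (poly_ring n) = (*)" "one (poly_ring n) = 1" "zero (poly_ring n) = 0" "add (poly_ring n) = (+)"
  by (simp_all add: poly_ring_def)

lemma carrier_poly_ring:
  "p \<in> polys n \<longleftrightarrow> (\<forall>m\<in>keys p. keys m \<subseteq> {1..n})"
  by (simp add: poly_ring_def)

lemma poly_closed [simp, intro]:
  shows poly_zero_closed: "0 \<in> polys n"
    and poly_one_closed: "1 \<in> polys n"
    and poly_add_closed: "p \<in> polys n \<Longrightarrow> q \<in> polys n \<Longrightarrow> p + q \<in> polys n"
    and poly_diff_closed: "p \<in> polys n \<Longrightarrow> q \<in> polys n \<Longrightarrow> p - q \<in> polys n"
    and poly_uminus_closed: "p \<in> polys n \<Longrightarrow> - p \<in> polys n"
    and poly_mult_closed: "p \<in> polys n \<Longrightarrow> q \<in> polys n \<Longrightarrow> p * q \<in> polys n"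
proof -
  show "p * q \<in> polys n" if "p \<in> polys n" "q \<in> polys n"
    using that keys_mult[of p q] by (fastforce simp: carrier_poly_ring keys_plus_nat)
  show "p + q \<in> polys n" if "p \<in> polys n" "q \<in> polys n"
    using that keys_add[of p q] by (auto simp: carrier_poly_ring)
  show "p - q \<in> polys n" if "p \<in> polys n" "q \<in> polys n"
    using that keys_diff[of p q] by (auto simp: carrier_poly_ring)
qed (auto simp: carrier_poly_ring in_keys_iff)

lemma poly_sum_closed [intro]:
  "(\<And>x. x \<in> X \<Longrightarrow> f x \<in> polys n) \<Longrightarrow> sum f X \<in> polys n"
  by (induction X rule: infinite_finite_induct) auto

lemma single_closed [simp]:
  "keys m \<subseteq> {1..n} \<Longrightarrow> single m c \<in> polys n"
  by (auto simp: carrier_poly_ring)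

lemma Var_closed [simp]: "l \<in> {1..n} \<Longrightarrow> Var l \<in> polys n"
  by (auto simp: Var_def)

lemma cring_poly_ring: "cring (poly_ring n)"
proof (intro cringI abelian_groupI comm_monoidI)
  fix p :: "'a mpoly" assume "p \<in> polys n"
  then show "\<exists>y\<in>polys n. y \<oplus>\<^bsub>poly_ring n\<^esub> p = \<zero>\<^bsub>poly_ring n\<^esub>"
    by (intro bexI[of _ "- p"]) auto
qed (auto simp: algebra_simps)

lemma a_minus_poly_ring: "p \<in> polys n \<Longrightarrow> a_inv (poly_ring n) p = - p"
  using cring_poly_ring[THEN cring.axioms(1), of n]
  by (intro abelian_group.minus_equality ring.is_abelian_group) auto

definition monomial_set :: "nat \<Rightarrow> mon set \<Rightarrow> 'k::comm_ring_1 mpoly set" where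
  "monomial_set n B = {p \<in> polys n. keys p \<subseteq> B}"

lemma ideal_monomial_set:
  assumes "\<And>a b. a \<in> B \<Longrightarrow> a + b \<in> B"
  shows "ideal (monomial_set n B :: 'k::comm_ring_1 mpoly set) (poly_ring n)"
proof (intro idealI subgroup.intro)
  show "ring (poly_ring n :: 'k mpoly ring)" by (rule cring.axioms(1)[OF cring_poly_ring])
  fix a x :: "'k mpoly" assume a: "a \<in> monomial_set n B" and x: "x \<in> polys n"
  show "x \<otimes>\<^bsub>poly_ring n\<^esub> a \<in> monomial_set n B" "a \<otimes>\<^bsub>poly_ring n\<^esub> x \<in> monomial_set n B"
    using a x keys_mult[of a x] assms by (fastforce simp: monomial_set_def mult.commute[of x a])+
next
  fix x y :: "'k mpoly" assume x: "x \<in> monomial_set n B"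
  show "inv\<^bsub>add_monoid (poly_ring n)\<^esub> x \<in> monomial_set n B"
    using x a_minus_poly_ring[of x n] by (auto simp: monomial_set_def a_inv_def in_keys_iff subset_iff)
  assume y: "y \<in> monomial_set n B"
  show "x \<otimes>\<^bsub>add_monoid (poly_ring n)\<^esub> y \<in> monomial_set n B"
    using x y keys_add[of x y] by (auto simp: monomial_set_def)
qed (auto simp: monomial_set_def)

text \<open>Serves both ideals of the development, the irrelevant ideal and the Stanley--Reisner
  ideal: membership in a monomial ideal is decided monomial by monomial, so later arguments work
  with coefficients.\<close>

lemma genideal_monomials:
  assumes "\<And>g. g \<in> Gs \<Longrightarrow> keys g \<subseteq> {1..n}"
  shows "Idl\<^bsub>poly_ring n\<^esub> ((\<lambda>g. single g 1) ` Gs)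
    = (monomial_set n {g + a |g a. g \<in> Gs} :: 'k::comm_ring_1 mpoly set)" (is "Idl\<^bsub>_\<^esub> ?X = ?M")
proof
  interpret R: cring "poly_ring n :: 'k mpoly ring" by (rule cring_poly_ring)
  have I: "ideal ?M (poly_ring n)"
    by (rule ideal_monomial_set) (use add.assoc in blast)
  have XM: "?X \<subseteq> ?M"
  proof
    fix p :: "'k mpoly" assume "p \<in> ?X"
    then obtain g where g: "g \<in> Gs" "p = single g 1" by auto
    have "keys p \<subseteq> {g + 0}" using g by simp
    moreover have "p \<in> polys n" using g assms by simp
    ultimately show "p \<in> ?M" using g(1) unfolding monomial_set_def by blast
  qed
  show "Idl\<^bsub>poly_ring n\<^esub> ?X \<subseteq> ?M"
    by (rule R.genideal_minimal[OF I XM])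
  have X: "?X \<subseteq> polys n" using assms by auto
  interpret J: ideal "Idl\<^bsub>poly_ring n\<^esub> ?X" "poly_ring n"
    by (rule R.genideal_ideal[OF X])
  have XI: "?X \<subseteq> Idl\<^bsub>poly_ring n\<^esub> ?X" by (rule R.genideal_self[OF X])
  show "?M \<subseteq> Idl\<^bsub>poly_ring n\<^esub> ?X"
  proof
    fix p assume p: "p \<in> ?M"
    have tm: "single m c \<in> Idl\<^bsub>poly_ring n\<^esub> ?X" if m: "m \<in> keys p" for m c
    proof -
      obtain g a where ga: "m = g + a" "g \<in> Gs" using p m by (auto simp: monomial_set_def)
      have km: "keys m \<subseteq> {1..n}" using p m by (auto simp: monomial_set_def carrier_poly_ring)
      then have ka: "keys a \<subseteq> {1..n}" by (simp add: ga keys_plus_nat)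
      have "single g 1 \<in> Idl\<^bsub>poly_ring n\<^esub> ?X" using XI ga by auto
      then have "single a c * single g 1 \<in> Idl\<^bsub>poly_ring n\<^esub> ?X"
        using J.I_l_closed[OF _ single_closed[OF ka]] by simp
      then show ?thesis by (simp add: mult_single ga add.commute)
    qed
    have "(\<Sum>m\<in>X. single m (lookup p m)) \<in> Idl\<^bsub>poly_ring n\<^esub> ?X"
      if "finite X" "X \<subseteq> keys p" for X
      using that
    proof (induction X rule: finite_induct)
      case empty
      then show ?case using J.zero_closed by simp
    next
      case (insert x F)
      then show ?case using J.a_closed[OF tm[of x "lookup p x"]] by simp
    qed
    from this[OF finite_keys order_refl] show "p \<in> Idl\<^bsub>poly_ring n\<^esub> ?X"
      by (subst poly_sum_monomials)
  qed
qed

text \<open>The form in which minimality of a resolution is used: every coordinate of an image has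
  vanishing constant coefficient.\<close>

lemma irrelevant_ideal_eq:
  "irrelevant_ideal n = {p \<in> polys n. lookup p 0 = (0 :: 'k::comm_ring_1)}"
proof -
  have "Var ` {1..n} = (\<lambda>g. single g (1::'k)) ` ((\<lambda>i. single i 1) ` {1..n})"
    by (auto simp: Var_def image_image)
  then have "irrelevant_ideal n = (monomial_set n {g + a |g a. g \<in> (\<lambda>i. single i 1) ` {1..n}} :: 'k mpoly set)"
    unfolding irrelevant_ideal_def by (simp only:) (rule genideal_monomials, auto)
  also have "\<dots> = {p \<in> polys n. lookup p 0 = 0}"
  proof (intro equalityI subsetI CollectI conjI)
    fix p :: "'k mpoly" assume p: "p \<in> monomial_set n {g + a |g a. g \<in> (\<lambda>i. single i 1) ` {1..n}}"
    then show "p \<in> polys n" by (simp add: monomial_set_def)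
    show "lookup p 0 = 0"
    proof (rule ccontr)
      assume "lookup p 0 \<noteq> 0"
      then have "0 \<in> keys p" by (simp add: in_keys_iff)
      then have "0 \<in> {g + a |g a. g \<in> (\<lambda>i. single i (1::nat)) ` {1..n}}"
        using p unfolding monomial_set_def by blast
      then obtain i a where ia: "(0 :: mon) = single i (1::nat) + a" by blast
      have "i \<in> keys (single i (1::nat) + a)" by (simp add: keys_plus_nat)
      then have "i \<in> keys (0 :: mon)" by (simp only: ia[symmetric])
      then show False by simp
    qed
  next
    fix p :: "'k mpoly" assume p: "p \<in> {p \<in> polys n. lookup p 0 = 0}"
    show "p \<in> monomial_set n {g + a |g a. g \<in> (\<lambda>i. single i 1) ` {1..n}}"
      unfolding monomial_set_def
    proof (intro CollectI conjI subsetI)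
      show "p \<in> polys n" using p by simp
      fix m assume m: "m \<in> keys p"
      then have "m \<noteq> 0" using p by (auto simp: in_keys_iff)
      then obtain i where i: "i \<in> keys m" by (metis ex_in_conv keys_eq_empty)
      have "keys m \<subseteq> {1..n}" using p m by (simp add: carrier_poly_ring)
      then have "i \<in> {1..n}" using i by blast
      then show "\<exists>g a. m = g + a \<and> g \<in> (\<lambda>i. single i 1) ` {1..n}"
        using single_le[OF i] by blast
    qed
  qed
  finally show ?thesis .
qed

text \<open>If the support of m is a nonface, the squarefree monomial on it is itself a generator
  and divides m; conversely, a generator dividing m has its nonface inside the support of m. Modulo
  the ideal only coefficients at monomials supported on faces count.\<close>

lemma stanley_reisner_ideal_eq:
  assumes "simplicial_complex n \<Delta>"
  shows "stanley_reisner_ideal n \<Delta>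
    = {p \<in> polys n. \<forall>m\<in>keys p. keys m \<notin> \<Delta>}" (is "_ = ?I")
proof -
  let ?N = "{F. F \<subseteq> {1..n} \<and> F \<notin> \<Delta>}"
  have fin: "finite F" if "F \<in> ?N" for F using that finite_subset[of F "{1..n}"] by auto
  have "{(\<Prod>i\<in>F. Var i) |F. F \<subseteq> {1..n} \<and> F \<notin> \<Delta>} = (\<lambda>g. single g (1::'a)) ` (ind_mon ` ?N)"
  proof -
    have "{(\<Prod>i\<in>F. Var i) |F. F \<subseteq> {1..n} \<and> F \<notin> \<Delta>} = (\<lambda>F. \<Prod>i\<in>F. Var i) ` ?N" by blast
    also have "\<dots> = (\<lambda>F. single (ind_mon F) (1::'a)) ` ?N"
      by (intro image_cong refl prod_Var fin)
    finally show ?thesis by (simp add: image_image)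
  qed
  then have "stanley_reisner_ideal n \<Delta> = (monomial_set n {g + a |g a. g \<in> ind_mon ` ?N} :: 'a mpoly set)"
    unfolding stanley_reisner_ideal_def by (simp only:) (rule genideal_monomials, use fin keys_ind_mon in fastforce)
  also have "\<dots> = ?I"
  proof (intro equalityI subsetI CollectI conjI ballI)
    fix p :: "'a mpoly" assume p: "p \<in> monomial_set n {g + a |g a. g \<in> ind_mon ` ?N}"
    then show "p \<in> polys n" by (simp add: monomial_set_def)
    fix m assume m: "m \<in> keys p"
    then obtain F a where Fa: "m = ind_mon F + a" "F \<in> ?N" using p by (auto simp: monomial_set_def)
    have "F \<subseteq> keys m" using fin Fa by (auto simp: keys_plus_nat)
    moreover have "keys m \<in> \<Delta> \<Longrightarrow> F \<subseteq> keys m \<Longrightarrow> F \<in> \<Delta>" 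
      using assms unfolding simplicial_complex_def by blast
    ultimately show "keys m \<notin> \<Delta>" using Fa by auto
  next
    fix p assume p: "p \<in> ?I"
    show "p \<in> monomial_set n {g + a |g a. g \<in> ind_mon ` ?N}"
      unfolding monomial_set_def
    proof (intro CollectI conjI subsetI)
      show "p \<in> polys n" using p by simp
      fix m assume m: "m \<in> keys p"
      then have "keys m \<in> ?N" using p by (auto simp: carrier_poly_ring)
      moreover obtain a where "m = ind_mon (keys m) + a"
        by (rule ind_mon_le[of "keys m" m]) auto
      ultimately show "\<exists>g a. m = g + a \<and> g \<in> ind_mon ` ?N" by blast
    qed
  qed
  finally show ?thesis .
qed

section \<open>Collapsing a complex with few facets\<close>

text \<open>Induction on \<open>d\<close> via the link \<open>L\<close> of a vertex \<open>v\<close>: if \<open>L\<close> contains the boundary of a simplex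
  on \<open>W\<close>, then each facet \<open>W - {x}\<close> of it contributes one member containing \<open>v\<close> and one not containing
  \<open>v\<close>; otherwise the induction hypothesis applies to \<open>L\<close>.\<close>

lemma card_ge_of_no_free_ridge:
  fixes \<F> :: "'a set set"
  assumes "d \<ge> 1" "finite \<F>" "\<F> \<noteq> {}"
    and "\<And>F. F \<in> \<F> \<Longrightarrow> finite F \<and> card F = d"
    and "\<And>F x. F \<in> \<F> \<Longrightarrow> x \<in> F \<Longrightarrow> \<exists>F'\<in>\<F>. F' \<noteq> F \<and> F - {x} \<subseteq> F'"
    and "\<not> (\<exists>W. finite W \<and> card W = Suc d \<and> (\<forall>x\<in>W. W - {x} \<in> \<F>))"
  shows "2 * d \<le> card \<F>"
  using assms
proof (induction d arbitrary: \<F> rule: nat_induct_at_least)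
  case base
  obtain F where F: "F \<in> \<F>" using base by auto
  then obtain x where x: "x \<in> F" using base.prems(3)[OF F] by fastforce
  obtain F' where F': "F' \<in> \<F>" "F' \<noteq> F" using base.prems(4)[OF F x] by auto
  have "card {F, F'} \<le> card \<F>" using F F' base by (intro card_mono) auto
  then show ?case using F' by auto
next
  case (Suc d)
  note fin = Suc.prems(1) and sz = Suc.prems(3) and ridge = Suc.prems(4) and nofull = Suc.prems(5)
  obtain F0 where F0: "F0 \<in> \<F>" using Suc.prems by auto
  then obtain v where v: "v \<in> F0" using sz[OF F0] by fastforce
  \<comment> \<open>\<open>L\<close> is the link of \<open>v\<close> and \<open>D\<close> the
    deletion; the count splits as |L| + |D|.\<close>
  define L where "L = {G. v \<notin> G \<and> insert v G \<in> \<F>}"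
  define D where "D = {F\<in>\<F>. v \<notin> F}"
  have inj: "inj_on (insert v) L" by (auto simp: inj_on_def L_def)
  have finL: "finite L"
    by (rule finite_imageD[OF finite_subset[OF _ fin] inj]) (auto simp: L_def)
  have \<F>_eq: "\<F> = insert v ` L \<union> D"
  proof (intro equalityI subsetI)
    fix F assume F: "F \<in> \<F>"
    show "F \<in> insert v ` L \<union> D"
    proof (cases "v \<in> F")
      case True
      then have "insert v (F - {v}) = F" by auto
      moreover from this have "F - {v} \<in> L" using F by (simp add: L_def)
      ultimately show ?thesis by (metis UnI1 imageI)
    qed (use F in \<open>auto simp: D_def\<close>)
  qed (auto simp: L_def D_def)
  have finD: "finite D" using fin by (auto simp: D_def)
  have card_\<F>: "card \<F> = card L + card D"
    by (subst \<F>_eq, subst card_Un_disjoint) (use finL finD card_image[OF inj] in \<open>auto simp: D_def\<close>)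
  have szL: "finite G \<and> card G = d" if "G \<in> L" for G
    using sz[of "insert v G"] that by (auto simp: L_def)
  have neL: "L \<noteq> {}"
  proof -
    have "insert v (F0 - {v}) = F0" using v by auto
    then have "F0 - {v} \<in> L" using F0 by (simp add: L_def)
    then show ?thesis by blast
  qed
  have ridgeL: "\<exists>G'\<in>L. G' \<noteq> G \<and> G - {x} \<subseteq> G'" if G: "G \<in> L" and x: "x \<in> G" for G x
  proof -
    have vx: "v \<noteq> x" using G x by (auto simp: L_def)
    obtain F' where F': "F' \<in> \<F>" "F' \<noteq> insert v G" "insert v G - {x} \<subseteq> F'"
      using ridge[of "insert v G" x] G x by (auto simp: L_def)
    have vF': "v \<in> F'" using F'(3) vx by auto
    then have *: "insert v (F' - {v}) = F'" by auto
    then have m: "F' - {v} \<in> L" using F'(1) by (simp add: L_def)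
    have ne: "F' - {v} \<noteq> G" using * F'(2) by metis
    have sub: "G - {x} \<subseteq> F' - {v}" using F'(3) G by (auto simp: L_def)
    show ?thesis by (intro bexI[of _ "F' - {v}"] conjI ne sub m)
  qed
  \<comment> \<open>The ridge \<open>G\<close> of \<open>insert v G\<close> lies in a second member,
    and by cardinality that member cannot contain \<open>v\<close>.\<close>
  have cover: "\<exists>E\<in>D. G \<subseteq> E" if G: "G \<in> L" for G
  proof -
    obtain F' where F': "F' \<in> \<F>" "F' \<noteq> insert v G" "insert v G - {v} \<subseteq> F'"
      using ridge[of "insert v G" v] G by (auto simp: L_def)
    have GF: "G \<subseteq> F'" using F'(3) G by (auto simp: L_def)
    have "v \<notin> F'"
    proof
      assume "v \<in> F'"
      then have "insert v G \<subseteq> F'" using GF by auto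
      then have "insert v G = F'"
        using sz[OF F'(1)] sz[of "insert v G"] G by (intro card_subset_eq) (auto simp: L_def)
      then show False using F'(2) by auto
    qed
    then show ?thesis using GF F'(1) by (auto simp: D_def)
  qed
  \<comment> \<open>If such a \<open>W\<close> were itself a member, all subsets of codimension one
    of \<open>insert v W\<close> would be members.\<close>
  have noW: False if W: "finite W" "card W = Suc d" "v \<notin> W" "W \<in> \<F>" "\<And>x. x \<in> W \<Longrightarrow> W - {x} \<in> L" for W
  proof -
    have "insert v W - {x} \<in> \<F>" if "x \<in> insert v W" for x
    proof (cases "x = v")
      case True
      then show ?thesis using W by simp
    next
      case False
      then have "insert v W - {x} = insert v (W - {x})" by auto
      then show ?thesis using W(5)[of x] that False by (auto simp: L_def)
    qed
    moreover have "finite (insert v W)" "card (insert v W) = Suc (Suc d)" using W by auto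
    ultimately show False using nofull by blast
  qed
  show ?case
  proof (cases "\<exists>W. finite W \<and> card W = Suc d \<and> (\<forall>x\<in>W. W - {x} \<in> L)")
    case False
    have "2 * d \<le> card L"
      by (rule Suc.IH[OF finL neL szL ridgeL]) (use False in auto)
    \<comment> \<open>If \<open>D\<close> had a single member \<open>E\<close>, every member of
      \<open>L\<close> would be some \<open>E - {y}\<close>; the ridge condition in \<open>L\<close>
      then forces all of these into \<open>L\<close>, which \<open>noW\<close> excludes.\<close>
    moreover have "card D \<ge> 2"
    proof (rule ccontr)
      assume "\<not> card D \<ge> 2"
      then have D1: "\<And>a b. a \<in> D \<Longrightarrow> b \<in> D \<Longrightarrow> a = b"
        using card_le_Suc0_iff_eq[OF finD] by auto
      obtain G0 where G0: "G0 \<in> L" using neL by auto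
      obtain E where E: "E \<in> D" "G0 \<subseteq> E" using cover[OF G0] by auto
      have DE: "D = {E}" using D1 E by blast
      have szE: "finite E" "card E = Suc d" "v \<notin> E" "E \<in> \<F>" using E sz by (auto simp: D_def)
      have sub: "\<exists>y\<in>E. G = E - {y}" if G: "G \<in> L" for G
      proof -
        have GE: "G \<subseteq> E" using cover[OF G] DE by auto
        have "card (E - G) = 1" using szL[OF G] szE GE by (simp add: card_Diff_subset)
        then obtain y where "E - G = {y}" by (rule card_1_singletonE)
        then have "y \<in> E" "G = E - {y}" using GE by auto
        then show ?thesis by auto
      qed
      obtain x0 where x0: "x0 \<in> E" "G0 = E - {x0}" using sub[OF G0] by auto
      have "E - {x} \<in> L" if x: "x \<in> E" for x
      proof (cases "x = x0")
        case True
        then show ?thesis using G0 x0 by simp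
      next
        case False
        then have "x \<in> G0" using x x0 by auto
        then obtain G' where G': "G' \<in> L" "G' \<noteq> G0" "G0 - {x} \<subseteq> G'" using ridgeL[OF G0] by blast
        obtain y where y: "y \<in> E" "G' = E - {y}" using sub[OF G'(1)] by auto
        have "y \<noteq> x0" using G'(2) y x0 by auto
        moreover have "y \<notin> G0 - {x}" using G'(3) y by auto
        ultimately have "y = x" using y x0 by auto
        then show ?thesis using y G' by simp
      qed
      from noW[OF szE this] show False .
    qed
    ultimately show ?thesis using card_\<F> by simp
  next
    case True
    then obtain W where W: "finite W" "card W = Suc d" "\<And>x. x \<in> W \<Longrightarrow> W - {x} \<in> L" by auto
    have vW: "v \<notin> W"
    proof
      assume "v \<in> W"
      have "\<exists>x\<in>W. x \<noteq> v"
      proof (rule ccontr)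
        assume "\<not> ?thesis"
        then have "card W \<le> card {v}" by (intro card_mono) auto
        then show False using W(2) Suc.hyps by simp
      qed
      then obtain x where "x \<in> W" "x \<noteq> v" by auto
      then show False using W(3)[of x] \<open>v \<in> W\<close> by (auto simp: L_def)
    qed
    \<comment> \<open>Hence a member covering \<open>W - {x}\<close> and avoiding \<open>v\<close>
      cannot contain \<open>x\<close>. The d + 1 covering members are distinct, and with the d + 1
      sets \<open>W - {x}\<close> of the link they give 2(d + 1).\<close>
    have WF: "W \<notin> \<F>" using noW[OF W(1,2) vW _ W(3)] by blast
    have "\<forall>x\<in>W. \<exists>E. E \<in> D \<and> W - {x} \<subseteq> E" using cover[OF W(3)] by blast
    then obtain E where E: "\<And>x. x \<in> W \<Longrightarrow> E x \<in> D" "\<And>x. x \<in> W \<Longrightarrow> W - {x} \<subseteq> E x" by metis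
    have nx: "x \<notin> E x" if "x \<in> W" for x
    proof
      assume "x \<in> E x"
      then have WE: "W \<subseteq> E x" using E(2)[OF that] by auto
      have "E x \<in> \<F>" using E(1)[OF that] by (auto simp: D_def)
      then have "W = E x" using WE W sz by (intro card_subset_eq) auto
      then show False using WF \<open>E x \<in> \<F>\<close> by simp
    qed
    have "inj_on E W"
    proof (rule inj_onI, rule ccontr)
      fix x y assume xy: "x \<in> W" "y \<in> W" "E x = E y" "x \<noteq> y"
      then have "x \<in> E y" using E(2)[of y] by auto
      then show False using nx[of x] xy by auto
    qed
    then have "card W \<le> card D" using finD E(1) by (intro card_inj_on_le) auto
    moreover have "inj_on (\<lambda>x. W - {x}) W" by (auto simp: inj_on_def)
    then have "card W \<le> card L" using finL W(3) by (intro card_inj_on_le) auto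
    ultimately show ?thesis using W(2) card_\<F> by simp
  qed
qed

text \<open>The interval \<open>[G, F]\<close> removed in a step spans a submodule \<open>k[F](-|G|)\<close> of the Stanley--Reisner
  ring of the whole family.\<close>

inductive collapsible :: "nat \<Rightarrow> nat set set \<Rightarrow> bool" for d where
  empty: "collapsible d {}"
| step: "collapsible d \<Gamma> \<Longrightarrow> G \<subseteq> F \<Longrightarrow> finite F \<Longrightarrow> card F \<le> d \<Longrightarrow> card G < d \<Longrightarrow> (\<And>H. H \<in> \<Gamma> \<Longrightarrow> \<not> G \<subseteq> H)
    \<Longrightarrow> (\<And>H. H \<subseteq> F \<Longrightarrow> \<not> G \<subseteq> H \<Longrightarrow> H \<in> \<Gamma>) \<Longrightarrow> collapsible d (\<Gamma> \<union> {H. G \<subseteq> H \<and> H \<subseteq> F})"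

text \<open>Having few faces of size d and having no full boundary both pass to subcomplexes, so
  strong induction on the number of faces works once an interval can be split off at the top. With
  \<open>d \<ge> 1\<close> a ridge, of size d - 1, is small enough to be the bottom of such an
  interval.\<close>

lemma collapsibleI:
  assumes "d \<ge> 1" "finite \<Gamma>"
    and "\<And>F. F \<in> \<Gamma> \<Longrightarrow> finite F \<and> card F \<le> d"
    and "\<And>F G. F \<in> \<Gamma> \<Longrightarrow> G \<subseteq> F \<Longrightarrow> G \<in> \<Gamma>"
    and "card {F\<in>\<Gamma>. card F = d} < 2 * d"
    and "\<not> (\<exists>W. finite W \<and> card W = Suc d \<and> (\<forall>x\<in>W. W - {x} \<in> \<Gamma>))"
  shows "collapsible d \<Gamma>"
  using assms(2-)
proof (induction "card \<Gamma>" arbitrary: \<Gamma> rule: less_induct)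
  case less
  note fin = less.prems(1) and sz = less.prems(2) and down = less.prems(3)
    and few = less.prems(4) and nofull = less.prems(5)
  have smaller: "collapsible d \<Gamma>'" if sub: "\<Gamma>' \<subset> \<Gamma>" and d: "\<And>F G. F \<in> \<Gamma>' \<Longrightarrow> G \<subseteq> F \<Longrightarrow> G \<in> \<Gamma>'" for \<Gamma>'
  proof (rule less.hyps)
    show "card \<Gamma>' < card \<Gamma>" by (rule psubset_card_mono[OF fin sub])
    have "card {F\<in>\<Gamma>'. card F = d} \<le> card {F\<in>\<Gamma>. card F = d}" using fin sub by (intro card_mono) auto
    then show "card {F \<in> \<Gamma>'. card F = d} < 2 * d" using few by simp
    show "\<not> (\<exists>W. finite W \<and> card W = Suc d \<and> (\<forall>x\<in>W. W - {x} \<in> \<Gamma>'))" using nofull sub by blast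
  qed (use sub d sz finite_subset[OF _ fin] in auto)
  show ?case
  proof (cases "\<Gamma> = {}")
    case True
    then show ?thesis by (simp add: collapsible.empty)
  next
    case ne: False
    define \<F> where "\<F> = {F\<in>\<Gamma>. card F = d}"
    show ?thesis
    proof (cases "\<F> = {}")
      \<comment> \<open>With no face of size d left, a maximal face is smaller than d, and the
        one-element interval from it to itself can be removed.\<close>
      case True
      obtain F where F: "F \<in> \<Gamma>" and max: "\<And>H. H \<in> \<Gamma> \<Longrightarrow> F \<subseteq> H \<Longrightarrow> F = H"
        using finite_has_maximal[OF fin ne] by blast
      have c: "collapsible d (\<Gamma> - {F})"
      proof (rule smaller)
        show "\<Gamma> - {F} \<subset> \<Gamma>" using F by auto
        fix F' G' assume *: "F' \<in> \<Gamma> - {F}" "G' \<subseteq> F'"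
        then have "G' \<in> \<Gamma>" using down by blast
        moreover have "G' \<noteq> F" using * max by auto
        ultimately show "G' \<in> \<Gamma> - {F}" by simp
      qed
      have cF: "card F < d" using True sz[OF F] F by (force simp: \<F>_def)
      have "collapsible d (\<Gamma> - {F} \<union> {H. F \<subseteq> H \<and> H \<subseteq> F})"
        by (rule collapsible.step[OF c]) (use cF sz[OF F] max down[OF F] in auto)
      moreover have "\<Gamma> - {F} \<union> {H. F \<subseteq> H \<and> H \<subseteq> F} = \<Gamma>" using F by auto
      ultimately show ?thesis by simp
    next
      case False
      \<comment> \<open>A free ridge exists: otherwise the counting lemma would give at least 2d
        faces of size d.\<close>
      have "\<exists>F\<in>\<F>. \<exists>x\<in>F. \<forall>F'\<in>\<F>. F - {x} \<subseteq> F' \<longrightarrow> F' = F"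
      proof (rule ccontr)
        assume "\<not> ?thesis"
        then have ridge: "\<And>F x. F \<in> \<F> \<Longrightarrow> x \<in> F \<Longrightarrow> \<exists>F'\<in>\<F>. F' \<noteq> F \<and> F - {x} \<subseteq> F'" by metis
        have nf: "\<not> (\<exists>W. finite W \<and> card W = Suc d \<and> (\<forall>x\<in>W. W - {x} \<in> \<F>))"
          using nofull by (auto simp: \<F>_def)
        have finF: "finite \<F>" and szF: "\<And>F. F \<in> \<F> \<Longrightarrow> finite F \<and> card F = d"
          using fin sz by (auto simp: \<F>_def)
        have "2 * d \<le> card \<F>"
          by (rule card_ge_of_no_free_ridge[OF assms(1) finF False szF ridge nf])
        then show False using few by (simp add: \<F>_def)
      qed
      then obtain F x where F: "F \<in> \<F>" "x \<in> F" and free: "\<And>F'. F' \<in> \<F> \<Longrightarrow> F - {x} \<subseteq> F' \<Longrightarrow> F' = F"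
        by blast
      define G where "G = F - {x}"
      have FG: "F \<in> \<Gamma>" "card F = d" "finite F" "card G = d - 1" "G \<subseteq> F" "G \<in> \<Gamma>"
        using F sz down by (auto simp: \<F>_def G_def)
      \<comment> \<open>Freeness speaks about faces of size d only; a smaller face over
        \<open>G\<close> equals \<open>G\<close>, which already has d - 1 elements.\<close>
      have above: "H = G \<or> H = F" if H: "H \<in> \<Gamma>" "G \<subseteq> H" for H
      proof (cases "card H = d")
        case True
        then show ?thesis using free[of H] H by (auto simp: \<F>_def G_def)
      next
        case False
        then have "card H < d" using sz[OF H(1)] by simp
        then have "card H \<le> card G" using FG by simp
        then show ?thesis using H sz[OF H(1)] by (metis card_seteq)
      qed
      have iv: "{H. G \<subseteq> H \<and> H \<subseteq> F} = {G, F}"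
        using F by (auto simp: G_def)
      have c: "collapsible d (\<Gamma> - {G, F})"
      proof (rule smaller)
        show "\<Gamma> - {G, F} \<subset> \<Gamma>" using FG by auto
        fix F' G' assume *: "F' \<in> \<Gamma> - {G, F}" "G' \<subseteq> F'"
        then have "G' \<in> \<Gamma>" using down by blast
        moreover have "\<not> G \<subseteq> G'" using * above[of F'] by auto
        ultimately show "G' \<in> \<Gamma> - {G, F}" using FG(5) by auto
      qed
      have "collapsible d (\<Gamma> - {G, F} \<union> {H. G \<subseteq> H \<and> H \<subseteq> F})"
        by (rule collapsible.step[OF c]) (use FG assms(1) above down[OF FG(1)] in auto)
      moreover have "\<Gamma> - {G, F} \<union> {H. G \<subseteq> H \<and> H \<subseteq> F} = \<Gamma>" using FG iv by auto
      ultimately show ?thesis by simp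
    qed
  qed
qed

section \<open>Incidence signs and top cohomology of a collapsible complex\<close>

definition ksign :: "nat \<Rightarrow> nat set \<Rightarrow> 'k::comm_ring_1" where
  "ksign l \<tau> = (- 1) ^ card {i\<in>\<tau>. i < l}"

lemma ksign_square [simp]: "ksign l \<tau> * ksign l \<tau> = 1" "ksign l \<tau> * (ksign l \<tau> * c) = c"
  by (simp_all add: ksign_def power_add[symmetric] mult.assoc[symmetric])

text \<open>One sign convention serves the simplicial, Koszul and Cech differentials. Only elements
  below \<open>l\<close> are counted, so the sign ignores \<open>l\<close> itself, and of two
  elements exactly one changes the sign of the other.\<close>

lemma ksign_insert: "finite \<tau> \<Longrightarrow> i \<notin> \<tau> \<Longrightarrow> ksign l (insert i \<tau>) = (if i < l then - ksign l \<tau> else ksign l \<tau>)"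
proof -
  assume fin: "finite \<tau>" "i \<notin> \<tau>"
  have "{j \<in> insert i \<tau>. j < l} = (if i < l then insert i {j\<in>\<tau>. j < l} else {j\<in>\<tau>. j < l})" by auto
  then show ?thesis using fin by (simp add: ksign_def)
qed

lemma ksign_insert_self [simp]: "ksign l (insert l \<tau>) = ksign l \<tau>"
  unfolding ksign_def by (rule arg_cong[of _ _ "\<lambda>X. (- 1) ^ card X"]) auto

lemma ksign_remove_self [simp]: "ksign l (\<tau> - {l}) = ksign l \<tau>"
  unfolding ksign_def by (rule arg_cong[of _ _ "\<lambda>X. (- 1) ^ card X"]) auto

text \<open>The cohomology in dimension d - 1 vanishes. A step that adds a face \<open>F\<close> of
  size d also adds some \<open>F - {x}\<close> containing \<open>G\<close>; the value of
  \<open>b\<close> there is still free and is set so that the equation at \<open>F\<close>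
  holds.\<close>

lemma collapsible_top_cochain:
  fixes c :: "nat set \<Rightarrow> 'k::comm_ring_1"
  assumes "collapsible d \<Gamma>"
  shows "\<exists>b. \<forall>F\<in>\<Gamma>. card F = d \<longrightarrow> (\<Sum>x\<in>F. ksign x F * b (F - {x})) = c F"
  using assms
proof induction
  case empty
  then show ?case by simp
next
  case (step \<Gamma> G F)
  obtain b where b: "\<And>H. H \<in> \<Gamma> \<Longrightarrow> card H = d \<Longrightarrow> (\<Sum>x\<in>H. ksign x H * b (H - {x})) = c H"
    using step.IH by blast
  show ?case
  proof (cases "card F = d")
    case False
    then have "card H \<noteq> d" if "H \<subseteq> F" for H using that step by (metis card_mono le_antisym)
    then show ?thesis using b by (intro exI[of _ b]) auto
  next
    case True
    then obtain x where x: "x \<in> F" "x \<notin> G" using step by (metis card_mono finite_subset not_le subsetI)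
    define b' where "b' = b(F - {x} := ksign x F * (c F - (\<Sum>y\<in>F - {x}. ksign y F * b (F - {y}))))"
    have ne: "F - {y} \<noteq> F - {x}" if "y \<in> F - {x}" for y using that x by auto
    have F: "(\<Sum>y\<in>F. ksign y F * b' (F - {y})) = c F"
    proof -
      have "(\<Sum>y\<in>F. ksign y F * b' (F - {y})) = ksign x F * b' (F - {x}) + (\<Sum>y\<in>F - {x}. ksign y F * b' (F - {y}))"
        by (rule sum.remove) (use x step in auto)
      also have "(\<Sum>y\<in>F - {x}. ksign y F * b' (F - {y})) = (\<Sum>y\<in>F - {x}. ksign y F * b (F - {y}))"
        by (intro sum.cong refl) (use ne in \<open>auto simp: b'_def\<close>)
      finally show ?thesis by (simp add: b'_def)
    qed
    have H: "(\<Sum>y\<in>H. ksign y H * b' (H - {y})) = c H" if H: "H \<in> \<Gamma>" "card H = d" for H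
    proof -
      \<comment> \<open>\<open>F - {x}\<close> contains \<open>G\<close> and no older face does, so
        the older equations do not see the new value.\<close>
      have "H - {y} \<noteq> F - {x}" for y using step.hyps(6)[OF H(1)] x step.hyps(2) by blast
      then have "(\<Sum>y\<in>H. ksign y H * b' (H - {y})) = (\<Sum>y\<in>H. ksign y H * b (H - {y}))"
        by (intro sum.cong refl) (auto simp: b'_def)
      then show ?thesis using b[OF H] by simp
    qed
    have "H = F" if "H \<subseteq> F" "card H = d" for H using that True step by (metis card_subset_eq)
    then show ?thesis using F H by (intro exI[of _ b']) auto
  qed
qed

section \<open>The Koszul complex\<close>

lemma homogeneous_part_iff:
  "p \<in> homogeneous_part n e \<longleftrightarrow>
    (\<forall>m. lookup p m \<noteq> 0 \<longrightarrow> keys m \<subseteq> {1..n} \<and> int (mon_degree m) = e)"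
  by (auto simp: homogeneous_part_def carrier_poly_ring in_keys_iff)

lemma homogeneous_part_carrier [dest]: "p \<in> homogeneous_part n e \<Longrightarrow> p \<in> polys n"
  by (simp add: homogeneous_part_def)

lemma homogeneous_zero [simp]: "0 \<in> homogeneous_part n e"
  by (simp add: homogeneous_part_iff)

lemma homogeneous_add: "p \<in> homogeneous_part n e \<Longrightarrow> q \<in> homogeneous_part n e \<Longrightarrow> p + q \<in> homogeneous_part n e"
  unfolding homogeneous_part_iff lookup_add by (metis add.right_neutral)

lemma homogeneous_uminus: "p \<in> homogeneous_part n e \<Longrightarrow> - p \<in> homogeneous_part n e"
  by (simp add: homogeneous_part_iff)

lemma homogeneous_diff: "p \<in> homogeneous_part n e \<Longrightarrow> q \<in> homogeneous_part n e \<Longrightarrow> p - q \<in> homogeneous_part n e"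
  using homogeneous_add[OF _ homogeneous_uminus, of p n e q] by simp

lemma homogeneous_sum:
  "(\<And>x. x \<in> X \<Longrightarrow> f x \<in> homogeneous_part n e) \<Longrightarrow> sum f X \<in> homogeneous_part n e"
  by (induction X rule: infinite_finite_induct) (auto intro: homogeneous_add)

lemma homogeneous_single: "keys m \<subseteq> {1..n} \<Longrightarrow> int (mon_degree m) = e \<Longrightarrow> single m c \<in> homogeneous_part n e"
  by (auto simp: homogeneous_part_iff lookup_single when_def)

lemma homogeneous_mult:
  assumes "p \<in> homogeneous_part n e" "q \<in> homogeneous_part n e'"
  shows "p * q \<in> homogeneous_part n (e + e')"
  unfolding homogeneous_part_def
proof (intro CollectI conjI ballI)
  show "p * q \<in> polys n" using assms by auto
  fix m assume "m \<in> keys (p * q)"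
  then obtain a b where ab: "m = a + b" "a \<in> keys p" "b \<in> keys q"
    using keys_mult[of p q] by auto
  then have "int (mon_degree a) = e" "int (mon_degree b) = e'"
    using assms by (auto simp: homogeneous_part_def)
  then show "int (mon_degree m) = e + e'" by (simp add: ab mon_degree_plus)
qed

lemma homogeneous_Var: "l \<in> {1..n} \<Longrightarrow> Var l \<in> homogeneous_part n 1"
  unfolding Var_def by (rule homogeneous_single) auto

lemma homogeneous_one: "1 \<in> homogeneous_part n 0"
  using homogeneous_single[of 0 n 0 1] by simp

lemma homogeneous_ksign: "p \<in> homogeneous_part n e \<Longrightarrow> ksign l \<tau> * p \<in> homogeneous_part n e"
proof -
  have "(- 1) ^ k * p \<in> homogeneous_part n e" if "p \<in> homogeneous_part n e" for k
    using that by (induction k) (auto intro: homogeneous_uminus)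
  then show "p \<in> homogeneous_part n e \<Longrightarrow> ksign l \<tau> * p \<in> homogeneous_part n e"
    by (simp add: ksign_def)
qed

text \<open>\<open>ksign\<close> occurs at two types: on the left in the polynomial ring, on the
  right in \<open>'k\<close>.\<close>

lemma lookup_ksign_mult: "lookup (ksign l \<tau> * p) a = ksign l \<tau> * lookup p (a :: mon)"
  for p :: "'k::comm_ring_1 mpoly"
proof -
  have "lookup ((- 1) ^ k * p) a = (- 1) ^ k * lookup p a" for k
    by (induction k) auto
  then show ?thesis by (simp add: ksign_def)
qed

text \<open>The Koszul differential on X_1, ..., X_n with coefficients in S:
  \<open>g \<sigma>\<close> is the coefficient of the exterior basis element e_\<sigma>, and the
  value at \<open>\<tau>\<close> is the coefficient of e_\<tau> in the differential, collected from
  all sets with one more element.\<close>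

definition koszul :: "nat \<Rightarrow> (nat set \<Rightarrow> 'k::comm_ring_1 mpoly) \<Rightarrow> nat set \<Rightarrow> 'k mpoly" where
  "koszul n g \<tau> = (if \<tau> \<subseteq> {1..n} then \<Sum>l\<in>{1..n} - \<tau>. ksign l \<tau> * (Var l * g (insert l \<tau>)) else 0)"

text \<open>\<open>j\<close> is the internal degree of the whole chain; e_\<sigma> has degree
  \<open>p\<close>, so coefficients have degree \<open>j - p\<close>. Chains are functions on all
  sets that vanish off the p-subsets, which keeps sums and differences pointwise.\<close>

definition koszul_chain :: "nat \<Rightarrow> nat \<Rightarrow> int \<Rightarrow> (nat set \<Rightarrow> 'k::comm_ring_1 mpoly) \<Rightarrow> bool" where
  "koszul_chain n p j g \<longleftrightarrow>
    (\<forall>\<sigma>. g \<sigma> \<in> homogeneous_part n (j - int p) \<and> (g \<sigma> \<noteq> 0 \<longrightarrow> \<sigma> \<subseteq> {1..n} \<and> card \<sigma> = p))"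

lemma lookup_koszul:
  "\<tau> \<subseteq> {1..n} \<Longrightarrow> lookup (koszul n g \<tau>) a =
    (\<Sum>l\<in>({1..n} - \<tau>) \<inter> keys a.
      ksign l \<tau> * lookup (g (insert l \<tau>)) (a - single l 1))"
  by (simp add: koszul_def lookup_sum lookup_ksign_mult lookup_Var_times sum.inter_restrict if_distrib cong: if_cong)

lemma koszul_add: "koszul n (\<lambda>\<sigma>. f \<sigma> + g \<sigma>) \<tau> = koszul n f \<tau> + koszul n g \<tau>"
  by (simp add: koszul_def algebra_simps sum.distrib)

lemma koszul_diff: "koszul n (\<lambda>\<sigma>. f \<sigma> - g \<sigma>) \<tau> = koszul n f \<tau> - koszul n g \<tau>"
  by (simp add: koszul_def algebra_simps sum_subtractf)

text \<open>Enlarging \<open>\<tau>\<close> by \<open>l\<close> and \<open>m\<close> in the two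
  orders gives the same coefficient with opposite signs, so the pairs with l < m cancel those with m
  < l.\<close>

lemma koszul_koszul: "koszul n (koszul n g) \<tau> = 0"
proof (cases "\<tau> \<subseteq> {1..n}")
  case True
  then have fin: "finite \<tau>" using finite_subset by blast
  let ?B = "{1..n} - \<tau>"
  define f where "f l m = ksign l \<tau> * (ksign m (insert l \<tau>) * (Var l * (Var m * g (insert m (insert l \<tau>)))))" for l m
  have anti: "f m l = - f l m" if "l \<in> ?B" "m \<in> ?B" "l < m" for l m
    using that fin by (simp add: f_def ksign_insert insert_commute mult.left_commute mult.commute)
  have "koszul n (koszul n g) \<tau> = (\<Sum>l\<in>?B. ksign l \<tau> * (Var l * koszul n g (insert l \<tau>)))"
    using True by (simp add: koszul_def)
  also have "\<dots> = (\<Sum>l\<in>?B. \<Sum>m\<in>?B - {l}. f l m)"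
  proof (rule sum.cong[OF refl])
    fix l assume l: "l \<in> ?B"
    have "{1..n} - insert l \<tau> = ?B - {l}" by auto
    then show "ksign l \<tau> * (Var l * koszul n g (insert l \<tau>)) = (\<Sum>m\<in>?B - {l}. f l m)"
      using l True by (simp add: koszul_def sum_distrib_left f_def mult.left_commute)
  qed
  also have "\<dots> = (\<Sum>(l, m)\<in>(SIGMA l:?B. ?B - {l}). f l m)"
    by (subst sum.Sigma) auto
  also have "(SIGMA l:?B. ?B - {l}) = {(l, m)\<in>?B \<times> ?B. l < m} \<union> {(l, m)\<in>?B \<times> ?B. m < l}"
    by auto
  also have "(\<Sum>(l, m)\<in>\<dots>. f l m) = (\<Sum>(l, m)\<in>{(l, m)\<in>?B \<times> ?B. l < m}. f l m) + (\<Sum>(l, m)\<in>{(l, m)\<in>?B \<times> ?B. m < l}. f l m)"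
    by (rule sum.union_disjoint) (auto intro: finite_subset[of _ "?B \<times> ?B"])
  also have "(\<Sum>(l, m)\<in>{(l, m)\<in>?B \<times> ?B. m < l}. f l m) = (\<Sum>(l, m)\<in>{(l, m)\<in>?B \<times> ?B. l < m}. f m l)"
    by (rule sum.reindex_bij_witness[of _ prod.swap prod.swap]) auto
  also have "\<dots> = (\<Sum>(l, m)\<in>{(l, m)\<in>?B \<times> ?B. l < m}. - f l m)"
    by (rule sum.cong) (auto simp: anti)
  finally show ?thesis by (simp add: case_prod_unfold sum_negf)
qed (simp add: koszul_def)

lemma koszul_chainD:
  assumes "koszul_chain n p j g"
  shows "g \<sigma> \<in> homogeneous_part n (j - int p)" "g \<sigma> \<noteq> 0 \<Longrightarrow> \<sigma> \<subseteq> {1..n}" "g \<sigma> \<noteq> 0 \<Longrightarrow> card \<sigma> = p"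
  using assms by (auto simp: koszul_chain_def)

lemma koszul_chain_diff: "koszul_chain n p j f \<Longrightarrow> koszul_chain n p j g \<Longrightarrow> koszul_chain n p j (\<lambda>\<sigma>. f \<sigma> - g \<sigma>)"
  unfolding koszul_chain_def using homogeneous_diff by (metis diff_self)

lemma koszul_chain_add: "koszul_chain n p j f \<Longrightarrow> koszul_chain n p j g \<Longrightarrow> koszul_chain n p j (\<lambda>\<sigma>. f \<sigma> + g \<sigma>)"
  unfolding koszul_chain_def using homogeneous_add by (metis add_0)

lemma koszul_chain_koszul:
  assumes "koszul_chain n (Suc p) j g"
  shows "koszul_chain n p j (koszul n g)"
  unfolding koszul_chain_def
proof (intro allI conjI impI)
  fix \<sigma>
  have "Var l * g (insert l \<sigma>) \<in> homogeneous_part n (j - int p)" if "l \<in> {1..n}" for l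
    using homogeneous_mult[OF homogeneous_Var[OF that] koszul_chainD(1)[OF assms]] by (simp add: algebra_simps)
  then show "koszul n g \<sigma> \<in> homogeneous_part n (j - int p)"
    by (auto simp: koszul_def intro!: homogeneous_sum homogeneous_ksign)
  assume nz: "koszul n g \<sigma> \<noteq> 0"
  then show s: "\<sigma> \<subseteq> {1..n}" by (auto simp: koszul_def split: if_splits)
  then obtain l where "l \<in> {1..n} - \<sigma>" "g (insert l \<sigma>) \<noteq> 0"
    using nz unfolding koszul_def by (metis (no_types, lifting) mult_zero_right sum.neutral)
  then show "card \<sigma> = p" using koszul_chainD(3)[OF assms, of "insert l \<sigma>"] s finite_subset[OF s] by auto
qed

text \<open>The multidegree is taken relative to the generator x_G and inside \<open>F\<close>:
  exterior factors outside \<open>F\<close> are left out, since their variables act as zero on k[F].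
  Moving a factor of a / x_G into the exterior part does not change the set, so differential and
  homotopy agree on the pivot.\<close>

definition pivot_set :: "nat set \<Rightarrow> nat set \<Rightarrow> nat set \<Rightarrow> mon \<Rightarrow> nat set" where
  "pivot_set G F \<tau> a = keys (a - ind_mon G) \<union> (\<tau> \<inter> F)"

text \<open>The contracting homotopy of the Koszul complex of \<open>k[F](-|G|)\<close>, realised on the monomials \<open>a\<close>
  with \<open>G \<subseteq> supp a \<subseteq> F\<close>: the pivot set is the support of the multidegree, and the
  homotopy moves its least element from the monomial to the exterior part.\<close>

definition homotopy_coeff :: "nat set \<Rightarrow> nat set \<Rightarrow> (nat set \<Rightarrow> 'k::comm_ring_1 mpoly) \<Rightarrow> nat set \<Rightarrow> mon \<Rightarrow> 'k" where
  "homotopy_coeff G F g \<sigma> a =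
    (let v = Min (pivot_set G F \<sigma> a) in
     if G \<subseteq> keys a \<and> keys a \<subseteq> F \<and> pivot_set G F \<sigma> a \<noteq> {} \<and> v \<in> \<sigma>
     then ksign v \<sigma> * lookup (g (\<sigma> - {v})) (a + single v 1) else 0)"

definition homotopy :: "nat \<Rightarrow> nat set \<Rightarrow> nat set \<Rightarrow> (nat set \<Rightarrow> 'k::comm_ring_1 mpoly) \<Rightarrow> nat set \<Rightarrow> 'k mpoly" where
  "homotopy n G F g \<sigma> = (if \<sigma> \<subseteq> {1..n} then Abs_poly_mapping (homotopy_coeff G F g \<sigma>) else 0)"

lemma homotopy_coeff_nonzero:
  assumes "homotopy_coeff G F g \<sigma> a \<noteq> 0"
  obtains v where "v \<in> \<sigma>" "lookup (g (\<sigma> - {v})) (a + single v 1) \<noteq> 0"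
    "G \<subseteq> keys a" "keys a \<subseteq> F"
proof (rule that)
  let ?v = "Min (pivot_set G F \<sigma> a)"
  show "?v \<in> \<sigma>" "G \<subseteq> keys a" "keys a \<subseteq> F"
    using assms by (auto simp: homotopy_coeff_def Let_def split: if_splits)
  show "lookup (g (\<sigma> - {?v})) (a + single ?v 1) \<noteq> 0"
    using assms unfolding homotopy_coeff_def Let_def by (metis mult_zero_right)
qed

text \<open>The content is finiteness of the support: a nonzero coefficient at \<open>a\<close>
  comes from the coefficient at a X_v of one of the finitely many
  \<open>g (\<sigma> - {v})\<close>.\<close>

lemma lookup_homotopy:
  assumes "\<sigma> \<subseteq> {1..n}"
  shows "lookup (homotopy n G F g \<sigma>) = homotopy_coeff G F g \<sigma>"
proof -
  have "{a. homotopy_coeff G F g \<sigma> a \<noteq> 0}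
      \<subseteq> (\<Union>v\<in>\<sigma>. (\<lambda>a. a + single v 1) -` keys (g (\<sigma> - {v})))"
    using homotopy_coeff_nonzero by (smt (verit) UN_I in_keys_iff mem_Collect_eq subsetI vimageI)
  moreover have "finite \<dots>"
    using finite_subset[OF assms] by (auto intro!: finite_vimageI injI)
  ultimately have "finite {a. homotopy_coeff G F g \<sigma> a \<noteq> 0}" by (rule finite_subset)
  then show ?thesis
    using assms by (simp add: homotopy_def)
qed

lemma koszul_chain_homotopy:
  assumes "koszul_chain n p j g"
  shows "koszul_chain n (Suc p) j (homotopy n G F g)"
  unfolding koszul_chain_def
proof (intro allI conjI impI)
  fix \<sigma>
  have *: "keys a \<subseteq> {1..n} \<and> int (mon_degree a) = j - int (Suc p) \<and> \<sigma> \<subseteq> {1..n} \<and> card \<sigma> = Suc p"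
    if a: "lookup (homotopy n G F g \<sigma>) a \<noteq> 0" for a
  proof -
    have s: "\<sigma> \<subseteq> {1..n}" using a by (auto simp: homotopy_def split: if_splits)
    then have fin: "finite \<sigma>" using finite_subset by blast
    from a have "homotopy_coeff G F g \<sigma> a \<noteq> 0" using lookup_homotopy[OF s, of G F g] by simp
    then obtain v where v: "v \<in> \<sigma>" "lookup (g (\<sigma> - {v})) (a + single v 1) \<noteq> 0"
      by (rule homotopy_coeff_nonzero)
    then have "g (\<sigma> - {v}) \<noteq> 0" by auto
    then have "card (\<sigma> - {v}) = p" using koszul_chainD(3)[OF assms] by blast
    then have "card \<sigma> = Suc p" using v fin by (metis card.remove)
    moreover have "keys (a + single v 1) \<subseteq> {1..n}
        \<and> int (mon_degree (a + single v 1)) = j - int p"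
      using koszul_chainD(1)[OF assms, of "\<sigma> - {v}"] v(2) unfolding homogeneous_part_iff by blast
    ultimately show ?thesis using s by (auto simp: keys_plus_nat mon_degree_plus)
  qed
  then show "homotopy n G F g \<sigma> \<in> homogeneous_part n (j - int (Suc p))"
    by (simp add: homogeneous_part_iff)
  assume "homotopy n G F g \<sigma> \<noteq> 0"
  then obtain a where "lookup (homotopy n G F g \<sigma>) a \<noteq> 0"
    by (metis lookup_zero poly_mapping_eqI)
  then show "\<sigma> \<subseteq> {1..n}" "card \<sigma> = Suc p" using * by auto
qed

text \<open>Identities are read only at monomials supported in \<open>\<Gamma>\<close>, that is,
  modulo the Stanley--Reisner ideal. There \<open>g\<close> is a cycle with values in k[F](-|G|),
  whose Koszul homology is spanned by the x_G e_\<sigma> with \<open>\<sigma>\<close> disjoint from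
  \<open>F\<close>. By \<open>const\<close> no such term occurs, and the homotopy exhibits
  \<open>g\<close> as a boundary.\<close>

lemma koszul_homotopy:
  fixes g :: "nat set \<Rightarrow> 'k::comm_ring_1 mpoly"
  assumes F: "F \<subseteq> {1..n}" and GF: "G \<subseteq> F"
    and up: "\<And>H. H \<in> \<Gamma> \<Longrightarrow> G \<subseteq> H \<Longrightarrow> H \<subseteq> F"
    and down: "\<And>H. H \<subseteq> F \<Longrightarrow> H \<in> \<Gamma>"
    and supp: "\<And>\<sigma> a. keys a \<in> \<Gamma> \<Longrightarrow> lookup (g \<sigma>) a \<noteq> 0 \<Longrightarrow> G \<subseteq> keys a"
    and cyc: "\<And>\<tau> a. keys a \<in> \<Gamma> \<Longrightarrow> lookup (koszul n g \<tau>) a = 0"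
    and const: "\<And>\<sigma>. \<sigma> \<inter> F = {} \<Longrightarrow> lookup (g \<sigma>) (ind_mon G) = 0"
    and \<tau>: "\<tau> \<subseteq> {1..n}" and a: "keys a \<in> \<Gamma>"
  shows "lookup (koszul n (homotopy n G F g) \<tau>) a = lookup (g \<tau>) a"
proof -
  have fin: "finite \<tau>" "finite F" "finite G" using finite_subset[OF \<tau>] finite_subset[OF F] finite_subset[OF subset_trans[OF GF F]] by auto
  let ?s = "\<lambda>l. single l (1::nat)"
  have eq: "lookup (koszul n (homotopy n G F g) \<tau>) a =
    (\<Sum>l\<in>({1..n} - \<tau>) \<inter> keys a. ksign l \<tau> * homotopy_coeff G F g (insert l \<tau>) (a - ?s l))"
    using \<tau> by (subst lookup_koszul[OF \<tau>], intro sum.cong refl) (simp add: lookup_homotopy)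
  show ?thesis
  proof (cases "G \<subseteq> keys a")
    \<comment> \<open>Off the interval both sides vanish: dividing by X_l cannot bring
      \<open>G\<close> into the support.\<close>
    case False
    have "homotopy_coeff G F g (insert l \<tau>) (a - ?s l) = 0" for l
    proof -
      have "keys (a - ?s l) \<subseteq> keys a" by (auto simp: in_keys_iff lookup_minus)
      then show ?thesis using False by (auto simp: homotopy_coeff_def Let_def)
    qed
    then show ?thesis using supp[OF a, of \<tau>] False eq by auto
  next
    case G: True
    then have aF: "keys a \<subseteq> F" using up[OF a] by simp
    define K where "K = keys (a - ind_mon G)"
    have KA: "K \<subseteq> keys a" by (auto simp: K_def in_keys_iff lookup_minus)
    \<comment> \<open>If \<open>l\<close> divides \<open>a\<close> but not a / x_G, then
      \<open>l\<close> lies in \<open>G\<close> with exponent 1, and dividing by X_l leaves the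
      interval.\<close>
    have notK: "\<not> G \<subseteq> keys (b - ?s l)"
      if "l \<in> keys a" "l \<notin> K" "lookup b l = lookup a l" for l b
      using that fin by (auto simp: K_def in_keys_iff lookup_minus lookup_ind_mon subset_iff split: if_splits intro!: exI[of _ l])
    have term0: "homotopy_coeff G F g (insert l \<tau>) (a - ?s l) = 0" if "l \<in> keys a" "l \<notin> K" for l
      using notK[OF that refl] by (auto simp: homotopy_coeff_def Let_def)
    define v where "v = Min (pivot_set G F \<tau> a)"
    have term1: "homotopy_coeff G F g (insert l \<tau>) (a - ?s l) =
        (if pivot_set G F \<tau> a \<noteq> {} \<and> v \<in> insert l \<tau>
         then ksign v (insert l \<tau>) * lookup (g (insert l \<tau> - {v})) (a - ?s l + ?s v) else 0)"
      if l: "l \<in> K" "l \<notin> \<tau>" for l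
    proof -
      have "G \<subseteq> keys (a - ?s l)"
        using l G fin by (auto simp: K_def in_keys_iff lookup_minus lookup_ind_mon lookup_single when_def subset_iff split: if_splits)
      moreover have "keys (a - ?s l) \<subseteq> F" using aF by (auto simp: in_keys_iff lookup_minus)
      moreover have "pivot_set G F (insert l \<tau>) (a - ?s l) = pivot_set G F \<tau> a"
        using l KA aF by (auto simp: pivot_set_def K_def in_keys_iff lookup_minus lookup_single when_def split: if_splits)
      ultimately show ?thesis by (simp add: homotopy_coeff_def v_def Let_def)
    qed
    have eq2: "lookup (koszul n (homotopy n G F g) \<tau>) a =
      (\<Sum>l\<in>({1..n} - \<tau>) \<inter> K. ksign l \<tau> * (if pivot_set G F \<tau> a \<noteq> {} \<and> v \<in> insert l \<tau>
         then ksign v (insert l \<tau>) * lookup (g (insert l \<tau> - {v})) (a - ?s l + ?s v) else 0))"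
      unfolding eq
    proof (rule sum.mono_neutral_cong_right)
      show "\<forall>l\<in>({1..n} - \<tau>) \<inter> keys a - ({1..n} - \<tau>) \<inter> K.
          ksign l \<tau> * homotopy_coeff G F g (insert l \<tau>) (a - ?s l) = 0"
        using term0 by (metis (no_types, lifting) DiffE IntD1 IntD2 IntI mult_zero_right)
    qed (use KA term1 in auto)
    have finp: "finite (pivot_set G F \<tau> a)" using fin by (auto simp: pivot_set_def)
    \<comment> \<open>Without a pivot the term is the homology class excluded by
      \<open>const\<close>. A pivot in the monomial leaves only the summand l = v, which returns
      \<open>g \<tau>\<close>. A pivot in the exterior part needs the cycle condition.\<close>
    consider (empty) "pivot_set G F \<tau> a = {}" | (out) "pivot_set G F \<tau> a \<noteq> {}" "v \<notin> \<tau>"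
      | (inn) "pivot_set G F \<tau> a \<noteq> {}" "v \<in> \<tau>" by blast
    then show ?thesis
    proof cases
      case empty
      have "lookup a i = lookup (ind_mon G) i" for i
      proof -
        have "i \<notin> keys (a - ind_mon G)" using empty by (simp add: pivot_set_def)
        then have "lookup a i - lookup (ind_mon G) i = 0"
          by (simp add: in_keys_iff lookup_minus)
        moreover have "i \<in> G \<Longrightarrow> lookup a i \<noteq> 0" using G by (auto simp: in_keys_iff)
        ultimately show ?thesis using fin by (auto simp: lookup_ind_mon split: if_splits)
      qed
      then have "a = ind_mon G" by (rule poly_mapping_eqI)
      moreover have "\<tau> \<inter> F = {}" using empty by (auto simp: pivot_set_def)
      ultimately show ?thesis using eq2 empty const by simp
    next
      case out
      have "v \<in> pivot_set G F \<tau> a" using out finp by (simp add: v_def)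
      then have vK: "v \<in> K" using out by (auto simp: pivot_set_def K_def)
      then have v: "v \<in> ({1..n} - \<tau>) \<inter> K" using out KA aF F by blast
      have "lookup (koszul n (homotopy n G F g) \<tau>) a =
        (\<Sum>l\<in>({1..n} - \<tau>) \<inter> K. if l = v then lookup (g \<tau>) a else 0)"
        unfolding eq2
      proof (intro sum.cong refl)
        fix l assume l: "l \<in> ({1..n} - \<tau>) \<inter> K"
        have "a - ?s v + ?s v = a" using single_le[of v a] vK KA by (auto simp: add.commute)
        moreover have "insert v \<tau> - {v} = \<tau>" using out by auto
        ultimately show "ksign l \<tau> * (if pivot_set G F \<tau> a \<noteq> {} \<and> v \<in> insert l \<tau>
          then ksign v (insert l \<tau>) * lookup (g (insert l \<tau> - {v})) (a - ?s l + ?s v) else 0)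
          = (if l = v then lookup (g \<tau>) a else 0)"
          using out by auto
      qed
      also have "\<dots> = lookup (g \<tau>) a" using v by (simp add: sum.delta)
      finally show ?thesis .
    next
      case inn
      have "v \<in> pivot_set G F \<tau> a" using inn finp by (simp add: v_def)
      then have vF: "v \<in> F" using KA aF by (auto simp: pivot_set_def K_def)
      have vn: "v \<in> {1..n}" using inn \<tau> by blast
      let ?X = "\<lambda>l. lookup (g (insert l \<tau> - {v})) (a - ?s l + ?s v)"
      \<comment> \<open>The cycle condition at \<open>\<tau> - {v}\<close> and the monomial a X_v
        expresses the coefficient of \<open>g \<tau>\<close> at \<open>a\<close> through the
        summands of the homotopy formula.\<close>
      have "keys (a + ?s v) \<in> \<Gamma>" using vF aF by (intro down) (auto simp: keys_plus_nat)
      then have "0 = lookup (koszul n g (\<tau> - {v})) (a + ?s v)" using cyc by simp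
      also have "\<dots> = (\<Sum>l\<in>({1..n} - (\<tau> - {v})) \<inter> keys (a + ?s v).
          ksign l (\<tau> - {v}) * lookup (g (insert l (\<tau> - {v}))) (a + ?s v - ?s l))"
        using \<tau> by (intro lookup_koszul) auto
      also have "({1..n} - (\<tau> - {v})) \<inter> keys (a + ?s v) = insert v (({1..n} - \<tau>) \<inter> keys a)"
        using vn by (auto simp: keys_plus_nat)
      also have "(\<Sum>l\<in>\<dots>. ksign l (\<tau> - {v}) * lookup (g (insert l (\<tau> - {v}))) (a + ?s v - ?s l)) =
         ksign v (\<tau> - {v}) * lookup (g (insert v (\<tau> - {v}))) (a + ?s v - ?s v) +
         (\<Sum>l\<in>({1..n} - \<tau>) \<inter> keys a. ksign l (\<tau> - {v}) * lookup (g (insert l (\<tau> - {v}))) (a + ?s v - ?s l))"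
        using inn by (intro sum.insert) auto
      also have "insert v (\<tau> - {v}) = \<tau>" using inn by auto
      also have "a + ?s v - ?s v = a" by simp
      also have "(\<Sum>l\<in>({1..n} - \<tau>) \<inter> keys a. ksign l (\<tau> - {v}) * lookup (g (insert l (\<tau> - {v}))) (a + ?s v - ?s l))
        = (\<Sum>l\<in>({1..n} - \<tau>) \<inter> K. ksign l (\<tau> - {v}) * ?X l)"
      proof (rule sum.mono_neutral_cong_right)
        show "\<forall>l\<in>({1..n} - \<tau>) \<inter> keys a - ({1..n} - \<tau>) \<inter> K.
          ksign l (\<tau> - {v}) * lookup (g (insert l (\<tau> - {v}))) (a + ?s v - ?s l) = 0"
        proof
          fix l assume l: "l \<in> ({1..n} - \<tau>) \<inter> keys a - ({1..n} - \<tau>) \<inter> K"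
          then have lv: "l \<noteq> v" using inn by auto
          have "\<not> G \<subseteq> keys (a + ?s v - ?s l)"
            using l lv by (intro notK) (auto simp: lookup_add lookup_single when_def)
          moreover have "keys (a + ?s v - ?s l) \<subseteq> insert v (keys a)"
            by (auto simp: in_keys_iff lookup_minus lookup_add lookup_single when_def split: if_splits)
          then have "keys (a + ?s v - ?s l) \<in> \<Gamma>" using aF vF by (intro down) blast
          ultimately show "ksign l (\<tau> - {v}) * lookup (g (insert l (\<tau> - {v}))) (a + ?s v - ?s l) = 0"
            using supp by fastforce
        qed
        fix l assume l: "l \<in> ({1..n} - \<tau>) \<inter> K"
        then have "insert l (\<tau> - {v}) = insert l \<tau> - {v}" using inn by auto
        moreover have "a + ?s v - ?s l = a - ?s l + ?s v"
          using l KA by (auto intro!: poly_mapping_eqI simp: lookup_add lookup_minus lookup_single when_def in_keys_iff subset_iff)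
        ultimately show "ksign l (\<tau> - {v}) * lookup (g (insert l (\<tau> - {v}))) (a + ?s v - ?s l) = ksign l (\<tau> - {v}) * ?X l"
          by simp
      qed (use KA in auto)
      finally have "ksign v \<tau> * (ksign v \<tau> * lookup (g \<tau>) a + (\<Sum>l\<in>({1..n} - \<tau>) \<inter> K. ksign l (\<tau> - {v}) * ?X l)) = 0"
        by simp
      then have g: "lookup (g \<tau>) a = - ksign v \<tau> * (\<Sum>l\<in>({1..n} - \<tau>) \<inter> K. ksign l (\<tau> - {v}) * ?X l)"
        by (simp add: distrib_left eq_neg_iff_add_eq_0)
      \<comment> \<open>Exactly one of the two signs changes: the sign of the larger of
        \<open>l\<close> and \<open>v\<close>.\<close>
      have "ksign l \<tau> * (ksign v (insert l \<tau>) * ?X l) = - ksign v \<tau> * (ksign l (\<tau> - {v}) * ?X l)"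
        if l: "l \<in> ({1..n} - \<tau>) \<inter> K" for l
      proof -
        have lv: "l \<noteq> v" "l \<notin> \<tau>" using l inn by auto
        have "ksign l \<tau> = ksign l (insert v (\<tau> - {v}))" using inn by (simp add: insert_absorb)
        also have "\<dots> = (if v < l then - ksign l (\<tau> - {v}) else ksign l (\<tau> - {v}))"
          using fin by (intro ksign_insert) auto
        finally have 1: "ksign l \<tau> = (if v < l then - ksign l (\<tau> - {v}) else ksign l (\<tau> - {v}) :: 'k)" .
        have 2: "ksign v (insert l \<tau>) = (if l < v then - ksign v \<tau> else ksign v \<tau> :: 'k)"
          using fin lv by (intro ksign_insert) auto
        show ?thesis unfolding 1 2 using lv by (cases "v < l") (auto simp: mult_ac)
      qed
      then show ?thesis unfolding eq2 g using inn by (simp add: sum_distrib_left)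
    qed
  qed
qed

text \<open>Induction along the collapse: the smaller complex is the quotient by k[F](-|G|). After
  subtracting a boundary that settles \<open>\<Gamma>\<close>, the rest of the cycle lives on the
  new interval, where the homotopy applies.\<close>

lemma koszul_exact_collapsible:
  assumes "collapsible d \<Gamma>" "\<Gamma> \<subseteq> Pow {1..n}" "koszul_chain n p j g" "j - int p \<ge> int d"
    and "\<And>\<tau> a. keys a \<in> \<Gamma> \<Longrightarrow> lookup (koszul n g \<tau>) a = 0"
  shows "\<exists>w. koszul_chain n (Suc p) j w \<and>
    (\<forall>\<tau> a. keys a \<in> \<Gamma> \<longrightarrow> lookup (g \<tau> - koszul n w \<tau>) a = 0)"
  using assms
proof (induction)
  case empty
  then show ?case by (intro exI[of _ "\<lambda>_. 0"]) (simp add: koszul_chain_def)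
next
  case (step \<Gamma> G F)
  let ?\<Gamma> = "\<Gamma> \<union> {H. G \<subseteq> H \<and> H \<subseteq> F}"
  have F: "F \<subseteq> {1..n}" using step.prems(1) step.hyps(2) by auto
  obtain w where w: "koszul_chain n (Suc p) j w"
    "\<And>\<tau> a. keys a \<in> \<Gamma> \<Longrightarrow> lookup (g \<tau> - koszul n w \<tau>) a = 0"
    using step.IH step.prems by auto
  define g' where "g' = (\<lambda>\<sigma>. g \<sigma> - koszul n w \<sigma>)"
  have g': "koszul_chain n p j g'"
    unfolding g'_def by (intro koszul_chain_diff step.prems koszul_chain_koszul w)
  have kos: "koszul n g' \<tau> = koszul n g \<tau>" for \<tau>
    by (simp add: g'_def koszul_diff koszul_koszul)
  have *: "lookup (koszul n (homotopy n G F g') \<tau>) a = lookup (g' \<tau>) a"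
    if \<tau>: "\<tau> \<subseteq> {1..n}" and a: "keys a \<in> ?\<Gamma>" for \<tau> a
  proof (rule koszul_homotopy[OF F step.hyps(2), of ?\<Gamma>])
    show "H \<subseteq> F" if "H \<in> ?\<Gamma>" "G \<subseteq> H" for H using that step.hyps(6) by auto
    show "H \<in> ?\<Gamma>" if "H \<subseteq> F" for H using that step.hyps(7) by auto
    show "G \<subseteq> keys b" if "keys b \<in> ?\<Gamma>" "lookup (g' \<sigma>) b \<noteq> 0" for \<sigma> b
      using that w(2)[of b \<sigma>] by (auto simp: g'_def)
    show "lookup (koszul n g' \<tau>) b = 0" if "keys b \<in> ?\<Gamma>" for \<tau> b
      using step.prems(4)[OF that] by (simp add: kos)
    \<comment> \<open>Coefficients have degree j - p >= d, whereas x_G has degree |G| < d.\<close>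
    show "lookup (g' \<sigma>) (ind_mon G) = 0" for \<sigma>
    proof (rule ccontr)
      assume "lookup (g' \<sigma>) (ind_mon G) \<noteq> 0"
      then have "int (mon_degree (ind_mon G)) = j - int p"
        using koszul_chainD(1)[OF g', of \<sigma>] by (simp add: homogeneous_part_iff)
      moreover have "finite G" using step.hyps finite_subset by blast
      ultimately show False using step.prems(3) step.hyps(5) by simp
    qed
  qed (use \<tau> a in auto)
  show ?case
  proof (intro exI[of _ "\<lambda>\<sigma>. w \<sigma> + homotopy n G F g' \<sigma>"] conjI allI impI)
    show "koszul_chain n (Suc p) j (\<lambda>\<sigma>. w \<sigma> + homotopy n G F g' \<sigma>)"
      by (intro koszul_chain_add w koszul_chain_homotopy g')
    fix \<tau> and a :: mon assume a: "keys a \<in> ?\<Gamma>"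
    show "lookup (g \<tau> - koszul n (\<lambda>\<sigma>. w \<sigma> + homotopy n G F g' \<sigma>) \<tau>) a = 0"
    proof (cases "\<tau> \<subseteq> {1..n}")
      case True
      then show ?thesis using *[OF True a] by (simp add: koszul_add g'_def lookup_minus lookup_add)
    next
      case False
      then have "g \<tau> = 0" using koszul_chainD(2)[OF step.prems(2)] by blast
      then show ?thesis using False by (simp add: koszul_def)
    qed
  qed
qed

text \<open>The polynomial ring is the case of the single interval from \<open>{}\<close> to
  \<open>{1..n}\<close>; its only Koszul homology is the constant coefficient of
  \<open>g {}\<close>.\<close>

lemma koszul_exact:
  assumes "koszul_chain n p j g" "\<And>\<tau>. koszul n g \<tau> = 0" "lookup (g {}) 0 = 0"
  shows "\<exists>w. koszul_chain n (Suc p) j w \<and> koszul n w = g"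
proof (intro exI conjI ext poly_mapping_eqI)
  show chain: "koszul_chain n (Suc p) j (homotopy n {} {1..n} g)"
    by (rule koszul_chain_homotopy[OF assms(1)])
  fix \<tau> a
  note k = koszul_chainD(1)[OF koszul_chain_koszul[OF chain], of \<tau>] koszul_chainD(1)[OF assms(1), of \<tau>]
  show "lookup (koszul n (homotopy n {} {1..n} g) \<tau>) a = lookup (g \<tau>) a"
  proof (cases "\<tau> \<subseteq> {1..n} \<and> keys a \<subseteq> {1..n}")
    case True
    show ?thesis
    proof (rule koszul_homotopy[of "{1..n}" n "{}" "Pow {1..n}"])
      show "lookup (g \<sigma>) (ind_mon {}) = 0" if "\<sigma> \<inter> {1..n} = {}" for \<sigma>
      proof (cases "\<sigma> = {}")
        case False
        then have "g \<sigma> = 0" using koszul_chainD(2)[OF assms(1), of \<sigma>] that by blast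
        then show ?thesis by simp
      qed (use assms(3) in \<open>simp add: ind_mon_def\<close>)
    qed (use True assms in auto)
  next
    case False
    then have "\<tau> \<subseteq> {1..n} \<Longrightarrow> lookup (koszul n (homotopy n {} {1..n} g) \<tau>) a = 0
        \<and> lookup (g \<tau>) a = 0"
      using k unfolding homogeneous_part_iff by blast
    moreover have "\<not> \<tau> \<subseteq> {1..n} \<Longrightarrow> g \<tau> = 0" using koszul_chainD(2)[OF assms(1)] by blast
    ultimately show ?thesis by (cases "\<tau> \<subseteq> {1..n}") (auto simp: koszul_def)
  qed
qed

section \<open>The Stanley--Reisner ring\<close>

locale sr_complex =
  fixes n :: nat and \<Delta> :: "nat set set" and A :: "('k::field mpoly, 'k mpoly set) module"
  assumes complex: "simplicial_complex n \<Delta>" and A_def: "A = stanley_reisner_ring n \<Delta>"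
begin

abbreviation SRI :: "'k mpoly set" where "SRI \<equiv> stanley_reisner_ideal n \<Delta>"

text \<open>The residue class map. Elements of \<open>A\<close> are cosets, and every operation on
  them is traded for one on representatives.\<close>

definition q :: "'k mpoly \<Rightarrow> 'k mpoly set" where "q p = SRI +>\<^bsub>poly_ring n\<^esub> p"

lemma I_iff: "p \<in> SRI \<longleftrightarrow> p \<in> polys n \<and> (\<forall>m. keys m \<in> \<Delta> \<longrightarrow> lookup p m = 0)"
  using stanley_reisner_ideal_eq[OF complex, where 'a = 'k] by (auto simp: in_keys_iff)

lemma face_subset: "F \<in> \<Delta> \<Longrightarrow> F \<subseteq> {1..n}" and face_finite: "F \<in> \<Delta> \<Longrightarrow> finite F"
  using complex finite_subset[of F "{1..n}"] by (auto simp: simplicial_complex_def)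

lemma face_down: "F \<in> \<Delta> \<Longrightarrow> G \<subseteq> F \<Longrightarrow> G \<in> \<Delta>"
  using complex by (auto simp: simplicial_complex_def)

lemma finite_\<Delta>: "finite \<Delta>"
  by (rule finite_subset[of _ "Pow {1..n}"]) (use complex in \<open>simp_all add: simplicial_complex_def\<close>)

lemma ideal_I: "ideal SRI (poly_ring n)"
  unfolding stanley_reisner_ideal_def
proof (rule ring.genideal_ideal)
  show "ring (poly_ring n :: 'k mpoly ring)" by (rule cring.axioms(1)[OF cring_poly_ring])
  have "(\<Prod>i\<in>F. Var i :: 'k mpoly) \<in> polys n" if "F \<subseteq> {1..n}" for F
    using finite_subset[OF that] that by (simp add: prod_Var)
  then show "{(\<Prod>i\<in>F. Var i :: 'k mpoly) |F. F \<subseteq> {1..n} \<and> F \<notin> \<Delta>} \<subseteq> polys n" by auto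
qed

sublocale SR: ideal SRI "poly_ring n" by (rule ideal_I)

lemma q_eq_iff: "p \<in> polys n \<Longrightarrow> p' \<in> polys n \<Longrightarrow> q p = q p' \<longleftrightarrow> p - p' \<in> SRI"
  using SR.quotient_eq_iff_same_a_r_cos[OF ideal_I, of p p'] a_minus_poly_ring[of p' n]
  by (simp add: q_def a_minus_def)

lemma q_zero_eq: "q 0 = SRI"
  unfolding q_def by (rule SR.a_rcos_const) (simp add: I_iff)

lemma A_simps:
  "carrier A = q ` polys n" "zero A = q 0" "one A = q 1"
  by (auto simp: A_def stanley_reisner_ring_def quotient_algebra_def ring.extend_def module.fields_def
      FactRing_def A_RCOSETS_def' q_def q_zero_eq[unfolded q_def])

lemma add_q: "p \<in> polys n \<Longrightarrow> p' \<in> polys n \<Longrightarrow> q p \<oplus>\<^bsub>A\<^esub> q p' = q (p + p')"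
  using SR.a_rcos_sum[of p p']
  by (simp add: A_def stanley_reisner_ring_def quotient_algebra_def ring.extend_def module.fields_def FactRing_def q_def)

lemma mult_q: "p \<in> polys n \<Longrightarrow> p' \<in> polys n \<Longrightarrow> q p \<otimes>\<^bsub>A\<^esub> q p' = q (p * p')"
  using SR.rcoset_mult_add[of p p']
  by (simp add: A_def stanley_reisner_ring_def quotient_algebra_def ring.extend_def module.fields_def FactRing_def q_def)

lemma smult_q: "p \<in> polys n \<Longrightarrow> p' \<in> polys n \<Longrightarrow> p \<odot>\<^bsub>A\<^esub> q p' = q (p * p')"
  using SR.rcoset_mult_add[of p p']
  by (simp add: A_def stanley_reisner_ring_def quotient_algebra_def ring.extend_def module.fields_def FactRing_def q_def)

lemma q_eq_zero_iff: "p \<in> polys n \<Longrightarrow> q p = \<zero>\<^bsub>A\<^esub> \<longleftrightarrow> p \<in> SRI"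
  using q_eq_iff[of p 0] by (simp add: A_simps)

lemma q_closed [simp, intro]: "p \<in> polys n \<Longrightarrow> q p \<in> carrier A"
  by (simp add: A_simps)

lemma carrier_A_E:
  assumes "x \<in> carrier A" obtains p where "p \<in> polys n" "x = q p"
  using assms by (auto simp: A_simps)

lemma cring_A: "cring A"
proof (intro cringI abelian_groupI comm_monoidI)
  fix x assume "x \<in> carrier A"
  then obtain p where p: "p \<in> polys n" "x = q p" by (rule carrier_A_E)
  then show "\<exists>y\<in>carrier A. y \<oplus>\<^bsub>A\<^esub> x = \<zero>\<^bsub>A\<^esub>"
    by (intro bexI[of _ "q (- p)"]) (auto simp: add_q A_simps)
qed (auto simp: A_simps add_q mult_q algebra_simps)

sublocale cring A by (rule cring_A)

lemma uminus_q: "p \<in> polys n \<Longrightarrow> \<ominus>\<^bsub>A\<^esub> q p = q (- p)"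
  by (rule minus_equality) (auto simp: add_q A_simps)

lemma pow_q: "p \<in> polys n \<Longrightarrow> q p [^]\<^bsub>A\<^esub> (k::nat) = q (p ^ k) \<and> p ^ k \<in> polys n"
  by (induction k) (auto simp: A_simps mult_q mult.commute)

lemma graded_part_A: "graded_part n A e = q ` homogeneous_part n e"
  unfolding graded_part_def by (intro image_cong refl) (auto simp: A_simps smult_q homogeneous_part_carrier)

lemma var_prod_A: "\<sigma> \<subseteq> {1..n} \<Longrightarrow> var_prod A \<sigma> = q (single (ind_mon \<sigma>) 1)"
  using finite_subset[of \<sigma> "{1..n}"] by (simp add: var_prod_def prod_Var A_simps smult_q)

lemma single_ind_I: "\<sigma> \<subseteq> {1..n} \<Longrightarrow> \<sigma> \<notin> \<Delta> \<Longrightarrow> single (ind_mon \<sigma>) c \<in> SRI"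
  using finite_subset[of \<sigma> "{1..n}"] by (auto simp: I_iff lookup_single when_def)

end

section \<open>Graded free modules\<close>

abbreviation "free_vecs n b \<equiv> carrier (graded_free n b)"

type_synonym 'k fvec = "nat \<times> nat \<Rightarrow>\<^sub>0 'k mpoly"

text \<open>Used for homogeneous components, for setting variables outside a vertex set to 0, and
  for discarding terms supported on nonfaces.\<close>

definition restr :: "('a \<Rightarrow> bool) \<Rightarrow> ('a \<Rightarrow>\<^sub>0 'b::zero) \<Rightarrow> 'a \<Rightarrow>\<^sub>0 'b" where
  "restr P f = Abs_poly_mapping (\<lambda>m. if P m then lookup f m else 0)"

lemma lookup_restr: "lookup (restr P f) m = (if P m then lookup f m else 0)"
proof -
  have "finite {m. (if P m then lookup f m else 0) \<noteq> 0}"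
    by (rule finite_subset[of _ "keys f"]) (auto simp: in_keys_iff)
  then show ?thesis by (simp add: restr_def)
qed

definition hcomp :: "int \<Rightarrow> 'k::zero mpoly \<Rightarrow> 'k mpoly" where
  "hcomp e = restr (\<lambda>m. int (mon_degree m) = e)"

lemma hcomp_homogeneous: "p \<in> polys n \<Longrightarrow> hcomp e p \<in> homogeneous_part n e"
  by (auto simp: homogeneous_part_iff hcomp_def lookup_restr carrier_poly_ring in_keys_iff split: if_splits)

lemma hcomp_of_homogeneous: "p \<in> homogeneous_part n e \<Longrightarrow> hcomp e' p = (if e' = e then p else 0)"
  by (rule poly_mapping_eqI) (auto simp: homogeneous_part_iff hcomp_def lookup_restr)

lemma hcomp_zero [simp]: "hcomp e 0 = 0"
  by (rule poly_mapping_eqI) (auto simp: hcomp_def lookup_restr)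

lemma hcomp_add: "hcomp e (p + p') = hcomp e p + hcomp e p'" for p :: "'k::comm_ring_1 mpoly"
  by (rule poly_mapping_eqI) (auto simp: hcomp_def lookup_restr lookup_add)

text \<open>The scalar multiplication of \<open>graded_free\<close>, named separately because it
  does not depend on the rank function.\<close>

definition smul :: "'k::comm_ring_1 mpoly \<Rightarrow> 'k fvec \<Rightarrow> 'k fvec" where
  "smul p = Poly_Mapping.map ((*) p)"

lemma lookup_smul [simp]: "lookup (smul p f) c = p * lookup f c"
  by (simp add: smul_def map.rep_eq when_def)

lemma smul_add_left: "smul (p + p') f = smul p f + smul p' f"
  and smul_add_right: "smul p (f + f') = smul p f + smul p f'"
  and smul_smul: "smul p (smul p' f) = smul (p * p') f"
  and smul_one [simp]: "smul 1 f = f"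
  and smul_zero_left [simp]: "smul 0 f = 0"
  and smul_zero_right [simp]: "smul p 0 = 0"
  by (rule poly_mapping_eqI, simp add: lookup_add algebra_simps)+

lemma smul_sum_left: "smul (sum g X) f = (\<Sum>x\<in>X. smul (g x) f)"
  by (induction X rule: infinite_finite_induct) (auto simp: smul_add_left)

lemma smul_sum_right: "smul p (sum g X) = (\<Sum>x\<in>X. smul p (g x))"
  by (induction X rule: infinite_finite_induct) (auto simp: smul_add_right)

lemma graded_free_simps [simp]:
  "zero (graded_free n b) = 0" "add (graded_free n b) = (+)" "smult (graded_free n b) = smul"
  by (simp_all add: graded_free_def smul_def fun_eq_iff)

lemma carrier_graded_free:
  "f \<in> free_vecs n b \<longleftrightarrow>
    (\<forall>j l. lookup f (j, l) \<in> polys n \<and> (lookup f (j, l) \<noteq> 0 \<longrightarrow> l < b j))"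
  by (auto simp: graded_free_def in_keys_iff)

lemma graded_free_part_iff:
  "f \<in> graded_free_part n b e \<longleftrightarrow>
    (\<forall>j l. lookup f (j, l) \<in> homogeneous_part n (e - int j) \<and> (lookup f (j, l) \<noteq> 0 \<longrightarrow> l < b j))"
  by (auto simp: graded_free_part_def carrier_graded_free in_keys_iff homogeneous_part_carrier)

lemma graded_free_part_carrier: "f \<in> graded_free_part n b e \<Longrightarrow> f \<in> free_vecs n b"
  by (simp add: graded_free_part_def)

lemma free_closed [simp, intro]:
  shows free_zero_closed: "0 \<in> free_vecs n b"
    and free_add_closed: "f \<in> free_vecs n b \<Longrightarrow> g \<in> free_vecs n b \<Longrightarrow> f + g \<in> free_vecs n b"
    and free_uminus_closed: "f \<in> free_vecs n b \<Longrightarrow> - f \<in> free_vecs n b"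
    and free_diff_closed: "f \<in> free_vecs n b \<Longrightarrow> g \<in> free_vecs n b \<Longrightarrow> f - g \<in> free_vecs n b"
    and free_smul_closed: "p \<in> polys n \<Longrightarrow> f \<in> free_vecs n b \<Longrightarrow> smul p f \<in> free_vecs n b"
proof -
  show "f + g \<in> free_vecs n b" if "f \<in> free_vecs n b" "g \<in> free_vecs n b"
    using that unfolding carrier_graded_free lookup_add by (metis add_0 poly_add_closed)
  show "f - g \<in> free_vecs n b" if "f \<in> free_vecs n b" "g \<in> free_vecs n b"
    using that unfolding carrier_graded_free lookup_minus by (metis diff_self poly_diff_closed)
  show "smul p f \<in> free_vecs n b" if "p \<in> polys n" "f \<in> free_vecs n b"
    using that unfolding carrier_graded_free lookup_smul by (metis mult_zero_right poly_mult_closed)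
qed (auto simp: carrier_graded_free)

lemma free_sum_closed: "(\<And>x. x \<in> X \<Longrightarrow> g x \<in> free_vecs n b) \<Longrightarrow> sum g X \<in> free_vecs n b"
  by (induction X rule: infinite_finite_induct) auto

lemma free_part_closed [simp]:
  shows free_part_zero: "0 \<in> graded_free_part n b e"
    and free_part_add: "f \<in> graded_free_part n b e \<Longrightarrow> g \<in> graded_free_part n b e \<Longrightarrow> f + g \<in> graded_free_part n b e"
    and free_part_diff: "f \<in> graded_free_part n b e \<Longrightarrow> g \<in> graded_free_part n b e \<Longrightarrow> f - g \<in> graded_free_part n b e"
proof -
  show "f + g \<in> graded_free_part n b e" if "f \<in> graded_free_part n b e" "g \<in> graded_free_part n b e"
    using that unfolding graded_free_part_iff lookup_add by (metis add_0 homogeneous_add)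
  show "f - g \<in> graded_free_part n b e" if "f \<in> graded_free_part n b e" "g \<in> graded_free_part n b e"
    using that unfolding graded_free_part_iff lookup_minus by (metis diff_self homogeneous_diff)
qed (auto simp: graded_free_part_iff)

lemma free_part_sum: "(\<And>x. x \<in> X \<Longrightarrow> g x \<in> graded_free_part n b e) \<Longrightarrow> sum g X \<in> graded_free_part n b e"
  by (induction X rule: infinite_finite_induct) auto

lemma free_part_smul:
  assumes "p \<in> homogeneous_part n e" "f \<in> graded_free_part n b e'" "e'' = e + e'"
  shows "smul p f \<in> graded_free_part n b e''"
proof -
  have "p * lookup f (j, l) \<in> homogeneous_part n (e + e' - int j)" for j l
    using homogeneous_mult[OF assms(1), of "lookup f (j, l)" "e' - int j"] assms(2)
    by (simp add: graded_free_part_iff algebra_simps)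
  moreover have "p * lookup f (j, l) \<noteq> 0 \<Longrightarrow> l < b j" for j l
    using assms(2) unfolding graded_free_part_iff by (metis mult_zero_right)
  ultimately show ?thesis using assms(3) by (simp add: graded_free_part_iff)
qed

definition vcomp :: "int \<Rightarrow> 'k::comm_ring_1 fvec \<Rightarrow> 'k fvec" where
  "vcomp e f = Abs_poly_mapping (\<lambda>c. hcomp (e - int (fst c)) (lookup f c))"

lemma lookup_vcomp: "lookup (vcomp e f) c = hcomp (e - int (fst c)) (lookup f c)"
proof -
  have "finite {c. hcomp (e - int (fst c)) (lookup f c) \<noteq> 0}"
    by (rule finite_subset[of _ "keys f"]) (auto simp: in_keys_iff)
  then show ?thesis by (simp add: vcomp_def)
qed

lemma vcomp_zero [simp]: "vcomp e 0 = 0"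
  by (rule poly_mapping_eqI) (simp add: lookup_vcomp)

lemma vcomp_add: "vcomp e (f + g) = vcomp e f + vcomp e g"
  by (rule poly_mapping_eqI) (simp add: lookup_vcomp lookup_add hcomp_add)

lemma vcomp_sum: "vcomp e (sum g X) = (\<Sum>x\<in>X. vcomp e (g x))"
  by (induction X rule: infinite_finite_induct) (auto simp: vcomp_add)

lemma vcomp_part: "f \<in> free_vecs n b \<Longrightarrow> vcomp e f \<in> graded_free_part n b e"
  unfolding graded_free_part_iff carrier_graded_free lookup_vcomp by (metis fst_conv hcomp_homogeneous hcomp_zero)

lemma vcomp_of_part: "f \<in> graded_free_part n b e \<Longrightarrow> vcomp e' f = (if e' = e then f else 0)"
proof (rule poly_mapping_eqI)
  fix c :: "nat \<times> nat"
  assume "f \<in> graded_free_part n b e"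
  then have "lookup f c \<in> homogeneous_part n (e - int (fst c))"
    unfolding graded_free_part_iff by (metis prod.collapse)
  then show "lookup (vcomp e' f) c = lookup (if e' = e then f else 0) c"
    by (simp add: lookup_vcomp hcomp_of_homogeneous)
qed

text \<open>The degrees that occur are j + deg m for the finitely many monomials m in coordinates
  (j, l). Splitting along them reduces questions about arbitrary vectors to homogeneous
  ones.\<close>

lemma vcomp_decomp: "\<exists>E. finite E \<and> (\<forall>e. e \<notin> E \<longrightarrow> vcomp e f = 0) \<and> f = (\<Sum>e\<in>E. vcomp e f)"
proof -
  define E where "E = (\<lambda>(c, m). int (fst c) + int (mon_degree m)) `
    (SIGMA c:keys f. keys (lookup f c))"
  have fin: "finite E" by (simp add: E_def)
  have coeff: "lookup (lookup (vcomp e f) c) m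
    = (if e = int (fst c) + int (mon_degree m) then lookup (lookup f c) m else 0)" for e c m
    by (auto simp: lookup_vcomp hcomp_def lookup_restr)
  have inE: "int (fst c) + int (mon_degree m) \<in> E" if nz: "lookup (lookup f c) m \<noteq> 0" for c m
  proof -
    have "c \<in> keys f" using nz by (auto simp: in_keys_iff)
    then have "(c, m) \<in> (SIGMA c:keys f. keys (lookup f c))"
      using nz by (simp add: in_keys_iff)
    then show ?thesis unfolding E_def by (rule rev_image_eqI) simp
  qed
  have "vcomp e f = 0" if "e \<notin> E" for e
    by (intro poly_mapping_eqI) (use inE that in \<open>auto simp: coeff\<close>)
  moreover have "f = (\<Sum>e\<in>E. vcomp e f)"
    by (intro poly_mapping_eqI) (use inE fin in \<open>auto simp: lookup_sum coeff\<close>)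
  ultimately show ?thesis using fin by blast
qed

lemma module_hom_setD:
  assumes "h \<in> module_hom_set R M N"
  shows "x \<in> carrier M \<Longrightarrow> h x \<in> carrier N"
    "x \<in> carrier M \<Longrightarrow> y \<in> carrier M \<Longrightarrow> h (x \<oplus>\<^bsub>M\<^esub> y) = h x \<oplus>\<^bsub>N\<^esub> h y"
    "r \<in> carrier R \<Longrightarrow> x \<in> carrier M \<Longrightarrow> h (r \<odot>\<^bsub>M\<^esub> x) = r \<odot>\<^bsub>N\<^esub> h x"
  using assms by (auto simp: module_hom_set_def)

section \<open>Degree-preserving maps of graded free modules\<close>

locale free_hom =
  fixes n :: nat and b b' :: "nat \<Rightarrow> nat" and h :: "'k::field fvec \<Rightarrow> 'k fvec"
  assumes hom: "h \<in> module_hom_set (poly_ring n) (graded_free n b) (graded_free n b')"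
    and graded: "\<And>e. h ` graded_free_part n b e \<subseteq> graded_free_part n b' e"
begin

lemma h_closed: "x \<in> free_vecs n b \<Longrightarrow> h x \<in> free_vecs n b'"
  and h_add: "x \<in> free_vecs n b \<Longrightarrow> y \<in> free_vecs n b \<Longrightarrow> h (x + y) = h x + h y"
  and h_smul: "r \<in> polys n \<Longrightarrow> x \<in> free_vecs n b \<Longrightarrow> h (smul r x) = smul r (h x)"
  using module_hom_setD[OF hom] by auto

lemma h_zero [simp]: "h 0 = 0"
  using h_add[of 0 0] by simp

lemma h_diff: "x \<in> free_vecs n b \<Longrightarrow> y \<in> free_vecs n b \<Longrightarrow> h (x - y) = h x - h y"
  using h_add[of "x - y" y] by (simp add: eq_diff_eq)

lemma h_sum: "(\<And>x. x \<in> X \<Longrightarrow> g x \<in> free_vecs n b) \<Longrightarrow> h (sum g X) = (\<Sum>x\<in>X. h (g x))"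
  by (induction X rule: infinite_finite_induct) (auto simp: h_add free_sum_closed)

lemma h_part: "x \<in> graded_free_part n b e \<Longrightarrow> h x \<in> graded_free_part n b' e"
  using graded by blast

lemma h_vcomp:
  assumes f: "f \<in> free_vecs n b"
  shows "h (vcomp e f) = vcomp e (h f)"
proof -
  obtain E where E: "finite E" "\<And>e. e \<notin> E \<Longrightarrow> vcomp e f = 0" "f = (\<Sum>e\<in>E. vcomp e f)"
    using vcomp_decomp[of f] by metis
  have "vcomp e (h f) = vcomp e (\<Sum>e'\<in>E. h (vcomp e' f))"
    by (subst E(3), subst h_sum) (auto intro: graded_free_part_carrier vcomp_part f)
  also have "\<dots> = (\<Sum>e'\<in>E. if e = e' then h (vcomp e' f) else 0)"
    unfolding vcomp_sum by (intro sum.cong refl vcomp_of_part[OF h_part] vcomp_part f)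
  also have "\<dots> = h (vcomp e f)" using E(1,2) by simp
  finally show ?thesis by simp
qed

text \<open>Any preimage can be replaced by its component in degree \<open>e\<close>, since a
  degree-preserving map commutes with taking components.\<close>

lemma graded_lift:
  assumes "x \<in> graded_free_part n b' e" "x \<in> h ` free_vecs n b"
  shows "\<exists>y\<in>graded_free_part n b e. h y = x"
proof -
  obtain y where y: "y \<in> free_vecs n b" "x = h y" using assms by auto
  then have "h (vcomp e y) = x" using h_vcomp[of y e] vcomp_of_part[OF assms(1), of e] by simp
  then show ?thesis using vcomp_part[OF y(1)] by blast
qed

end

text \<open>The Koszul complex with coefficients in a free module; in each coordinate it is
  \<open>koszul\<close>, which transfers exactness.\<close>

definition vkoszul :: "nat \<Rightarrow> (nat set \<Rightarrow> 'k::comm_ring_1 fvec) \<Rightarrow> nat set \<Rightarrow> 'k fvec" where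
  "vkoszul n u \<tau> = (if \<tau> \<subseteq> {1..n} then \<Sum>l\<in>{1..n} - \<tau>. smul (ksign l \<tau> * Var l) (u (insert l \<tau>)) else 0)"

definition vkoszul_chain :: "nat \<Rightarrow> (nat \<Rightarrow> nat) \<Rightarrow> nat \<Rightarrow> int \<Rightarrow> (nat set \<Rightarrow> 'k::comm_ring_1 fvec) \<Rightarrow> bool" where
  "vkoszul_chain n b p j u \<longleftrightarrow>
    (\<forall>\<sigma>. u \<sigma> \<in> graded_free_part n b (j - int p) \<and> (u \<sigma> \<noteq> 0 \<longrightarrow> \<sigma> \<subseteq> {1..n} \<and> card \<sigma> = p))"

lemma lookup_vkoszul: "lookup (vkoszul n u \<tau>) c = koszul n (\<lambda>\<sigma>. lookup (u \<sigma>) c) \<tau>"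
  by (simp add: vkoszul_def koszul_def lookup_sum mult.assoc)

lemma vkoszul_vkoszul [simp]: "vkoszul n (vkoszul n u) \<tau> = 0"
  by (rule poly_mapping_eqI) (simp add: lookup_vkoszul koszul_koszul)

lemma vkoszul_add: "vkoszul n (\<lambda>\<sigma>. u \<sigma> + v \<sigma>) \<tau> = vkoszul n u \<tau> + vkoszul n v \<tau>"
  by (rule poly_mapping_eqI) (simp add: lookup_vkoszul lookup_add koszul_add)

lemma vkoszul_diff: "vkoszul n (\<lambda>\<sigma>. u \<sigma> - v \<sigma>) \<tau> = vkoszul n u \<tau> - vkoszul n v \<tau>"
  by (rule poly_mapping_eqI) (simp add: lookup_vkoszul lookup_minus koszul_diff)

lemma vkoszul_smul: "vkoszul n (\<lambda>\<sigma>. smul (g \<sigma>) f) \<tau> = smul (koszul n g \<tau>) f"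
  by (simp add: vkoszul_def koszul_def smul_smul smul_sum_left mult.assoc)

lemma vkoszul_chainD:
  assumes "vkoszul_chain n b p j u"
  shows "u \<sigma> \<in> graded_free_part n b (j - int p)" "u \<sigma> \<noteq> 0 \<Longrightarrow> \<sigma> \<subseteq> {1..n}" "u \<sigma> \<noteq> 0 \<Longrightarrow> card \<sigma> = p"
    "u \<sigma> \<in> free_vecs n b"
  using assms by (auto simp: vkoszul_chain_def intro: graded_free_part_carrier)

lemma vkoszul_chain_diff:
  "vkoszul_chain n b p j u \<Longrightarrow> vkoszul_chain n b p j v \<Longrightarrow> vkoszul_chain n b p j (\<lambda>\<sigma>. u \<sigma> - v \<sigma>)"
  unfolding vkoszul_chain_def using free_part_diff by (metis diff_self)

lemma vkoszul_chain_coord: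
  assumes "vkoszul_chain n b p j u"
  shows "koszul_chain n p (j - int i) (\<lambda>\<sigma>. lookup (u \<sigma>) (i, l))"
  unfolding koszul_chain_def
proof (intro allI conjI impI)
  fix \<sigma>
  have "lookup (u \<sigma>) (i, l) \<in> homogeneous_part n (j - int p - int i)"
    using vkoszul_chainD(1)[OF assms, of \<sigma>] by (simp add: graded_free_part_iff)
  then show "lookup (u \<sigma>) (i, l) \<in> homogeneous_part n (j - int i - int p)"
    by (simp add: algebra_simps)
  assume "lookup (u \<sigma>) (i, l) \<noteq> 0"
  then have "u \<sigma> \<noteq> 0" by auto
  then show "\<sigma> \<subseteq> {1..n}" "card \<sigma> = p" using vkoszul_chainD[OF assms] by auto
qed

lemma vkoszul_chain_vkoszul:
  assumes "vkoszul_chain n b (Suc p) j u"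
  shows "vkoszul_chain n b p j (vkoszul n u)"
  unfolding vkoszul_chain_def
proof (intro allI conjI impI)
  fix \<sigma>
  have "smul (ksign l \<sigma> * Var l) (u (insert l \<sigma>)) \<in> graded_free_part n b (j - int p)" if "l \<in> {1..n}" for l
    by (rule free_part_smul[OF homogeneous_ksign[OF homogeneous_Var[OF that]] vkoszul_chainD(1)[OF assms]]) simp
  then show "vkoszul n u \<sigma> \<in> graded_free_part n b (j - int p)"
    by (auto simp: vkoszul_def intro!: free_part_sum)
  assume "vkoszul n u \<sigma> \<noteq> 0"
  then obtain i l where "lookup (vkoszul n u \<sigma>) (i, l) \<noteq> 0"
    by (metis lookup_zero poly_mapping_eqI prod.collapse)
  then have "koszul n (\<lambda>\<sigma>. lookup (u \<sigma>) (i, l)) \<sigma> \<noteq> 0" by (simp add: lookup_vkoszul)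
  then show "\<sigma> \<subseteq> {1..n}" "card \<sigma> = p" 
    using koszul_chainD(2,3)[OF koszul_chain_koszul[OF vkoszul_chain_coord[OF assms, of i l]], of \<sigma>] by blast+
qed

lemma vkoszul_exact:
  assumes u: "vkoszul_chain n b p j u" "\<And>\<tau>. vkoszul n u \<tau> = 0"
    and const: "\<And>c. lookup (lookup (u {}) c) 0 = 0"
  shows "\<exists>w. vkoszul_chain n b (Suc p) j w \<and> vkoszul n w = u"
proof -
  \<comment> \<open>Lifts are chosen coordinate by coordinate; taking 0 wherever all of
    \<open>u\<close> vanishes keeps the assembled vectors finitely supported.\<close>
  have "\<exists>w. koszul_chain n (Suc p) (j - int (fst c)) w \<and> koszul n w = (\<lambda>\<sigma>. lookup (u \<sigma>) c)
      \<and> ((\<forall>\<sigma>. lookup (u \<sigma>) c = 0) \<longrightarrow> w = (\<lambda>_. 0))" for c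
  proof (cases "\<forall>\<sigma>. lookup (u \<sigma>) c = 0")
    case True
    then show ?thesis by (intro exI[of _ "\<lambda>_. 0"]) (auto simp: koszul_chain_def koszul_def)
  next
    case False
    have "koszul_chain n p (j - int (fst c)) (\<lambda>\<sigma>. lookup (u \<sigma>) c)"
      using vkoszul_chain_coord[OF u(1), of "fst c" "snd c"] by simp
    moreover have "koszul n (\<lambda>\<sigma>. lookup (u \<sigma>) c) \<tau> = 0" for \<tau>
      using u(2)[of \<tau>] by (metis lookup_vkoszul lookup_zero)
    ultimately show ?thesis using koszul_exact[of n p _ "\<lambda>\<sigma>. lookup (u \<sigma>) c"] const False by blast
  qed
  then obtain W where W: "\<And>c. koszul_chain n (Suc p) (j - int (fst c)) (W c)"
    "\<And>c. koszul n (W c) = (\<lambda>\<sigma>. lookup (u \<sigma>) c)"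
    "\<And>c. (\<forall>\<sigma>. lookup (u \<sigma>) c = 0) \<Longrightarrow> W c = (\<lambda>_. 0)" by metis
  have nz: "\<exists>\<sigma>\<in>Pow {1..n}. c \<in> keys (u \<sigma>)" if "W c \<sigma> \<noteq> 0" for c \<sigma>
  proof -
    have "W c \<noteq> (\<lambda>_. 0)" using that by auto
    then obtain \<rho> where "lookup (u \<rho>) c \<noteq> 0" using W(3)[of c] by blast
    moreover from this have "u \<rho> \<noteq> 0" by auto
    ultimately show ?thesis using vkoszul_chainD(2)[OF u(1), of \<rho>] by (auto simp: in_keys_iff)
  qed
  define w where "w \<sigma> = Abs_poly_mapping (\<lambda>c. W c \<sigma>)" for \<sigma>
  have lw: "lookup (w \<sigma>) c = W c \<sigma>" for \<sigma> c
  proof -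
    have "finite {c. W c \<sigma> \<noteq> 0}"
      by (rule finite_subset[of _ "\<Union>\<sigma>\<in>Pow {1..n}. keys (u \<sigma>)"]) (use nz in auto)
    then show ?thesis by (simp add: w_def)
  qed
  have "vkoszul_chain n b (Suc p) j w"
    unfolding vkoszul_chain_def graded_free_part_iff
  proof (intro allI conjI impI)
    fix \<sigma> i l
    show "lookup (w \<sigma>) (i, l) \<in> homogeneous_part n (j - int (Suc p) - int i)"
      using koszul_chainD(1)[OF W(1)[of "(i, l)"], of \<sigma>] by (simp add: lw algebra_simps)
    assume "lookup (w \<sigma>) (i, l) \<noteq> 0"
    then obtain \<rho> where "lookup (u \<rho>) (i, l) \<noteq> 0" using nz[of "(i, l)" \<sigma>] by (auto simp: lw in_keys_iff)
    then show "l < b i" using vkoszul_chainD(1)[OF u(1), of \<rho>] by (simp add: graded_free_part_iff)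
  next
    fix \<sigma> assume "w \<sigma> \<noteq> 0"
    then obtain c where "lookup (w \<sigma>) c \<noteq> 0" by (metis lookup_zero poly_mapping_eqI)
    then show "\<sigma> \<subseteq> {1..n}" "card \<sigma> = Suc p" using koszul_chainD(2,3)[OF W(1)[of c], of \<sigma>] by (auto simp: lw)
  qed
  moreover have "vkoszul n w = u"
    by (intro ext poly_mapping_eqI) (simp only: lookup_vkoszul lw W(2))
  ultimately show ?thesis by blast
qed

lemma ksign_Var_closed: "l \<in> {1..n} \<Longrightarrow> ksign l \<tau> * Var l \<in> polys n"
  by (rule homogeneous_part_carrier[OF homogeneous_ksign[OF homogeneous_Var]])

lemma (in free_hom) h_vkoszul:
  assumes "\<And>\<sigma>. u \<sigma> \<in> free_vecs n b"
  shows "h (vkoszul n u \<tau>) = vkoszul n (\<lambda>\<sigma>. h (u \<sigma>)) \<tau>"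
proof -
  note k = ksign_Var_closed
  show ?thesis
  proof (cases "\<tau> \<subseteq> {1..n}")
    case True
    have "h (vkoszul n u \<tau>) = (\<Sum>l\<in>{1..n} - \<tau>. h (smul (ksign l \<tau> * Var l) (u (insert l \<tau>))))"
      unfolding vkoszul_def if_P[OF True] by (rule h_sum) (use k assms in blast)
    also have "\<dots> = vkoszul n (\<lambda>\<sigma>. h (u \<sigma>)) \<tau>"
      unfolding vkoszul_def if_P[OF True] by (intro sum.cong refl h_smul) (use k assms in blast)+
    finally show ?thesis .
  qed (simp add: vkoszul_def)
qed

lemma (in free_hom) vkoszul_chain_h: "vkoszul_chain n b p j u \<Longrightarrow> vkoszul_chain n b' p j (\<lambda>\<sigma>. h (u \<sigma>))"
  unfolding vkoszul_chain_def using h_part by (metis h_zero)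

section \<open>Betti numbers from the Koszul complex\<close>

locale sr_resolution = sr_complex n \<Delta> A
  for n :: nat and \<Delta> :: "nat set set" and A :: "('k::field mpoly, 'k mpoly set) module" +
  fixes \<beta> :: "nat \<Rightarrow> nat \<Rightarrow> nat" and \<epsilon> :: "'k fvec \<Rightarrow> 'k mpoly set" and \<phi> :: "nat \<Rightarrow> 'k fvec \<Rightarrow> 'k fvec"
  assumes res: "minimal_graded_free_resolution n A \<beta> \<epsilon> \<phi>"
    and empty_face: "{} \<in> \<Delta>"
begin

lemma \<epsilon>_hom: "\<epsilon> \<in> module_hom_set (poly_ring n) (graded_free n (\<beta> 0)) A"
  and \<epsilon>_part: "\<epsilon> ` graded_free_part n (\<beta> 0) e \<subseteq> graded_part n A e"
  and \<epsilon>_surj: "\<epsilon> ` free_vecs n (\<beta> 0) = carrier A"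
  and \<epsilon>_ker: "a_kernel (graded_free n (\<beta> 0)) A \<epsilon> = \<phi> 0 ` free_vecs n (\<beta> 1)"
  and \<phi>_hom: "\<phi> i \<in> module_hom_set (poly_ring n) (graded_free n (\<beta> (Suc i))) (graded_free n (\<beta> i))"
  and \<phi>_part: "\<phi> i ` graded_free_part n (\<beta> (Suc i)) e \<subseteq> graded_free_part n (\<beta> i) e"
  and \<phi>_ker: "a_kernel (graded_free n (\<beta> (Suc i))) (graded_free n (\<beta> i)) (\<phi> i)
    = \<phi> (Suc i) ` carrier (graded_free n (\<beta> (Suc (Suc i))))"
  and \<phi>_min: "f \<in> free_vecs n (\<beta> (Suc i)) \<Longrightarrow> lookup (\<phi> i f) c \<in> irrelevant_ideal n"
  using res unfolding minimal_graded_free_resolution_def Let_def by (auto simp del: split_paired_All)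

sublocale \<phi>: free_hom n "\<beta> (Suc i)" "\<beta> i" "\<phi> i" for i
  by unfold_locales (rule \<phi>_hom, rule \<phi>_part)

lemma ker_\<epsilon>_iff: "x \<in> free_vecs n (\<beta> 0) \<Longrightarrow> \<epsilon> x = \<zero>\<^bsub>A\<^esub> \<longleftrightarrow> x \<in> \<phi> 0 ` free_vecs n (\<beta> (Suc 0))"
  using \<epsilon>_ker by (auto simp: a_kernel_def' set_eq_iff)

lemma ker_\<phi>_iff: "x \<in> free_vecs n (\<beta> (Suc i)) \<Longrightarrow>
    \<phi> i x = 0 \<longleftrightarrow> x \<in> \<phi> (Suc i) ` carrier (graded_free n (\<beta> (Suc (Suc i))))"
  using \<phi>_ker[of i] by (auto simp: a_kernel_def' set_eq_iff)

lemma \<epsilon>_im: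
  assumes "x \<in> \<phi> 0 ` free_vecs n (\<beta> (Suc 0))"
  shows "\<epsilon> x = \<zero>\<^bsub>A\<^esub>"
proof -
  have "x \<in> free_vecs n (\<beta> 0)" using assms \<phi>.h_closed[of _ 0] by auto
  then show ?thesis using assms by (simp only: ker_\<epsilon>_iff)
qed

lemma \<phi>_im:
  assumes "x \<in> \<phi> (Suc i) ` carrier (graded_free n (\<beta> (Suc (Suc i))))"
  shows "\<phi> i x = 0"
proof -
  have "x \<in> free_vecs n (\<beta> (Suc i))" using assms \<phi>.h_closed[of _ "Suc i"] by auto
  then show ?thesis using assms by (simp only: ker_\<phi>_iff)
qed

lemma \<epsilon>_closed: "x \<in> free_vecs n (\<beta> 0) \<Longrightarrow> \<epsilon> x \<in> carrier A"
  and \<epsilon>_add: "x \<in> free_vecs n (\<beta> 0) \<Longrightarrow> y \<in> free_vecs n (\<beta> 0) \<Longrightarrow> \<epsilon> (x + y) = \<epsilon> x \<oplus>\<^bsub>A\<^esub> \<epsilon> y"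
  and \<epsilon>_smul: "r \<in> polys n \<Longrightarrow> x \<in> free_vecs n (\<beta> 0) \<Longrightarrow> \<epsilon> (smul r x) = r \<odot>\<^bsub>A\<^esub> \<epsilon> x"
  using module_hom_setD[OF \<epsilon>_hom] by auto

lemma \<epsilon>_zero [simp]: "\<epsilon> 0 = q 0"
proof -
  have "\<epsilon> 0 \<oplus>\<^bsub>A\<^esub> \<epsilon> 0 = \<epsilon> 0" using \<epsilon>_add[of 0 0] by simp
  then have "\<epsilon> 0 = \<zero>\<^bsub>A\<^esub>" using \<epsilon>_closed[of 0] add.l_cancel_one by auto
  then show ?thesis by (simp add: A_simps)
qed

lemma \<epsilon>_sum:
  assumes "\<And>x. x \<in> X \<Longrightarrow> f x \<in> free_vecs n (\<beta> 0)" "\<And>x. x \<in> X \<Longrightarrow> g x \<in> polys n"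
    "\<And>x. x \<in> X \<Longrightarrow> \<epsilon> (f x) = q (g x)"
  shows "\<epsilon> (sum f X) = q (sum g X)"
  using assms
  by (induction X rule: infinite_finite_induct) (auto simp: \<epsilon>_add free_sum_closed add_q poly_sum_closed)

lemma \<epsilon>_diff_zero:
  assumes "x \<in> free_vecs n (\<beta> 0)" "y \<in> free_vecs n (\<beta> 0)" "\<epsilon> x = \<epsilon> y"
  shows "x - y \<in> \<phi> 0 ` free_vecs n (\<beta> (Suc 0))"
proof -
  have "\<epsilon> x = \<epsilon> (x - y) \<oplus>\<^bsub>A\<^esub> \<epsilon> y" using \<epsilon>_add[of "x - y" y] assms by simp
  then have "\<epsilon> (x - y) = \<zero>\<^bsub>A\<^esub>"
    using assms \<epsilon>_closed[of y] \<epsilon>_closed[of "x - y"] add.l_cancel_one[of "\<epsilon> y"] 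
    by (metis add.r_cancel_one' free_diff_closed)
  then show ?thesis using assms by (simp add: ker_\<epsilon>_iff)
qed

lemma \<epsilon>_koszul:
  assumes u: "\<And>\<sigma>. u \<sigma> \<in> free_vecs n (\<beta> 0)" "\<And>\<sigma>. g \<sigma> \<in> polys n" "\<And>\<sigma>. \<epsilon> (u \<sigma>) = q (g \<sigma>)"
  shows "\<epsilon> (vkoszul n u \<tau>) = q (koszul n g \<tau>)"
proof (cases "\<tau> \<subseteq> {1..n}")
  case True
  show ?thesis
    unfolding vkoszul_def koszul_def if_P[OF True] mult.assoc[symmetric]
    by (rule \<epsilon>_sum) (simp_all add: u ksign_Var_closed \<epsilon>_smul smult_q poly_mult_closed free_smul_closed)
qed (simp add: vkoszul_def koszul_def)

text \<open>A resolution does not come with an identification of its zeroth module with S, so a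
  homogeneous preimage of 1 has to be found. Among the components of a preimage only the one of
  degree 0 is represented with a constant coefficient, and this must be 1 because
  \<open>{} \<in> \<Delta>\<close> keeps constants out of the ideal.\<close>

lemma unit_generator: "\<exists>f\<in>graded_free_part n (\<beta> 0) 0. \<epsilon> f = q 1"
proof -
  obtain y where y: "y \<in> free_vecs n (\<beta> 0)" "\<epsilon> y = q 1"
    using q_closed[OF poly_one_closed[of n]] unfolding \<epsilon>_surj[symmetric] by (auto simp: image_iff) 
  obtain E where E: "finite E" "\<And>e. e \<notin> E \<Longrightarrow> vcomp e y = 0" "y = (\<Sum>e\<in>E. vcomp e y)"
    using vcomp_decomp[of y] by metis
  have "\<exists>s\<in>homogeneous_part n e. \<epsilon> (vcomp e y) = q s" for e
    using \<epsilon>_part[of e] vcomp_part[OF y(1), of e] by (auto simp: graded_part_A)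
  then obtain s where s: "\<And>e. s e \<in> homogeneous_part n e" "\<And>e. \<epsilon> (vcomp e y) = q (s e)" by metis
  have sc: "s e \<in> polys n" for e using s(1) by blast
  have "q 1 = \<epsilon> (\<Sum>e\<in>E. vcomp e y)" by (simp only: E(3)[symmetric] y(2))
  also have "\<dots> = q (\<Sum>e\<in>E. s e)"
    by (rule \<epsilon>_sum[OF graded_free_part_carrier[OF vcomp_part[OF y(1)]] sc s(2)])
  finally have "q 1 = q (\<Sum>e\<in>E. s e)" .
  moreover have "(\<Sum>e\<in>E. s e) \<in> polys n" by (rule poly_sum_closed[OF sc])
  ultimately have "1 - (\<Sum>e\<in>E. s e) \<in> SRI" using q_eq_iff[OF poly_one_closed] by simp
  then have "lookup (1 - (\<Sum>e\<in>E. s e)) 0 = 0" using empty_face by (simp add: I_iff)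
  then have "(\<Sum>e\<in>E. lookup (s e) 0) = 1" by (simp add: lookup_minus lookup_sum)
  moreover have "lookup (s e) 0 = 0" if "e \<noteq> 0" for e
    using s(1)[of e] that by (auto simp: homogeneous_part_iff)
  then have "(\<Sum>e\<in>E. lookup (s e) 0) = (\<Sum>e\<in>E. if e = 0 then lookup (s 0) 0 else 0)"
    by (intro sum.cong) auto
  ultimately have z: "0 \<in> E" "lookup (s 0) 0 = 1" using E(1) by (auto split: if_splits)
  have "s 0 = 1"
  proof (rule poly_mapping_eqI)
    fix m show "lookup (s 0) m = lookup 1 m"
      using s(1)[of 0] z by (cases "m = 0") (auto simp: homogeneous_part_iff lookup_one when_def)
  qed
  then show ?thesis using s(2)[of 0] vcomp_part[OF y(1), of 0] by auto
qed

definition f1 :: "'k fvec" where "f1 = (SOME f. f \<in> graded_free_part n (\<beta> 0) 0 \<and> \<epsilon> f = q 1)"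

lemma f1: "f1 \<in> graded_free_part n (\<beta> 0) 0" "\<epsilon> f1 = q 1"
  using someI_ex[of "\<lambda>f. f \<in> graded_free_part n (\<beta> 0) 0 \<and> \<epsilon> f = q 1"] unit_generator
  unfolding f1_def by auto

text \<open>Through \<open>f1\<close> every residue class, and every Koszul chain over S, lifts to
  the zeroth free module.\<close>

lemma \<epsilon>_smul_f1: "p \<in> polys n \<Longrightarrow> \<epsilon> (smul p f1) = q p"
  using f1 by (simp add: \<epsilon>_smul graded_free_part_carrier smult_q)

lemma vkoszul_chain_smul_f1:
  assumes "koszul_chain n p j g"
  shows "vkoszul_chain n (\<beta> 0) p j (\<lambda>\<sigma>. smul (g \<sigma>) f1)"
  unfolding vkoszul_chain_def
  using free_part_smul[OF koszul_chainD(1)[OF assms] f1(1)] koszul_chainD(2,3)[OF assms]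
  by (metis add.right_neutral smul_zero_left)

lemma koszul_representative:
  assumes "vkoszul_chain n (\<beta> 0) p j u"
  obtains g where "koszul_chain n p j g" "\<And>\<sigma>. \<epsilon> (u \<sigma>) = q (g \<sigma>)"
proof -
  \<comment> \<open>Representing 0 by 0 is required so that the chosen family is again a
    chain.\<close>
  have "\<exists>s. s \<in> homogeneous_part n (j - int p) \<and> \<epsilon> (u \<sigma>) = q s \<and> (u \<sigma> = 0 \<longrightarrow> s = 0)" for \<sigma>
  proof (cases "u \<sigma> = 0")
    case False
    then show ?thesis
      using \<epsilon>_part[of "j - int p"] vkoszul_chainD(1)[OF assms, of \<sigma>] by (auto simp: graded_part_A)
  qed (auto intro!: exI[of _ 0])
  then obtain g where g: "\<And>\<sigma>. g \<sigma> \<in> homogeneous_part n (j - int p)" "\<And>\<sigma>. \<epsilon> (u \<sigma>) = q (g \<sigma>)" "\<And>\<sigma>. u \<sigma> = 0 \<Longrightarrow> g \<sigma> = 0"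
    by metis
  have "koszul_chain n p j g"
    unfolding koszul_chain_def using g vkoszul_chainD(2,3)[OF assms] by metis
  then show ?thesis using that g(2) by blast
qed

lemma lift_chain:
  assumes "vkoszul_chain n (\<beta> i) p j u" "\<And>\<sigma>. u \<sigma> \<in> \<phi> i ` free_vecs n (\<beta> (Suc i))"
  obtains v where "vkoszul_chain n (\<beta> (Suc i)) p j v" "\<And>\<sigma>. \<phi> i (v \<sigma>) = u \<sigma>"
proof -
  have "\<exists>y. y \<in> graded_free_part n (\<beta> (Suc i)) (j - int p) \<and> \<phi> i y = u \<sigma> \<and> (u \<sigma> = 0 \<longrightarrow> y = 0)" for \<sigma>
  proof (cases "u \<sigma> = 0")
    case False
    then show ?thesis using \<phi>.graded_lift[OF vkoszul_chainD(1)[OF assms(1)] assms(2)] by blast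
  qed (auto intro!: exI[of _ 0])
  then obtain v where v: "\<And>\<sigma>. v \<sigma> \<in> graded_free_part n (\<beta> (Suc i)) (j - int p)" "\<And>\<sigma>. \<phi> i (v \<sigma>) = u \<sigma>"
    "\<And>\<sigma>. u \<sigma> = 0 \<Longrightarrow> v \<sigma> = 0" by metis
  have "vkoszul_chain n (\<beta> (Suc i)) p j v"
    unfolding vkoszul_chain_def using v vkoszul_chainD(2,3)[OF assms(1)] by metis
  then show ?thesis using that v(2) by blast
qed

text \<open>The double complex argument computing \<open>Tor\<close> of \<open>A\<close> and \<open>k\<close> in two ways, by induction along the
  resolution.\<close>

lemma chase:
  assumes coll: "collapsible d \<Delta>"
  shows "vkoszul_chain n (\<beta> i) p j u \<Longrightarrow> (\<And>\<tau>. vkoszul n u \<tau> \<in> \<phi> i ` free_vecs n (\<beta> (Suc i))) \<Longrightarrow>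
    j \<ge> int (p + i + d) \<Longrightarrow>
    \<exists>w v. vkoszul_chain n (\<beta> i) (Suc p) j w \<and> vkoszul_chain n (\<beta> (Suc i)) p j v \<and> (\<forall>\<sigma>. u \<sigma> = vkoszul n w \<sigma> + \<phi> i (v \<sigma>))"
proof (induction i arbitrary: p u)
  case 0
  \<comment> \<open>For i = 0 the claim concerns the Koszul homology of \<open>A\<close> itself: the
    chain is represented over S, where it is a cycle modulo the ideal.\<close>
  obtain g where g: "koszul_chain n p j g" "\<And>\<sigma>. \<epsilon> (u \<sigma>) = q (g \<sigma>)" by (rule koszul_representative[OF 0(1)]) blast
  have gc: "g \<sigma> \<in> polys n" for \<sigma> using koszul_chainD(1)[OF g(1)] by blast
  have kc: "koszul n g \<tau> \<in> polys n" for \<tau>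
    unfolding koszul_def mult.assoc[symmetric]
    by (auto intro!: poly_sum_closed poly_mult_closed ksign_Var_closed gc)
  have "koszul n g \<tau> \<in> SRI" for \<tau>
  proof -
    have "q (koszul n g \<tau>) = \<epsilon> (vkoszul n u \<tau>)"
      using \<epsilon>_koszul[of u g] vkoszul_chainD(4)[OF 0(1)] gc g(2) by simp
    also have "\<dots> = \<zero>\<^bsub>A\<^esub>"
by (rule \<epsilon>_im[OF 0(2)])
    finally show ?thesis using q_eq_zero_iff[OF kc] by simp
  qed
  then have "lookup (koszul n g \<tau>) a = 0" if "keys a \<in> \<Delta>" for \<tau> a
    using that by (simp add: I_iff)
  moreover have "\<Delta> \<subseteq> Pow {1..n}" using face_subset by auto
  \<comment> \<open>The collapse enters here; the bound on \<open>j\<close> reads j - p >= d when i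
    = 0.\<close>
  ultimately obtain w where w: "koszul_chain n (Suc p) j w"
    "\<And>\<tau> a. keys a \<in> \<Delta> \<Longrightarrow> lookup (g \<tau> - koszul n w \<tau>) a = 0"
    using koszul_exact_collapsible[OF coll _ g(1)] 0(3) by fastforce
  have wc: "koszul n w \<tau> \<in> polys n" for \<tau>
    using koszul_chainD(1)[OF koszul_chain_koszul[OF w(1)]] by blast
  define w' where "w' = (\<lambda>\<sigma>. smul (w \<sigma>) f1)"
  have w': "vkoszul_chain n (\<beta> 0) (Suc p) j w'" unfolding w'_def by (rule vkoszul_chain_smul_f1[OF w(1)])
  note kw' = vkoszul_chain_vkoszul[OF w']
  have "u \<sigma> - vkoszul n w' \<sigma> \<in> \<phi> 0 ` free_vecs n (\<beta> (Suc 0))" for \<sigma>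
  proof (rule \<epsilon>_diff_zero)
    show "u \<sigma> \<in> free_vecs n (\<beta> 0)" "vkoszul n w' \<sigma> \<in> free_vecs n (\<beta> 0)"
      using vkoszul_chainD(4)[OF 0(1)] vkoszul_chainD(4)[OF kw'] by auto
    have "\<epsilon> (vkoszul n w' \<sigma>) = q (koszul n w \<sigma>)"
      unfolding w'_def vkoszul_smul by (rule \<epsilon>_smul_f1[OF wc])
    also have "\<dots> = q (g \<sigma>)"
    proof -
      have "g \<sigma> - koszul n w \<sigma> \<in> SRI" using w(2) gc wc unfolding I_iff by auto
      then show ?thesis using q_eq_iff[OF gc wc] by metis
    qed
    finally show "\<epsilon> (u \<sigma>) = \<epsilon> (vkoszul n w' \<sigma>)" using g(2) by simp
  qed
  then obtain v where v: "vkoszul_chain n (\<beta> (Suc 0)) p j v" "\<And>\<sigma>. \<phi> 0 (v \<sigma>) = u \<sigma> - vkoszul n w' \<sigma>"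
    using lift_chain[OF vkoszul_chain_diff[OF 0(1) kw']] by metis
  show ?case using w' v by (intro exI[of _ w'] exI[of _ v]) simp
next
  case (Suc i)
  define x where "x = (\<lambda>\<sigma>. \<phi> i (u \<sigma>))"
  have x: "vkoszul_chain n (\<beta> i) p j x" unfolding x_def by (rule \<phi>.vkoszul_chain_h[OF Suc.prems(1)])
  have uc: "u \<sigma> \<in> free_vecs n (\<beta> (Suc i))" for \<sigma> by (rule vkoszul_chainD(4)[OF Suc.prems(1)])
  have kx: "vkoszul n x \<tau> = 0" for \<tau>
  proof -
    have "vkoszul n x \<tau> = \<phi> i (vkoszul n u \<tau>)" unfolding x_def by (rule \<phi>.h_vkoszul[symmetric, OF uc])
    also have "\<dots> = 0"
by (rule \<phi>_im[OF Suc.prems(2)])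
    finally show ?thesis .
  qed
  \<comment> \<open>Minimality removes the only obstruction to exactness of the Koszul complex over
    the polynomial ring.\<close>
  have "lookup (lookup (x {}) c) 0 = 0" for c
    using \<phi>_min[OF uc, of "{}" c] by (simp add: x_def irrelevant_ideal_eq)
  then obtain y where y: "vkoszul_chain n (\<beta> i) (Suc p) j y" "vkoszul n y = x"
    using vkoszul_exact[OF x kx] by blast
  \<comment> \<open>One step down the resolution costs one step up in Koszul degree, so p + i, and
    with it the bound on \<open>j\<close>, is unchanged.\<close>
  have "\<exists>w v. vkoszul_chain n (\<beta> i) (Suc (Suc p)) j w \<and> vkoszul_chain n (\<beta> (Suc i)) (Suc p) j v
      \<and> (\<forall>\<sigma>. y \<sigma> = vkoszul n w \<sigma> + \<phi> i (v \<sigma>))"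
    by (rule Suc.IH[OF y(1)]) (use Suc.prems(3) uc in \<open>auto simp: y(2) x_def\<close>)
  then obtain w v where wv: "vkoszul_chain n (\<beta> i) (Suc (Suc p)) j w" "vkoszul_chain n (\<beta> (Suc i)) (Suc p) j v"
      "y = (\<lambda>\<sigma>. vkoszul n w \<sigma> + \<phi> i (v \<sigma>))" by blast
  note kv = vkoszul_chain_vkoszul[OF wv(2)]
  have "u \<sigma> - vkoszul n v \<sigma> \<in> \<phi> (Suc i) ` carrier (graded_free n (\<beta> (Suc (Suc i))))" for \<sigma>
  proof -
    have "x \<sigma> = vkoszul n y \<sigma>" by (simp add: y(2))
    also have "\<dots> = vkoszul n (\<lambda>\<sigma>. \<phi> i (v \<sigma>)) \<sigma>"
      unfolding wv(3) vkoszul_add by (simp add: vkoszul_vkoszul[unfolded eta_contract_eq])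
    also have "\<dots> = \<phi> i (vkoszul n v \<sigma>)" by (rule \<phi>.h_vkoszul[symmetric, OF vkoszul_chainD(4)[OF wv(2)]])
    finally have "\<phi> i (u \<sigma> - vkoszul n v \<sigma>) = 0"
      using uc vkoszul_chainD(4)[OF kv] by (simp add: \<phi>.h_diff x_def)
    then show ?thesis using ker_\<phi>_iff[OF free_diff_closed[OF uc vkoszul_chainD(4)[OF kv]]] by simp
  qed
  then obtain v' where v': "vkoszul_chain n (\<beta> (Suc (Suc i))) p j v'" "\<And>\<sigma>. \<phi> (Suc i) (v' \<sigma>) = u \<sigma> - vkoszul n v \<sigma>"
    using lift_chain[OF vkoszul_chain_diff[OF Suc.prems(1) kv]] by metis
  show ?case using wv(2) v' by (intro exI[of _ v] exI[of _ v']) simp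
qed

text \<open>A basis vector of degree \<open>j\<close> is a Koszul 0-chain. If j >= i + d, the chase
  writes it as a combination of the X_l plus a value of \<open>\<phi> i\<close>; by minimality both
  have coordinates without constant coefficient, but the basis vector has a coordinate 1.\<close>

theorem betti_bound:
  assumes coll: "collapsible d \<Delta>" and nz: "\<beta> i j \<noteq> 0"
  shows "j < i + d"
proof (rule ccontr)
  assume "\<not> j < i + d"
  then have ij: "int j \<ge> int (0 + i + d)" by simp
  define e :: "'k fvec" where "e = single (j, 0) 1"
  define u where "u = (\<lambda>\<sigma>::nat set. if \<sigma> = {} then e else 0)"
  have "e \<in> graded_free_part n (\<beta> i) (int j)"
    using nz by (auto simp: graded_free_part_iff e_def lookup_single when_def homogeneous_one)
  then have u: "vkoszul_chain n (\<beta> i) 0 (int j) u"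
    by (auto simp: vkoszul_chain_def u_def)
  have "vkoszul n u \<tau> = 0" for \<tau> by (simp add: vkoszul_def u_def)
  then have "vkoszul n u \<tau> \<in> \<phi> i ` free_vecs n (\<beta> (Suc i))" for \<tau>
    using \<phi>.h_zero[of i] free_zero_closed by (metis imageI)
  then obtain w v where wv: "vkoszul_chain n (\<beta> i) (Suc 0) (int j) w" "vkoszul_chain n (\<beta> (Suc i)) 0 (int j) v"
    "u {} = vkoszul n w {} + \<phi> i (v {})" using chase[OF coll u _ ij] by blast
  have "lookup (lookup (vkoszul n w {}) (j, 0)) 0 = 0"
    by (simp add: lookup_vkoszul lookup_koszul)
  moreover have "lookup (lookup (\<phi> i (v {})) (j, 0)) 0 = 0"
    using \<phi>_min[OF vkoszul_chainD(4)[OF wv(2)]] by (simp add: irrelevant_ideal_eq)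
  ultimately have "lookup (lookup (u {}) (j, 0)) 0 = 0"
    by (simp add: wv(3) lookup_add)
  then show False by (simp add: u_def e_def)
qed

text \<open>For a fixed l0 in \<open>G\<close>, the chain with coefficient x_{G - l0} at e_{l0} has
  differential +-x_G, which is zero in \<open>A\<close>. If \<open>\<beta> 1 (card G)\<close> were
  0, this relation would come from relations of lower degree and the chain would be a boundary over
  \<open>A\<close>, which the minimality of the nonface \<open>G\<close> rules out.\<close>

theorem betti_minimal_nonface:
  assumes G: "G \<subseteq> {1..n}" "G \<notin> \<Delta>" "\<And>l. l \<in> G \<Longrightarrow> G - {l} \<in> \<Delta>"
  shows "\<beta> 1 (card G) \<noteq> 0"
proof
  assume zero: "\<beta> 1 (card G) = 0"
  have fin: "finite G" using finite_subset[OF G(1)] by simp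
  have "G \<noteq> {}" using G(2) empty_face by auto
  then obtain l0 where l0: "l0 \<in> G" by auto
  let ?j = "int (card G)"
  define g :: "nat set \<Rightarrow> 'k mpoly" where
    "g = (\<lambda>\<sigma>. if \<sigma> = {l0} then single (ind_mon (G - {l0})) 1 else 0)"
  have "card (G - {l0}) = card G - 1" "card G > 0" using l0 fin by (auto simp: card_gt_0_iff)
  then have g: "koszul_chain n 1 ?j g"
    unfolding koszul_chain_def g_def using G l0 fin by (auto intro!: homogeneous_single)
  have gc: "g \<sigma> \<in> polys n" for \<sigma> using koszul_chainD(1)[OF g] by blast
  have ind: "single l0 1 + ind_mon (G - {l0}) = ind_mon G"
    using fin l0 by (auto intro!: poly_mapping_eqI simp: lookup_add lookup_single lookup_ind_mon when_def)
  have kg: "koszul n g \<tau> = (if \<tau> = {} then ksign l0 {} * single (ind_mon G) 1 else 0)" for \<tau>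
  proof (cases "\<tau> = {}")
    case True
    have "koszul n g {} = (\<Sum>l\<in>{1..n}. if l = l0 then ksign l0 {} * (Var l0 * g {l0}) else 0)"
    proof -
      have "koszul n g {} = (\<Sum>l\<in>{1..n}. ksign l {} * (Var l * g {l}))" by (simp add: koszul_def)
      also have "\<dots> = (\<Sum>l\<in>{1..n}. if l = l0 then ksign l0 {} * (Var l0 * g {l0}) else 0)"
        by (rule sum.cong) (auto simp: g_def)
      finally show ?thesis .
    qed
    also have "\<dots> = ksign l0 {} * (Var l0 * g {l0})" using l0 G(1) by (simp add: sum.delta subset_iff)
    also have "Var l0 * g {l0} = single (ind_mon G) 1"
      by (simp add: g_def Var_def mult_single ind[simplified])
    finally show ?thesis using True by simp
  next
    case False
    then have "g (insert l \<tau>) = 0" if "l \<notin> \<tau>" for l using that by (auto simp: g_def)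
    then show ?thesis using False by (auto simp: koszul_def intro!: sum.neutral)
  qed
  define u where "u = (\<lambda>\<sigma>. smul (g \<sigma>) f1)"
  have u: "vkoszul_chain n (\<beta> 0) 1 ?j u" unfolding u_def by (rule vkoszul_chain_smul_f1[OF g])
  have ku: "vkoszul n u \<tau> = smul (koszul n g \<tau>) f1" for \<tau> unfolding u_def by (rule vkoszul_smul)
  have "koszul n g {} \<in> SRI" using single_ind_I[OF G(1,2), of 1] by (auto simp: kg ksign_def)
  then have "\<epsilon> (vkoszul n u {}) = \<zero>\<^bsub>A\<^esub>"
    using q_eq_zero_iff[of "koszul n g {}"] by (simp add: ku \<epsilon>_smul_f1 I_iff)
  moreover have kup: "vkoszul n u {} \<in> graded_free_part n (\<beta> 0) ?j"
    using vkoszul_chainD(1)[OF vkoszul_chain_vkoszul[of n "\<beta> 0" 0 ?j u], of "{}"] u by simp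
  ultimately have "vkoszul n u {} \<in> \<phi> 0 ` free_vecs n (\<beta> (Suc 0))"
    using ker_\<epsilon>_iff[OF graded_free_part_carrier] by blast
  then obtain y where y: "y \<in> graded_free_part n (\<beta> (Suc 0)) ?j" "\<phi> 0 y = vkoszul n u {}"
    using \<phi>.graded_lift[OF kup] by blast
  \<comment> \<open>\<open>y\<close> is viewed as a Koszul 0-chain. Without generators of degree
    \<open>card G\<close> its coordinates have no constant coefficient, so exactness writes it as a
    combination of the X_l.\<close>
  define y0 where "y0 = (\<lambda>\<sigma>::nat set. if \<sigma> = {} then y else 0)"
  have y0: "vkoszul_chain n (\<beta> (Suc 0)) 0 ?j y0" using y(1) by (auto simp: vkoszul_chain_def y0_def)
  have "vkoszul n y0 \<tau> = 0" for \<tau> by (simp add: vkoszul_def y0_def)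
  moreover have "lookup (lookup (y0 {}) c) 0 = 0" for c
  proof (rule ccontr)
    assume nz: "lookup (lookup (y0 {}) c) 0 \<noteq> 0"
    obtain i l where c: "c = (i, l)" by force
    have "lookup y (i, l) \<in> homogeneous_part n (?j - int i)"
      and l: "lookup y (i, l) \<noteq> 0 \<longrightarrow> l < \<beta> (Suc 0) i"
      using y(1) by (auto simp: graded_free_part_iff)
    then have "int (mon_degree 0) = ?j - int i" using nz unfolding homogeneous_part_iff by (auto simp: y0_def c)
    then have "i = card G" by simp
    then show False using l nz zero by (auto simp: y0_def c)
  qed
  ultimately obtain y' where y': "vkoszul_chain n (\<beta> (Suc 0)) (Suc 0) ?j y'" "vkoszul n y' = y0"
    using vkoszul_exact[OF y0] by blast
  \<comment> \<open>Correcting \<open>u\<close> by the image of \<open>y'\<close> gives a cycle in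
    the free module, hence a boundary; \<open>\<epsilon>\<close> kills the correction.\<close>
  define u' where "u' = (\<lambda>\<sigma>. u \<sigma> - \<phi> 0 (y' \<sigma>))"
  have u': "vkoszul_chain n (\<beta> 0) 1 ?j u'"
    unfolding u'_def using y'(1) by (intro vkoszul_chain_diff u \<phi>.vkoszul_chain_h) simp
  have "vkoszul n u' \<tau> = 0" for \<tau>
  proof -
    have "vkoszul n u' \<tau> = vkoszul n u \<tau> - \<phi> 0 (vkoszul n y' \<tau>)"
      unfolding u'_def vkoszul_diff using \<phi>.h_vkoszul[of y' 0 \<tau>] vkoszul_chainD(4)[OF y'(1)] by simp
    then show ?thesis using y(2) by (auto simp: y'(2) y0_def ku kg)
  qed
  moreover have "u' {} = 0" using vkoszul_chainD(3)[OF u', of "{}"] by auto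
  ultimately obtain w where w: "vkoszul_chain n (\<beta> 0) (Suc 1) ?j w" "vkoszul n w = u'"
    using vkoszul_exact[OF u'] by (metis lookup_zero)
  obtain h where h: "koszul_chain n (Suc 1) ?j h" "\<And>\<sigma>. \<epsilon> (w \<sigma>) = q (h \<sigma>)" by (rule koszul_representative[OF w(1)]) blast
  have hc: "h \<sigma> \<in> polys n" for \<sigma> using koszul_chainD(1)[OF h(1)] by blast
  have khc: "koszul n h \<sigma> \<in> polys n" for \<sigma> using koszul_chainD(1)[OF koszul_chain_koszul[OF h(1)]] by blast
  have "g \<sigma> - koszul n h \<sigma> \<in> SRI" for \<sigma>
  proof -
    have "q (g \<sigma>) = \<epsilon> (u \<sigma>)" by (simp add: u_def \<epsilon>_smul_f1 gc)
    also have "u \<sigma> = vkoszul n w \<sigma> + \<phi> 0 (y' \<sigma>)" by (simp add: w(2) u'_def)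
    also have "\<epsilon> \<dots> = \<epsilon> (vkoszul n w \<sigma>) \<oplus>\<^bsub>A\<^esub> \<epsilon> (\<phi> 0 (y' \<sigma>))"
      using vkoszul_chainD(4)[OF u'] vkoszul_chainD(4)[OF y'(1)] by (intro \<epsilon>_add \<phi>.h_closed) (auto simp: w(2))
    also have "\<epsilon> (\<phi> 0 (y' \<sigma>)) = \<zero>\<^bsub>A\<^esub>"
by (intro \<epsilon>_im imageI vkoszul_chainD(4)[OF y'(1)])
    also have "\<epsilon> (vkoszul n w \<sigma>) = q (koszul n h \<sigma>)"
      using vkoszul_chainD(4)[OF w(1)] hc h(2) by (intro \<epsilon>_koszul) auto
    finally have "q (g \<sigma>) = q (koszul n h \<sigma>)" using khc by simp
    then show ?thesis using q_eq_iff[OF gc khc] by simp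
  qed
  then have face: "keys a \<in> \<Delta> \<Longrightarrow> lookup (g \<sigma> - koszul n h \<sigma>) a = 0" for a \<sigma> by (simp add: I_iff)
  \<comment> \<open>Two evaluations at x_G: the differential of \<open>g\<close> gives +-1, while
    each summand is a coefficient at x_{G - l}, which vanishes because \<open>G - {l}\<close> is a
    face.\<close>
  have "koszul n (\<lambda>\<sigma>. g \<sigma> - koszul n h \<sigma>) {} = ksign l0 {} * single (ind_mon G) 1"
    by (simp add: koszul_diff koszul_koszul kg)
  then have "lookup (koszul n (\<lambda>\<sigma>. g \<sigma> - koszul n h \<sigma>) {}) (ind_mon G) = ksign l0 {}"
    by (simp add: lookup_ksign_mult)
  moreover have "lookup (koszul n (\<lambda>\<sigma>. g \<sigma> - koszul n h \<sigma>) {}) (ind_mon G) = 0"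
  proof (subst lookup_koszul, simp, rule sum.neutral, rule ballI)
    fix l assume "l \<in> ({1..n} - {}) \<inter> keys (ind_mon G)"
    then have l: "l \<in> G" using fin by simp
    have "keys (ind_mon G - single l 1) = G - {l}"
      using fin by (auto simp: in_keys_iff lookup_minus lookup_ind_mon lookup_single when_def split: if_splits)
    then show "ksign l {} * lookup (g (insert l {}) - koszul n h (insert l {})) (ind_mon G - single l 1) = 0"
      using face[of "ind_mon G - single l 1"] G(3)[OF l] by simp
  qed
  ultimately show False by (simp add: ksign_def)
qed

end

section \<open>Existence of minimal graded free resolutions\<close>

lemma finite_monomials:
  assumes "finite V"
  shows "finite {m :: mon. keys m \<subseteq> V \<and> mon_degree m = k}"
proof (rule inj_on_finite)
  let ?f = "\<lambda>m. restrict (lookup m) V"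
  show "inj_on ?f {m. keys m \<subseteq> V \<and> mon_degree m = k}"
  proof (rule inj_onI)
    fix a b assume a: "a \<in> {m. keys m \<subseteq> V \<and> mon_degree m = k}"
      and b: "b \<in> {m. keys m \<subseteq> V \<and> mon_degree m = k}" and ab: "?f a = ?f b"
    show "a = b"
    proof (rule poly_mapping_eqI)
      fix i show "lookup a i = lookup b i"
      proof (cases "i \<in> V")
        case True
        then show ?thesis using fun_cong[OF ab, of i] by simp
      next
        case False
        then have "i \<notin> keys a" "i \<notin> keys b" using a b by blast+
        then show ?thesis by (simp add: in_keys_iff)
      qed
    qed
  qed
  show "?f ` {m. keys m \<subseteq> V \<and> mon_degree m = k} \<subseteq> PiE V (\<lambda>_. {..k})"
  proof -
    have "lookup m i \<le> mon_degree m" for m :: mon and i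
      by (cases "i \<in> keys m") (auto simp: mon_degree_def in_keys_iff intro: member_le_sum)
    then show ?thesis by auto
  qed
qed (auto intro: finite_PiE assms)

text \<open>Degree components are treated as vector spaces over the constants, so that bases can be
  chosen in them.\<close>

definition vscale :: "'k::field \<Rightarrow> 'k fvec \<Rightarrow> 'k fvec" where
  "vscale c f = smul (single 0 c) f"

interpretation vs: vector_space vscale
  by unfold_locales
    (simp_all add: vscale_def smul_add_right smul_smul mult_single single_add smul_add_left)

lemma free_part_negative:
  assumes "f \<in> graded_free_part n b e" "e < 0"
  shows "f = 0"
proof (rule poly_mapping_eqI, rule poly_mapping_eqI)
  fix c m
  have "lookup f c \<in> homogeneous_part n (e - int (fst c))"
    using assms(1) unfolding graded_free_part_iff by (metis prod.collapse)
  then show "lookup (lookup f c) m = lookup (lookup 0 c) m"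
    using assms(2) by (auto simp: homogeneous_part_iff)
qed

lemma homogeneous_negative: "p \<in> homogeneous_part n e \<Longrightarrow> e < 0 \<Longrightarrow> p = 0"
  by (rule poly_mapping_eqI) (auto simp: homogeneous_part_iff)

lemma homogeneous_const:
  assumes "p \<in> homogeneous_part n 0"
  shows "p = single 0 (lookup p 0)"
  using assms by (intro poly_mapping_eqI) (auto simp: homogeneous_part_iff lookup_single when_def)

lemma single_sum: "single c (sum g X) = (\<Sum>x\<in>X. single c (g x))"
  for g :: "'a \<Rightarrow> 'b::comm_monoid_add"
  by (induction X rule: infinite_finite_induct) (auto simp: single_add)

text \<open>The ranks of a resolution are natural numbers in each degree, so the generators chosen
  in one degree must be finitely many.\<close>

lemma free_part_finite_span:
  "\<exists>M. finite M \<and> graded_free_part n b (int e) \<subseteq> vs.span (M :: 'k::field fvec set)"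
proof (intro exI conjI subsetI)
  let ?C = "SIGMA j:{..e}. {..<b j}"
  let ?M = "\<Union>c\<in>?C. (\<lambda>m. single c (single m 1)) `
    {m. keys m \<subseteq> {1..n} \<and> mon_degree m = e - fst c}"
  show "finite ?M" using finite_monomials[OF finite_atLeastAtMost] by auto
  fix f :: "'k fvec" assume f: "f \<in> graded_free_part n b (int e)"
  have "single c (single m a) \<in> vs.span ?M"
    if c: "c \<in> keys f" and m: "m \<in> keys (lookup f c)" for c m a
  proof -
    obtain j l where jl: "c = (j, l)" by force
    have "lookup f (j, l) \<in> homogeneous_part n (int e - int j)" "l < b j"
      using f c by (auto simp: graded_free_part_iff jl in_keys_iff)
    then have "keys m \<subseteq> {1..n}" "int (mon_degree m) = int e - int j" "l < b j"
      using m by (auto simp: homogeneous_part_iff jl in_keys_iff simp del: atLeastAtMost_iff)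
    moreover from this have "j \<le> e" "mon_degree m = e - j" by auto
    ultimately have "single c (single m 1) \<in> ?M"
      unfolding jl by (intro UN_I[of "(j, l)"] imageI) auto
    then have "vscale a (single c (single m 1)) \<in> vs.span ?M"
      by (intro vs.span_scale vs.span_base)
    moreover have "vscale a (single c (single m 1)) = single c (single m a)"
      by (rule poly_mapping_eqI) (simp add: vscale_def lookup_single when_def mult_single)
    ultimately show ?thesis by simp
  qed
  then have "(\<Sum>c\<in>keys f. \<Sum>m\<in>keys (lookup f c).
      single c (single m (lookup (lookup f c) m))) \<in> vs.span ?M"
    by (intro vs.span_sum) auto
  also have "(\<Sum>c\<in>keys f. \<Sum>m\<in>keys (lookup f c).
      single c (single m (lookup (lookup f c) m))) = f"
    unfolding single_sum[symmetric] poly_sum_monomials[symmetric] ..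
  finally show "f \<in> vs.span ?M" .
qed

locale graded_submodule =
  fixes n :: nat and b :: "nat \<Rightarrow> nat" and N :: "'k::field fvec set"
  assumes N_carrier: "N \<subseteq> free_vecs n b"
    and N_zero: "0 \<in> N"
    and N_add: "f \<in> N \<Longrightarrow> f' \<in> N \<Longrightarrow> f + f' \<in> N"
    and N_smul: "p \<in> polys n \<Longrightarrow> f \<in> N \<Longrightarrow> smul p f \<in> N"
    and N_vcomp: "f \<in> N \<Longrightarrow> vcomp e f \<in> N"
begin

lemma N_sum: "(\<And>x. x \<in> X \<Longrightarrow> f x \<in> N) \<Longrightarrow> sum f X \<in> N"
  by (induction X rule: infinite_finite_induct) (auto simp: N_add N_zero)

lemma N_scale: "f \<in> N \<Longrightarrow> vscale c f \<in> N"
  unfolding vscale_def by (rule N_smul) auto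

text \<open>The degree \<open>e\<close> part of the irrelevant ideal times \<open>N\<close>; a
  complement in \<open>N\<close> provides the minimal generators of degree \<open>e\<close>.\<close>

definition dec :: "nat \<Rightarrow> 'k fvec set" where
  "dec e = vs.span {smul (Var l) f |l f. l \<in> {1..n} \<and> f \<in> N \<inter> graded_free_part n b (int e - 1)}"

lemma dec_subset: "dec e \<subseteq> N \<inter> graded_free_part n b (int e)"
  unfolding dec_def
proof (rule vs.span_minimal)
  show "{smul (Var l) f |l f. l \<in> {1..n} \<and> f \<in> N \<inter> graded_free_part n b (int e - 1)} \<subseteq> N \<inter> graded_free_part n b (int e)"
    by (auto intro!: N_smul free_part_smul[OF homogeneous_Var])
  show "vs.subspace (N \<inter> graded_free_part n b (int e))"
    unfolding vs.subspace_def
    by (auto simp: N_zero N_add N_scale vscale_def intro!: N_smul free_part_smul[of _ _ 0] homogeneous_single)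
qed

lemma dec_smul:
  assumes h: "h \<in> homogeneous_part n (int e - int j)" and j: "j < e" and f: "f \<in> N \<inter> graded_free_part n b (int j)"
  shows "smul h f \<in> dec e"
proof -
  have tm: "smul (single m c) f \<in> dec e" if m: "m \<in> keys h" for m c
  proof -
    have km: "keys m \<subseteq> {1..n}" "int (mon_degree m) = int e - int j"
      using h m unfolding homogeneous_part_iff in_keys_iff by blast+
    then have "m \<noteq> 0" using j by auto
    then obtain i where i: "i \<in> keys m" by (metis ex_in_conv keys_eq_empty)
    let ?m = "m - single i 1"
    have split: "m = single i 1 + ?m" by (rule single_le[OF i])
    have "keys ?m \<subseteq> {1..n}" using km(1) by (auto simp: in_keys_iff lookup_minus subset_iff)
    moreover have "int (mon_degree ?m) = int e - int j - 1"
      using km(2) mon_degree_plus[of "single i 1" ?m] split by simp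
    ultimately have hm: "single ?m c \<in> homogeneous_part n (int e - int j - 1)"
      by (rule homogeneous_single)
    have "smul (single ?m c) f \<in> N \<inter> graded_free_part n b (int e - 1)"
    proof
      show "smul (single ?m c) f \<in> N"
        using f by (intro N_smul[OF homogeneous_part_carrier[OF hm]]) blast
      show "smul (single ?m c) f \<in> graded_free_part n b (int e - 1)"
        using f by (intro free_part_smul[OF hm]) auto
    qed
    moreover have "i \<in> {1..n}" using i km by blast
    ultimately have "smul (Var i) (smul (single ?m c) f) \<in> dec e"
      unfolding dec_def by (intro vs.span_base) blast
    moreover have "Var i * single ?m c = single m c"
      unfolding Var_def mult_single split[symmetric] by simp
    ultimately show ?thesis by (simp add: smul_smul)
  qed
  have "smul (\<Sum>m\<in>keys h. single m (lookup h m)) f \<in> dec e"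
    unfolding smul_sum_left dec_def by (rule vs.span_sum) (rule tm[unfolded dec_def])
  then show ?thesis by (simp only: poly_sum_monomials[symmetric])
qed

text \<open>\<open>B\<close> is a basis of the decomposable part, and \<open>G\<close> completes it
  to a basis of the whole degree; the members of \<open>G\<close> become the generators of degree
  \<open>e\<close>.\<close>

lemma degree_basis:
  "\<exists>B G. finite G \<and> G \<subseteq> N \<inter> graded_free_part n b (int e) \<and> dec e \<subseteq> vs.span B \<and> B \<subseteq> dec e \<and> B \<inter> G = {}
    \<and> vs.independent (B \<union> G) \<and> N \<inter> graded_free_part n b (int e) \<subseteq> vs.span (B \<union> G)"
proof -
  let ?N = "N \<inter> graded_free_part n b (int e)"
  obtain B where B: "B \<subseteq> dec e" "vs.independent B" "dec e \<subseteq> vs.span B"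
    using vs.maximal_independent_subset[of "dec e"] by metis
  then have "B \<subseteq> ?N" using dec_subset by blast
  then obtain C where C: "B \<subseteq> C" "C \<subseteq> ?N" "vs.independent C" "?N \<subseteq> vs.span C"
    using vs.maximal_independent_subset_extend[OF _ B(2)] by metis
  obtain M :: "'k fvec set" where M: "finite M" "graded_free_part n b (int e) \<subseteq> vs.span M"
    using free_part_finite_span by blast
  have "finite C" using vs.independent_span_bound[OF M(1) C(3)] C(2) M(2) by blast
  moreover have "B \<union> (C - B) = C" using C(1) by blast
  ultimately show ?thesis using B C by (intro exI[of _ B] exI[of _ "C - B"]) auto
qed

text \<open>Graded Nakayama: complements of the decomposable parts in all degrees together generate
  \<open>N\<close>, and their independence modulo these parts keeps every relation inside the
  irrelevant ideal.\<close>

lemma cover: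
  "\<exists>b' h. h \<in> module_hom_set (poly_ring n) (graded_free n b') (graded_free n b)
    \<and> (\<forall>e. h ` graded_free_part n b' e \<subseteq> graded_free_part n b e) \<and> h ` free_vecs n b' = N
    \<and> (\<forall>f\<in>free_vecs n b'. h f = 0 \<longrightarrow> (\<forall>c. lookup f c \<in> irrelevant_ideal n))"
proof -
  obtain B G where BG: "\<And>e. finite (G e)" "\<And>e. G e \<subseteq> N \<inter> graded_free_part n b (int e)" "\<And>e. dec e \<subseteq> vs.span (B e)"
    "\<And>e. B e \<subseteq> dec e" "\<And>e. B e \<inter> G e = {}" "\<And>e. vs.independent (B e \<union> G e)"
    "\<And>e. N \<inter> graded_free_part n b (int e) \<subseteq> vs.span (B e \<union> G e)"
    using degree_basis by metis
  define b' where "b' e = card (G e)" for e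
  have "\<exists>g. bij_betw g {0..<b' e} (G e)" for e
    unfolding b'_def by (rule ex_bij_betw_nat_finite[OF BG(1)])
  then obtain g where g: "\<And>e. bij_betw (g e) {0..<b' e} (G e)" by metis
  have gG: "g e l \<in> G e" if "l < b' e" for e l using bij_betwE[OF g] that by simp
  have gN: "g e l \<in> N \<inter> graded_free_part n b (int e)" if "l < b' e" for e l using gG[OF that] BG(2) by blast
  define h where "h f = (\<Sum>c\<in>keys f. smul (lookup f c) (g (fst c) (snd c)))" for f
  have h_sup: "h f = (\<Sum>c\<in>X. smul (lookup f c) (g (fst c) (snd c)))"
    if "finite X" "keys f \<subseteq> X" for f X
    unfolding h_def using that by (intro sum.mono_neutral_left) (auto simp: in_keys_iff)
  have h_add: "h (f + f') = h f + h f'" for f f'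
    using keys_add[of f f']
    by (subst (1 2 3) h_sup[of "keys f \<union> keys f'"]) (auto simp: lookup_add smul_add_left sum.distrib)
  have h_smul: "h (smul r f) = smul r (h f)" for r f
    by (subst (1 2) h_sup[of "keys f"]) (auto simp: smul_sum_right smul_smul in_keys_iff)
  have crd: "l < b' j" if "f \<in> free_vecs n b'" "(j, l) \<in> keys f" for f :: "'k fvec" and j l
    using that by (auto simp: carrier_graded_free in_keys_iff)
  have hN: "h f \<in> N" if f: "f \<in> free_vecs n b'" for f
    unfolding h_def
  proof (rule N_sum)
    fix c assume c: "c \<in> keys f"
    then have "snd c < b' (fst c)" using crd[OF f, of "fst c" "snd c"] by simp
    then have "g (fst c) (snd c) \<in> N" using gN by blast
    moreover have "lookup f c \<in> polys n"
      using f unfolding carrier_graded_free by (metis prod.collapse)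
    ultimately show "smul (lookup f c) (g (fst c) (snd c)) \<in> N" by (intro N_smul)
  qed
  have hom: "h \<in> module_hom_set (poly_ring n) (graded_free n b') (graded_free n b)"
    unfolding module_hom_set_def using hN N_carrier by (auto simp: h_add h_smul)
  have graded: "h ` graded_free_part n b' e \<subseteq> graded_free_part n b e" for e
  proof
    fix x assume "x \<in> h ` graded_free_part n b' e"
    then obtain f where f: "f \<in> graded_free_part n b' e" "x = h f" by blast
    show "x \<in> graded_free_part n b e"
      unfolding f(2) h_def
    proof (rule free_part_sum)
      fix c assume c: "c \<in> keys f"
      then have "snd c < b' (fst c)" using crd[OF graded_free_part_carrier[OF f(1)], of "fst c" "snd c"] by simp
      then have "g (fst c) (snd c) \<in> graded_free_part n b (int (fst c))" using gN by blast
      moreover have "lookup f c \<in> homogeneous_part n (e - int (fst c))"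
        using f(1) unfolding graded_free_part_iff by (metis prod.collapse)
      ultimately show "smul (lookup f c) (g (fst c) (snd c)) \<in> graded_free_part n b e"
        by (intro free_part_smul) auto
    qed
  qed
  interpret h: free_hom n b' b h by unfold_locales (rule hom, rule graded)
  let ?R = "h ` free_vecs n b'"
  have R_smul: "smul r x \<in> ?R" if "r \<in> polys n" "x \<in> ?R" for r x
  proof -
    obtain f where "f \<in> free_vecs n b'" "x = h f" using \<open>x \<in> ?R\<close> by blast
    then show ?thesis using \<open>r \<in> polys n\<close> by (intro image_eqI[of _ _ "smul r f"]) (auto simp: h_smul)
  qed
  have R_sub: "vs.subspace ?R"
    unfolding vs.subspace_def
  proof (intro conjI ballI allI)
    show "0 \<in> ?R" by (intro image_eqI[of _ _ 0]) auto
    show "x + y \<in> ?R" if "x \<in> ?R" "y \<in> ?R" for x y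
    proof -
      obtain f f' where "f \<in> free_vecs n b'" "x = h f" "f' \<in> free_vecs n b'" "y = h f'"
        using \<open>x \<in> ?R\<close> \<open>y \<in> ?R\<close> by blast
      then show ?thesis by (intro image_eqI[of _ _ "f + f'"]) (auto simp: h_add)
    qed
    show "vscale c x \<in> ?R" if "x \<in> ?R" for c x
      unfolding vscale_def using that by (intro R_smul) auto
  qed
  \<comment> \<open>Degrees are bounded below by 0, so generation follows by induction on the
    degree.\<close>
  have RN: "N \<inter> graded_free_part n b (int e) \<subseteq> ?R" for e
  proof (induction e rule: less_induct)
    case (less e)
    have "dec e \<subseteq> ?R" unfolding dec_def
    proof (rule vs.span_minimal[OF _ R_sub], rule subsetI)
      fix x assume "x \<in> {smul (Var l) f |l f. l \<in> {1..n} \<and> f \<in> N \<inter> graded_free_part n b (int e - 1)}"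
      then obtain l f where x: "l \<in> {1..n}" "x = smul (Var l) f" "f \<in> N \<inter> graded_free_part n b (int e - 1)" by blast
      show "x \<in> ?R"
      proof (cases e)
        case 0
        then have "f = 0" using x(3) free_part_negative by fastforce
        then show ?thesis using vs.subspace_0[OF R_sub] by (simp add: x(2))
      next
        case (Suc e')
        then have "f \<in> ?R" using less[of e'] x(3) by auto
        then show ?thesis unfolding x(2) by (rule R_smul[OF Var_closed[OF x(1)]])
      qed
    qed
    moreover have "G e \<subseteq> ?R"
    proof
      fix x assume "x \<in> G e"
      then obtain l where "l < b' e" "x = g e l" using g[of e] by (metis atLeastLessThan_iff bij_betw_imp_surj_on imageE)
      then have "h (single (e, l) 1) = x" "single (e, l) 1 \<in> free_vecs n b'"
        by (auto simp: h_def carrier_graded_free lookup_single when_def)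
      then show "x \<in> ?R" by blast
    qed
    ultimately have "vs.span (B e \<union> G e) \<subseteq> ?R" using BG(4)[of e] by (intro vs.span_minimal[OF _ R_sub]) blast
    then show ?case using BG(7)[of e] by blast
  qed
  have image: "?R = N"
  proof
    show "?R \<subseteq> N" using hN by blast
    show "N \<subseteq> ?R"
    proof
      fix f assume f: "f \<in> N"
      obtain E where E: "finite E" "f = (\<Sum>e\<in>E. vcomp e f)" using vcomp_decomp[of f] by metis
      have "vcomp e f \<in> ?R" for e
      proof -
        have v: "vcomp e f \<in> N \<inter> graded_free_part n b e" using f N_carrier by (auto intro: N_vcomp vcomp_part)
        show ?thesis
        proof (cases "e < 0")
          case True
          then have "vcomp e f = 0" using v free_part_negative by blast
          then show ?thesis using vs.subspace_0[OF R_sub] by simp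
        next
          case False
          then show ?thesis using v RN[of "nat e"] by auto
        qed
      qed
      then have "(\<Sum>e\<in>E. vcomp e f) \<in> ?R" by (intro vs.subspace_sum[OF R_sub])
      then show "f \<in> ?R" using E(2) by simp
    qed
  qed
  have min: "lookup f c \<in> irrelevant_ideal n"
    if f: "f \<in> free_vecs n b'" and hf: "h f = 0" for f c
  proof (rule ccontr)
    assume nz: "lookup f c \<notin> irrelevant_ideal n"
    obtain e l where c: "c = (e, l)" by force
    let ?k = "lookup (lookup f c) 0"
    have fc: "lookup f c \<in> polys n" "lookup f c \<noteq> 0 \<Longrightarrow> l < b' e"
      using f unfolding carrier_graded_free c by blast+
    then have "?k \<noteq> 0" using nz by (simp add: irrelevant_ideal_eq)
    moreover from this have "lookup f c \<noteq> 0" by auto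
    ultimately have k: "?k \<noteq> 0" "l < b' e" using fc(2) by auto
    \<comment> \<open>In degree \<open>e\<close> the offending coordinate becomes a nonzero
      constant. The other coordinates contribute constant multiples of other generators of degree
      \<open>e\<close>, or decomposable elements, so the generator would depend on the rest of the
      basis.\<close>
    define f' where "f' = vcomp (int e) f"
    have f': "f' \<in> graded_free_part n b' (int e)" unfolding f'_def by (rule vcomp_part[OF f])
    have hf': "h f' = 0" unfolding f'_def using h.h_vcomp[OF f] hf by simp
    have coord: "lookup f' d \<in> homogeneous_part n (int e - int (fst d))" for d
      using f' unfolding graded_free_part_iff by (metis prod.collapse)
    have "lookup (lookup f' c) 0 = ?k"
      by (simp add: f'_def lookup_vcomp c hcomp_def lookup_restr)
    then have f'c: "lookup f' c = single 0 ?k"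
      using homogeneous_const[of "lookup f' c" n] coord[of c] by (simp add: c)
    let ?U = "B e \<union> G e - {g e l}"
    have others: "smul (lookup f' d) (g (fst d) (snd d)) \<in> vs.span ?U"
      if d: "d \<in> keys f' - {c}" for d
    proof -
      obtain j m where dj: "d = (j, m)" by force
      have m: "m < b' j" using crd[OF graded_free_part_carrier[OF f'], of j m] d dj by simp
      have "lookup f' d \<noteq> 0" using d by (simp add: in_keys_iff)
      then have "\<not> int e - int j < 0" using homogeneous_negative[OF coord[of d]] by (auto simp: dj)
      then consider "j = e" | "j < e" by linarith
      then show ?thesis
      proof cases
        case 1
        have "lookup f' d = single 0 (lookup (lookup f' d) 0)"
          using homogeneous_const coord[of d] by (simp add: dj 1)
        moreover have "g e m \<noteq> g e l"
          using bij_betw_imp_inj_on[OF g[of e]] m k(2) d by (auto simp: dj c 1 inj_on_def)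
        then have "g e m \<in> ?U" using gG[OF m] by (simp add: 1)
        then have "vscale (lookup (lookup f' d) 0) (g e m) \<in> vs.span ?U"
          by (intro vs.span_scale vs.span_base)
        ultimately show ?thesis by (simp add: dj 1 vscale_def)
      next
        case 2
        have "smul (lookup f' d) (g j m) \<in> dec e"
          by (rule dec_smul[OF _ 2 gN[OF m]]) (use coord[of d] in \<open>simp add: dj\<close>)
        moreover have "B e \<subseteq> ?U" using BG(5)[of e] gG[OF k(2)] by blast
        then have "vs.span (B e) \<subseteq> vs.span ?U" by (rule vs.span_mono)
        ultimately show ?thesis using BG(3)[of e] by (auto simp: dj)
      qed
    qed
    have ck: "c \<in> keys f'" using f'c k(1) by (metis in_keys_iff lookup_single_eq lookup_zero)
    have "0 = h f'" using hf' by simp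
    also have "\<dots> = vscale ?k (g e l) + (\<Sum>d\<in>keys f' - {c}. smul (lookup f' d) (g (fst d) (snd d)))"
    proof -
      have "g (fst c) (snd c) = g e l" by (simp add: c)
      then show ?thesis unfolding h_def by (subst sum.remove[OF _ ck]) (simp_all add: f'c vscale_def)
    qed
    finally have "vscale ?k (g e l) = - (\<Sum>d\<in>keys f' - {c}. smul (lookup f' d) (g (fst d) (snd d)))"
      by (simp add: eq_neg_iff_add_eq_0)
    then have "vscale ?k (g e l) \<in> vs.span ?U" by (simp only:) (intro vs.span_neg vs.span_sum others)
    then have "vscale (inverse ?k) (vscale ?k (g e l)) \<in> vs.span ?U" by (rule vs.span_scale)
    then have "g e l \<in> vs.span ?U" using k(1) by simp
    then have "vs.dependent (B e \<union> G e)" unfolding vs.dependent_def using gG[OF k(2)] by blast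
    then show False using BG(6)[of e] by simp
  qed
  show ?thesis using hom graded image min by blast
qed

end

lemma (in free_hom) graded_submodule_kernel:
  "graded_submodule n b {f \<in> free_vecs n b. h f = 0}"
  by unfold_locales (auto simp: h_add h_smul h_vcomp intro: graded_free_part_carrier vcomp_part)

text \<open>\<open>betti\<close> is a choice that carries information only if a resolution exists.
  Starting from S with the ideal as first kernel, \<open>cover\<close> is applied repeatedly to the
  kernel of the previous map.\<close>

theorem (in sr_complex) minimal_resolution_exists:
  assumes "{} \<in> \<Delta>"
  shows "\<exists>\<beta> \<epsilon> \<phi>. minimal_graded_free_resolution n A \<beta> \<epsilon> \<phi>"
proof -
  define b0 :: "nat \<Rightarrow> nat" where "b0 j = (if j = 0 then 1 else 0)" for j
  define K0 where "K0 = {f \<in> free_vecs n b0. lookup f (0, 0) \<in> SRI}"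
  define \<epsilon> :: "'k fvec \<Rightarrow> 'k mpoly set" where "\<epsilon> f = q (lookup f (0, 0))" for f
  \<comment> \<open>A state is a rank function together with the submodule to be covered next. That
    its coordinates lie in the irrelevant ideal is carried along: it is the image of the next map,
    so this is minimality.\<close>
  define P where "P i s \<longleftrightarrow> (case s of (b, K) \<Rightarrow> graded_submodule n b K \<and> (\<forall>f\<in>K. \<forall>c. lookup f c \<in> irrelevant_ideal n)
    \<and> (i = 0 \<longrightarrow> b = b0 \<and> K = K0))" for i :: nat and s :: "(nat \<Rightarrow> nat) \<times> 'k fvec set"
  define Q where "Q s s' h \<longleftrightarrow> (case s of (b, K) \<Rightarrow> case s' of (b', K') \<Rightarrow>
      h \<in> module_hom_set (poly_ring n) (graded_free n b') (graded_free n b)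
      \<and> (\<forall>e. h ` graded_free_part n b' e \<subseteq> graded_free_part n b e) \<and> h ` free_vecs n b' = K
      \<and> K' = {f\<in>free_vecs n b'. h f = 0})" for s s' :: "(nat \<Rightarrow> nat) \<times> 'k fvec set" and h
  have crd0: "c = (0, 0)" if "f \<in> free_vecs n b0" "lookup f c \<noteq> 0" for f :: "'k fvec" and c
  proof -
    obtain j l where "c = (j, l)" by force
    moreover from this have "l < b0 j" using that unfolding carrier_graded_free by blast
    ultimately show ?thesis by (simp add: b0_def split: if_splits)
  qed
  have "graded_submodule n b0 K0"
  proof unfold_locales
    show "vcomp e f \<in> K0" if f: "f \<in> K0" for e f
    proof -
      have fc: "f \<in> free_vecs n b0" and f0: "lookup f (0, 0) \<in> SRI"
        using f by (simp_all add: K0_def)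
      have "vcomp e f \<in> free_vecs n b0" by (rule graded_free_part_carrier[OF vcomp_part[OF fc]])
      moreover from this have "lookup (vcomp e f) (0, 0) \<in> polys n"
        unfolding carrier_graded_free by blast
      then have "lookup (vcomp e f) (0, 0) \<in> SRI"
        using f0 unfolding I_iff lookup_vcomp hcomp_def lookup_restr by simp
      ultimately show ?thesis by (simp add: K0_def)
    qed
    show "smul p f \<in> K0" if "p \<in> polys n" "f \<in> K0" for p f
      using that SR.I_l_closed[of "lookup f (0, 0)" p] by (auto simp: K0_def)
  qed (auto simp: K0_def I_iff lookup_add)
  \<comment> \<open>Minimality of the first map: \<open>{} \<in> \<Delta>\<close> forces the
    constant coefficient of every element of the ideal to vanish.\<close>
  moreover have "lookup f c \<in> irrelevant_ideal n" if f: "f \<in> K0" for f c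
  proof (cases "c = (0, 0)")
    case True
    then show ?thesis using f assms by (auto simp: K0_def I_iff irrelevant_ideal_eq)
  next
    case False
    have "f \<in> free_vecs n b0" using f by (simp add: K0_def)
    then have "lookup f c = 0" using crd0[of f c] False by blast
    then show ?thesis by (simp add: irrelevant_ideal_eq)
  qed
  ultimately have start: "\<exists>s. P 0 s" by (intro exI[of _ "(b0, K0)"]) (simp add: P_def)
  have step: "\<exists>s'. P (Suc i) s' \<and> (\<exists>h. Q s s' h)" if "P i s" for i s
  proof -
    obtain b K where s: "s = (b, K)" by force
    interpret graded_submodule n b K using that by (simp add: P_def s)
    from cover obtain b' h where h0: "h \<in> module_hom_set (poly_ring n) (graded_free n b') (graded_free n b)
      \<and> (\<forall>e. h ` graded_free_part n b' e \<subseteq> graded_free_part n b e) \<and> h ` free_vecs n b' = K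
      \<and> (\<forall>f\<in>free_vecs n b'. h f = 0 \<longrightarrow> (\<forall>c. lookup f c \<in> irrelevant_ideal n))"
      by (elim exE)
    then have h: "h \<in> module_hom_set (poly_ring n) (graded_free n b') (graded_free n b)"
      "\<And>e. h ` graded_free_part n b' e \<subseteq> graded_free_part n b e" "h ` free_vecs n b' = K"
      "\<And>f c. f \<in> free_vecs n b' \<Longrightarrow> h f = 0 \<Longrightarrow> lookup f c \<in> irrelevant_ideal n"
      by (simp_all del: split_paired_All)
    interpret h: free_hom n b' b h by unfold_locales (rule h(1), rule h(2))
    have "Q s (b', {f\<in>free_vecs n b'. h f = 0}) h" using h by (simp add: Q_def s)
    moreover have "P (Suc i) (b', {f\<in>free_vecs n b'. h f = 0})"
      using h.graded_submodule_kernel h(4) by (simp add: P_def)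
    ultimately show ?thesis by blast
  qed
  obtain s where s: "\<And>i. P i (s i)" "\<And>i. \<exists>h. Q (s i) (s (Suc i)) h"
    using dependent_nat_choice[of P "\<lambda>_ s s'. \<exists>h. Q s s' h", OF start step] by metis
  then obtain \<phi> where \<phi>: "\<And>i. Q (s i) (s (Suc i)) (\<phi> i)" by metis
  define \<beta> where "\<beta> i = fst (s i)" for i
  define K where "K i = snd (s i)" for i
  have s0: "\<beta> 0 = b0" "K 0 = K0" using s(1)[of 0] by (auto simp: P_def \<beta>_def K_def split: prod.splits)
  have Kmin: "f \<in> K i \<Longrightarrow> lookup f c \<in> irrelevant_ideal n" for i f c
    using s(1)[of i] by (auto simp: P_def K_def split: prod.splits simp del: split_paired_All)
  have \<phi>': "\<phi> i \<in> module_hom_set (poly_ring n) (graded_free n (\<beta> (Suc i))) (graded_free n (\<beta> i))"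
      "\<phi> i ` graded_free_part n (\<beta> (Suc i)) e \<subseteq> graded_free_part n (\<beta> i) e"
      "\<phi> i ` free_vecs n (\<beta> (Suc i)) = K i"
      "K (Suc i) = {f\<in>free_vecs n (\<beta> (Suc i)). \<phi> i f = 0}" for i e
    using \<phi>[of i] by (auto simp: Q_def \<beta>_def K_def split: prod.splits)
  have "minimal_graded_free_resolution n A \<beta> \<epsilon> \<phi>"
    unfolding minimal_graded_free_resolution_def Let_def
  proof (intro conjI allI ballI)
    have c00: "lookup f (0, 0) \<in> polys n" if "f \<in> free_vecs n (\<beta> 0)" for f :: "'k fvec"
      using that by (simp add: carrier_graded_free)
    show "\<epsilon> \<in> module_hom_set (poly_ring n) (graded_free n (\<beta> 0)) A"
      unfolding module_hom_set_def \<epsilon>_def using c00 by (auto simp: lookup_add add_q smult_q)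
    show "\<epsilon> ` graded_free_part n (\<beta> 0) e \<subseteq> graded_part n A e" for e
    proof -
      have "lookup f (0, 0) \<in> homogeneous_part n e" if "f \<in> graded_free_part n (\<beta> 0) e" for f :: "'k fvec"
        using that by (auto simp: graded_free_part_iff dest!: spec[of _ 0])
      then show ?thesis by (auto simp: graded_part_A \<epsilon>_def)
    qed
    show "\<epsilon> ` free_vecs n (\<beta> 0) = carrier A"
    proof
      show "\<epsilon> ` free_vecs n (\<beta> 0) \<subseteq> carrier A" using c00 by (auto simp: \<epsilon>_def)
      show "carrier A \<subseteq> \<epsilon> ` free_vecs n (\<beta> 0)"
      proof
        fix x assume "x \<in> carrier A"
        then obtain p where p: "p \<in> polys n" "x = q p" by (rule carrier_A_E)
        then have "\<epsilon> (single (0, 0) p) = x" "single (0, 0) p \<in> free_vecs n (\<beta> 0)"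
          by (auto simp: \<epsilon>_def carrier_graded_free s0 b0_def lookup_single when_def)
        then show "x \<in> \<epsilon> ` free_vecs n (\<beta> 0)" by blast
      qed
    qed
    show "a_kernel (graded_free n (\<beta> 0)) A \<epsilon> = \<phi> 0 ` free_vecs n (\<beta> 1)"
    proof -
      have "a_kernel (graded_free n (\<beta> 0)) A \<epsilon> = K 0"
        using c00 unfolding a_kernel_def' s0 K0_def \<epsilon>_def
        by (intro Collect_cong conj_cong refl) (simp add: q_eq_zero_iff)
      then show ?thesis using \<phi>'(3)[of 0] by simp
    qed
    fix i
    show "a_kernel (graded_free n (\<beta> (Suc i))) (graded_free n (\<beta> i)) (\<phi> i) = \<phi> (Suc i) ` carrier (graded_free n (\<beta> (Suc (Suc i))))"
      unfolding a_kernel_def' \<phi>'(3) \<phi>'(4) by simp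
    show "lookup (\<phi> i f) c \<in> irrelevant_ideal n" if "f \<in> free_vecs n (\<beta> (Suc i))" for f c
      using that \<phi>'(3)[of i] by (intro Kmin[of _ i]) blast
  qed (rule \<phi>')+
  then show ?thesis by blast
qed

section \<open>Top local cohomology\<close>

context sr_complex
begin

section \<open>Localizations of \<open>A\<close> computed on representatives\<close>

definition fr :: "'k mpoly \<Rightarrow> 'k mpoly \<Rightarrow> nat \<Rightarrow> ('k mpoly set \<times> nat) set" where
  "fr f a m = fraction A (q f) (q a) m"

lemma I_mult: "p \<in> polys n \<Longrightarrow> p' \<in> SRI \<Longrightarrow> p * p' \<in> SRI"
  using SR.I_l_closed by simp

lemma I_add: "p \<in> SRI \<Longrightarrow> p' \<in> SRI \<Longrightarrow> p + p' \<in> SRI"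
  by (simp add: I_iff lookup_add)

lemma I_uminus: "p \<in> SRI \<Longrightarrow> - p \<in> SRI"
  by (simp add: I_iff)

lemma I_zero [simp]: "0 \<in> SRI"
  by (simp add: I_iff)

lemma I_sum: "(\<And>x. x \<in> X \<Longrightarrow> g x \<in> SRI) \<Longrightarrow> sum g X \<in> SRI"
  by (induction X rule: infinite_finite_induct) (auto intro: I_add)

lemma poly_pow_closed [simp, intro]: "p \<in> polys n \<Longrightarrow> p ^ k \<in> polys n"
  by (induction k) auto

lemma fr_mem_iff:
  assumes "f \<in> polys n" "a \<in> polys n" "b \<in> polys n"
  shows "(q b, l) \<in> fr f a m \<longleftrightarrow> (\<exists>r. f ^ r * (b * f ^ m - a * f ^ l) \<in> SRI)"
proof -
  have "q f [^]\<^bsub>A\<^esub> r \<otimes>\<^bsub>A\<^esub> (q b \<otimes>\<^bsub>A\<^esub> q f [^]\<^bsub>A\<^esub> m) = q f [^]\<^bsub>A\<^esub> r \<otimes>\<^bsub>A\<^esub> (q a \<otimes>\<^bsub>A\<^esub> q f [^]\<^bsub>A\<^esub> l)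
    \<longleftrightarrow> f ^ r * (b * f ^ m - a * f ^ l) \<in> SRI" for r :: nat
    using assms by (simp add: pow_q mult_q q_eq_iff right_diff_distrib)
  then show ?thesis using assms by (simp add: fr_def fraction_def)
qed

lemma fr_mem_E:
  assumes "x \<in> fr f a m" obtains b l where "x = (q b, l)" "b \<in> polys n"
  using assms by (auto simp: fr_def fraction_def elim: carrier_A_E)

lemma fr_mem_rep:
  assumes "x \<in> fr f a m" "f \<in> polys n" "a \<in> polys n"
  obtains b l r where "x = (q b, l)" "b \<in> polys n" "f ^ r * (b * f ^ m - a * f ^ l) \<in> SRI"
proof -
  obtain b l where b: "x = (q b, l)" "b \<in> polys n" by (rule fr_mem_E[OF assms(1)])
  then show ?thesis using that[OF b] assms(1) fr_mem_iff[OF assms(2,3) b(2)] by auto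
qed

lemma fr_self: "f \<in> polys n \<Longrightarrow> a \<in> polys n \<Longrightarrow> (q a, m) \<in> fr f a m"
  by (auto simp: fr_mem_iff I_iff)

text \<open>Equality of fractions allows multiplication by a power of \<open>f\<close>; its
  transitivity needs a larger power, supplied by the displayed identity.\<close>

lemma fr_eqI:
  assumes f: "f \<in> polys n" and ab: "a \<in> polys n" "b \<in> polys n"
    and eq: "f ^ r * (b * f ^ m - a * f ^ l) \<in> SRI"
  shows "fr f a m = fr f b l"
proof -
  have sub: "fr f a m \<subseteq> fr f b l" if ab: "a \<in> polys n" "b \<in> polys n"
    and eq: "f ^ r * (b * f ^ m - a * f ^ l) \<in> SRI" for a b m l
  proof
    fix x assume x: "x \<in> fr f a m"
    then obtain c k s where c: "x = (q c, k)" "c \<in> polys n"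
      and s: "f ^ s * (c * f ^ m - a * f ^ k) \<in> SRI" by (rule fr_mem_rep[OF _ f ab(1)])
    have "f ^ (s + r + m) * (c * f ^ l - b * f ^ k) =
      f ^ (r + l) * (f ^ s * (c * f ^ m - a * f ^ k)) + - (f ^ (s + k) * (f ^ r * (b * f ^ m - a * f ^ l)))"
      by (simp add: algebra_simps power_add)
    also have "\<dots> \<in> SRI" using f by (intro I_add I_uminus I_mult[OF _ s] I_mult[OF _ eq]) auto
    finally have "f ^ (s + r + m) * (c * f ^ l - b * f ^ k) \<in> SRI" .
    then show "x \<in> fr f b l" unfolding c(1) fr_mem_iff[OF f ab(2) c(2)] by blast
  qed
  have "f ^ r * (a * f ^ l - b * f ^ m) = - (f ^ r * (b * f ^ m - a * f ^ l))" by (simp add: algebra_simps)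
  then have "f ^ r * (a * f ^ l - b * f ^ m) \<in> SRI" using I_uminus[OF eq] by simp
  then show ?thesis using sub[OF ab eq] sub[OF ab(2,1)] by blast
qed

lemma fr_eqI0:
  assumes "f \<in> polys n" "a \<in> polys n" "b \<in> polys n" "b * f ^ m = a * f ^ l"
  shows "fr f a m = fr f b l"
  by (rule fr_eqI[of f a b 0]) (use assms in \<open>auto simp: I_iff\<close>)

lemma loc_simps:
  "carrier (localization A (q f)) = {fr f a m |a m. a \<in> polys n}"
  "zero (localization A (q f)) = fr f 0 0"
  by (auto simp: localization_def fr_def A_simps)

text \<open>Addition is defined as a union over all representatives; every pair of them yields the
  same fraction, and the union collapses to it.\<close>

lemma loc_add:
  assumes f: "f \<in> polys n" and ab: "a \<in> polys n" "b \<in> polys n"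
  shows "fr f a m \<oplus>\<^bsub>localization A (q f)\<^esub> fr f b l = fr f (a * f ^ l + b * f ^ m) (m + l)"
proof -
  let ?T = "\<lambda>x y. fraction A (q f) (fst x \<otimes>\<^bsub>A\<^esub> q f [^]\<^bsub>A\<^esub> snd y \<oplus>\<^bsub>A\<^esub> fst y \<otimes>\<^bsub>A\<^esub> q f [^]\<^bsub>A\<^esub> snd x) (snd x + snd y)"
  have "?T x y = fr f (a * f ^ l + b * f ^ m) (m + l)" if x: "x \<in> fr f a m" and y: "y \<in> fr f b l" for x y
  proof -
    obtain c k r where c: "x = (q c, k)" "c \<in> polys n"
      and r: "f ^ r * (c * f ^ m - a * f ^ k) \<in> SRI" by (rule fr_mem_rep[OF x f ab(1)])
    obtain e h s where e: "y = (q e, h)" "e \<in> polys n"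
      and s: "f ^ s * (e * f ^ l - b * f ^ h) \<in> SRI" by (rule fr_mem_rep[OF y f ab(2)])
    have "?T x y = fr f (c * f ^ h + e * f ^ k) (k + h)"
      using f c e by (simp add: pow_q mult_q add_q fr_def)
    also have "\<dots> = fr f (a * f ^ l + b * f ^ m) (m + l)"
    proof (rule fr_eqI[symmetric])
      have "f ^ (r + s) * ((c * f ^ h + e * f ^ k) * f ^ (m + l) - (a * f ^ l + b * f ^ m) * f ^ (k + h)) =
        f ^ (s + l + h) * (f ^ r * (c * f ^ m - a * f ^ k)) + f ^ (r + m + k) * (f ^ s * (e * f ^ l - b * f ^ h))"
        by (simp add: algebra_simps power_add)
      also have "\<dots> \<in> SRI" using f by (intro I_add I_mult[OF _ r] I_mult[OF _ s]) auto
      finally show "f ^ (r + s) * ((c * f ^ h + e * f ^ k) * f ^ (m + l) - (a * f ^ l + b * f ^ m) * f ^ (k + h)) \<in> SRI" .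
    qed (use f ab c e in auto)
    finally show ?thesis .
  qed
  moreover have "fr f a m \<noteq> {}" "fr f b l \<noteq> {}" using fr_self[OF f ab(1)] fr_self[OF f ab(2)] by blast+
  ultimately show ?thesis
    unfolding localization_def by (simp add: case_prod_unfold)
qed

lemma loc_add_same:
  assumes "f \<in> polys n" "a \<in> polys n" "b \<in> polys n"
  shows "fr f a m \<oplus>\<^bsub>localization A (q f)\<^esub> fr f b m = fr f (a + b) m"
  unfolding loc_add[OF assms] by (rule fr_eqI0) (use assms in \<open>auto simp: algebra_simps power_add\<close>)

lemma loc_abelian:
  assumes f: "f \<in> polys n"
  shows "abelian_group (localization A (q f))"
proof (rule abelian_groupI)
  fix x y z assume "x \<in> carrier (localization A (q f))" "y \<in> carrier (localization A (q f))" "z \<in> carrier (localization A (q f))"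
  then obtain a k b l c m where abc: "x = fr f a k" "a \<in> polys n" "y = fr f b l" "b \<in> polys n"
    "z = fr f c m" "c \<in> polys n" by (auto simp: loc_simps)
  show "(x \<oplus>\<^bsub>localization A (q f)\<^esub> y) \<oplus>\<^bsub>localization A (q f)\<^esub> z = x \<oplus>\<^bsub>localization A (q f)\<^esub> (y \<oplus>\<^bsub>localization A (q f)\<^esub> z)"
    using abc f by (simp add: loc_add, intro fr_eqI0) (auto simp: algebra_simps power_add)
next
  fix x y assume "x \<in> carrier (localization A (q f))" "y \<in> carrier (localization A (q f))"
  then obtain a k b l where ab: "x = fr f a k" "a \<in> polys n" "y = fr f b l" "b \<in> polys n"
    by (auto simp: loc_simps)
  show "x \<oplus>\<^bsub>localization A (q f)\<^esub> y \<in> carrier (localization A (q f))"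
    using ab f by (simp add: loc_add loc_simps) (metis poly_add_closed poly_mult_closed poly_pow_closed)
  show "x \<oplus>\<^bsub>localization A (q f)\<^esub> y = y \<oplus>\<^bsub>localization A (q f)\<^esub> x"
    using ab f by (simp add: loc_add algebra_simps)
next
  fix x assume "x \<in> carrier (localization A (q f))"
  then obtain a k where a: "x = fr f a k" "a \<in> polys n" by (auto simp: loc_simps)
  show "\<zero>\<^bsub>localization A (q f)\<^esub> \<oplus>\<^bsub>localization A (q f)\<^esub> x = x"
    using a f by (simp add: loc_simps loc_add)
  show "\<exists>y\<in>carrier (localization A (q f)). y \<oplus>\<^bsub>localization A (q f)\<^esub> x = \<zero>\<^bsub>localization A (q f)\<^esub>"
  proof (intro bexI[of _ "fr f (- a) k"])
    show "fr f (- a) k \<oplus>\<^bsub>localization A (q f)\<^esub> x = \<zero>\<^bsub>localization A (q f)\<^esub>"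
      using a f by (simp add: loc_add_same loc_simps, intro fr_eqI0) auto
  qed (use a in \<open>auto simp: loc_simps\<close>)
qed (auto simp: loc_simps)

lemma loc_uminus:
  assumes "f \<in> polys n" "a \<in> polys n"
  shows "\<ominus>\<^bsub>localization A (q f)\<^esub> fr f a m = fr f (- a) m"
proof (rule abelian_group.minus_equality[OF loc_abelian[OF assms(1)]])
  show "fr f (- a) m \<oplus>\<^bsub>localization A (q f)\<^esub> fr f a m = \<zero>\<^bsub>localization A (q f)\<^esub>"
    using assms by (simp add: loc_add_same loc_simps, intro fr_eqI0) auto
qed (use assms in \<open>auto simp: loc_simps\<close>)

lemma loc_finsum:
  assumes f: "f \<in> polys n" and "finite X" "\<And>x. x \<in> X \<Longrightarrow> g x \<in> polys n"
  shows "finsum (localization A (q f)) (\<lambda>x. fr f (g x) m) X = fr f (sum g X) m"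
  using assms(2,3)
proof (induction X rule: finite_induct)
  case empty
  interpret L: abelian_group "localization A (q f)" by (rule loc_abelian[OF f])
  show ?case using f by (simp add: loc_simps, intro fr_eqI0) auto
next
  case (insert x X)
  interpret L: abelian_group "localization A (q f)" by (rule loc_abelian[OF f])
  have c: "fr f (g y) m \<in> carrier (localization A (q f))" if "y \<in> insert x X" for y
    using insert.prems[OF that] by (auto simp: loc_simps)
  have "finsum (localization A (q f)) (\<lambda>x. fr f (g x) m) (insert x X) =
      fr f (g x) m \<oplus>\<^bsub>localization A (q f)\<^esub> finsum (localization A (q f)) (\<lambda>x. fr f (g x) m) X"
    using insert.hyps c by (intro L.finsum_insert) auto
  also have "\<dots> = fr f (g x + sum g X) m"
    using insert f by (simp add: loc_add_same poly_sum_closed)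
  finally show ?case using insert by simp
qed

lemma loc_map:
  assumes f: "f \<in> polys n" and g: "g \<in> polys n" and a: "a \<in> polys n"
  shows "localization_map A (q f) (q g) (fr f a m) = fr (f * g) (a * g ^ m) m"
proof -
  let ?T = "\<lambda>x. fraction A (q f \<otimes>\<^bsub>A\<^esub> q g) (fst x \<otimes>\<^bsub>A\<^esub> q g [^]\<^bsub>A\<^esub> snd x) (snd x)"
  have "?T x = fr (f * g) (a * g ^ m) m" if x: "x \<in> fr f a m" for x
  proof -
    obtain c k r where c: "x = (q c, k)" "c \<in> polys n"
      and r: "f ^ r * (c * f ^ m - a * f ^ k) \<in> SRI" by (rule fr_mem_rep[OF x f a])
    have "?T x = fr (f * g) (c * g ^ k) k" using f g c by (simp add: pow_q mult_q fr_def)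
    also have "\<dots> = fr (f * g) (a * g ^ m) m"
    proof (rule fr_eqI[symmetric])
      have "(f * g) ^ r * (c * g ^ k * (f * g) ^ m - a * g ^ m * (f * g) ^ k)
          = g ^ (r + k + m) * (f ^ r * (c * f ^ m - a * f ^ k))"
        by (simp add: algebra_simps power_add power_mult_distrib)
      also have "\<dots> \<in> SRI" using g by (intro I_mult[OF _ r]) auto
      finally show "(f * g) ^ r * (c * g ^ k * (f * g) ^ m - a * g ^ m * (f * g) ^ k) \<in> SRI" .
    qed (use f g a c in auto)
    finally show ?thesis .
  qed
  moreover have "fr f a m \<noteq> {}" using fr_self[OF f a] by blast
  ultimately show ?thesis unfolding localization_map_def by (simp add: case_prod_unfold)
qed

section \<open>The Cech complex\<close>

definition xm :: "nat set \<Rightarrow> 'k mpoly" where "xm \<sigma> = single (ind_mon \<sigma>) 1"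

abbreviation Loc :: "nat set \<Rightarrow> ('k mpoly set \<times> nat) set ring" where
  "Loc \<sigma> \<equiv> localization A (var_prod A \<sigma>)"

lemma xm_closed [simp]: "\<sigma> \<subseteq> {1..n} \<Longrightarrow> xm \<sigma> \<in> polys n"
  using finite_subset[of \<sigma> "{1..n}"] by (simp add: xm_def)

lemma xm_homogeneous: "\<sigma> \<subseteq> {1..n} \<Longrightarrow> xm \<sigma> \<in> homogeneous_part n (int (card \<sigma>))"
  using finite_subset[of \<sigma> "{1..n}"] unfolding xm_def by (intro homogeneous_single) auto

lemma homogeneous_pow: "p \<in> homogeneous_part n e \<Longrightarrow> p ^ k \<in> homogeneous_part n (int k * e)"
proof (induction k)
  case (Suc k)
  then show ?case using homogeneous_mult[of p n e "p ^ k" "int k * e"] by (simp add: algebra_simps)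
qed (simp add: homogeneous_one)

lemma var_prod_xm: "\<sigma> \<subseteq> {1..n} \<Longrightarrow> var_prod A \<sigma> = q (xm \<sigma>)"
  by (simp add: xm_def var_prod_A)

lemma ind_mon_remove: "finite \<tau> \<Longrightarrow> j \<in> \<tau> \<Longrightarrow> ind_mon (\<tau> - {j}) + single j 1 = ind_mon \<tau>"
  by (rule poly_mapping_eqI) (auto simp: lookup_add lookup_single lookup_ind_mon when_def)

lemma xm_remove: "\<tau> \<subseteq> {1..n} \<Longrightarrow> j \<in> \<tau> \<Longrightarrow> xm (\<tau> - {j}) * Var j = xm \<tau>"
  using finite_subset[of \<tau> "{1..n}"] unfolding xm_def Var_def mult_single by (simp only: ind_mon_remove finite_atLeastAtMost) simp

lemma part_iff:
  assumes "\<sigma> \<subseteq> {1..n}"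
  shows "localization_part n A \<sigma> p = {fr (xm \<sigma>) a m |a m. a \<in> homogeneous_part n (p + int (m * card \<sigma>))}"
  unfolding localization_part_def graded_part_A fr_def using var_prod_xm[OF assms] by auto

lemma part_carrier: "\<sigma> \<subseteq> {1..n} \<Longrightarrow> localization_part n A \<sigma> p \<subseteq> carrier (Loc \<sigma>)"
  by (auto simp: part_iff loc_simps var_prod_xm)

lemma part_add:
  assumes s: "\<sigma> \<subseteq> {1..n}" and x: "x \<in> localization_part n A \<sigma> p" and y: "y \<in> localization_part n A \<sigma> p"
  shows "x \<oplus>\<^bsub>Loc \<sigma>\<^esub> y \<in> localization_part n A \<sigma> p"
proof -
  obtain a m where a: "x = fr (xm \<sigma>) a m" "a \<in> homogeneous_part n (p + int (m * card \<sigma>))" using x by (auto simp: part_iff[OF s])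
  obtain b l where b: "y = fr (xm \<sigma>) b l" "b \<in> homogeneous_part n (p + int (l * card \<sigma>))" using y by (auto simp: part_iff[OF s])
  have "a * xm \<sigma> ^ l \<in> homogeneous_part n (p + int ((m + l) * card \<sigma>))"
    using homogeneous_mult[OF a(2) homogeneous_pow[OF xm_homogeneous[OF s], of l]] by (simp add: algebra_simps)
  moreover have "b * xm \<sigma> ^ m \<in> homogeneous_part n (p + int ((m + l) * card \<sigma>))"
    using homogeneous_mult[OF b(2) homogeneous_pow[OF xm_homogeneous[OF s], of m]] by (simp add: algebra_simps)
  ultimately have "a * xm \<sigma> ^ l + b * xm \<sigma> ^ m \<in> homogeneous_part n (p + int ((m + l) * card \<sigma>))"
    by (rule homogeneous_add)
  moreover have "x \<oplus>\<^bsub>Loc \<sigma>\<^esub> y = fr (xm \<sigma>) (a * xm \<sigma> ^ l + b * xm \<sigma> ^ m) (m + l)"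
    unfolding a(1) b(1) var_prod_xm[OF s] using a b s by (intro loc_add) auto
  ultimately show ?thesis unfolding part_iff[OF s] by blast
qed

lemma part_uminus:
  assumes s: "\<sigma> \<subseteq> {1..n}" and x: "x \<in> localization_part n A \<sigma> p"
  shows "\<ominus>\<^bsub>Loc \<sigma>\<^esub> x \<in> localization_part n A \<sigma> p"
proof -
  obtain a m where a: "x = fr (xm \<sigma>) a m" "a \<in> homogeneous_part n (p + int (m * card \<sigma>))" using x by (auto simp: part_iff[OF s])
  have "\<ominus>\<^bsub>Loc \<sigma>\<^esub> x = fr (xm \<sigma>) (- a) m"
    unfolding a(1) var_prod_xm[OF s] using a s by (intro loc_uminus) auto
  then show ?thesis unfolding part_iff[OF s] using homogeneous_uminus[OF a(2)] by blast
qed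

lemma part_zero: "\<sigma> \<subseteq> {1..n} \<Longrightarrow> \<zero>\<^bsub>Loc \<sigma>\<^esub> \<in> localization_part n A \<sigma> p"
proof -
  assume s: "\<sigma> \<subseteq> {1..n}"
  have "\<zero>\<^bsub>Loc \<sigma>\<^esub> = fr (xm \<sigma>) 0 0" by (simp add: var_prod_xm[OF s] loc_simps)
  then show ?thesis unfolding part_iff[OF s] using homogeneous_zero by blast
qed

text \<open>x_\<sigma> lies in the ideal, so the element that becomes invertible is zero in
  \<open>A\<close>.\<close>

lemma loc_nonface:
  assumes s: "\<sigma> \<subseteq> {1..n}" "\<sigma> \<notin> \<Delta>" and x: "x \<in> carrier (Loc \<sigma>)"
  shows "x = \<zero>\<^bsub>Loc \<sigma>\<^esub>"
proof -
  obtain a m where a: "x = fr (xm \<sigma>) a m" "a \<in> polys n" using x by (auto simp: var_prod_xm[OF s(1)] loc_simps)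
  have "xm \<sigma> \<in> SRI" unfolding xm_def by (rule single_ind_I[OF s])
  then have "(0 * xm \<sigma> ^ m - a * xm \<sigma> ^ 0) * xm \<sigma> \<in> SRI" using a s by (intro I_mult) auto
  then have "xm \<sigma> ^ 1 * (0 * xm \<sigma> ^ m - a * xm \<sigma> ^ 0) \<in> SRI" by (simp add: mult.commute)
  then have "fr (xm \<sigma>) a m = fr (xm \<sigma>) 0 0" using a s by (intro fr_eqI[of _ _ _ 1]) auto
  then show ?thesis by (simp add: a(1) var_prod_xm[OF s(1)] loc_simps)
qed

lemma index_setsD: "\<sigma> \<in> index_sets n i \<Longrightarrow> \<sigma> \<subseteq> {1..n}" "\<sigma> \<in> index_sets n i \<Longrightarrow> card \<sigma> = i"
  by (auto simp: index_sets_def)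

lemma cochain_group: "group (cech_cochains n A i p)"
proof (rule groupI)
  have L: "abelian_group (Loc \<sigma>)" if "\<sigma> \<in> index_sets n i" for \<sigma>
    using loc_abelian[OF xm_closed[OF index_setsD(1)[OF that]]] var_prod_xm[OF index_setsD(1)[OF that]] by simp
  have cc: "carrier (cech_cochains n A i p) = (\<Pi>\<^sub>E \<sigma>\<in>index_sets n i. localization_part n A \<sigma> p)"
    by (simp add: cech_cochains_def)
  have pc: "x \<sigma> \<in> carrier (Loc \<sigma>)" "x \<sigma> \<in> localization_part n A \<sigma> p"
    if "x \<in> carrier (cech_cochains n A i p)" "\<sigma> \<in> index_sets n i" for x \<sigma>
    using PiE_mem[OF that(1)[unfolded cc] that(2)] part_carrier[OF index_setsD(1)[OF that(2)]] by blast+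
  have ext: "x = y" if "x \<in> carrier (cech_cochains n A i p)" "y \<in> carrier (cech_cochains n A i p)"
    "\<And>\<sigma>. \<sigma> \<in> index_sets n i \<Longrightarrow> x \<sigma> = y \<sigma>" for x y
    by (rule PiE_ext[OF that(1)[unfolded cc] that(2)[unfolded cc] that(3)])
  show cl: "x \<otimes>\<^bsub>cech_cochains n A i p\<^esub> y \<in> carrier (cech_cochains n A i p)"
    if "x \<in> carrier (cech_cochains n A i p)" "y \<in> carrier (cech_cochains n A i p)" for x y
    unfolding cc using part_add[OF index_setsD(1) pc(2)[OF that(1)] pc(2)[OF that(2)]]
    by (simp add: cech_cochains_def restrict_PiE_iff)
  have ap: "(x \<otimes>\<^bsub>cech_cochains n A i p\<^esub> y) \<sigma> = x \<sigma> \<oplus>\<^bsub>Loc \<sigma>\<^esub> y \<sigma>" if "\<sigma> \<in> index_sets n i" for x y \<sigma>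
    using that by (simp add: cech_cochains_def)
  show one: "\<one>\<^bsub>cech_cochains n A i p\<^esub> \<in> carrier (cech_cochains n A i p)"
    unfolding cc using part_zero[OF index_setsD(1)] by (simp add: cech_cochains_def restrict_PiE_iff)
  fix x assume x: "x \<in> carrier (cech_cochains n A i p)"
  show "\<one>\<^bsub>cech_cochains n A i p\<^esub> \<otimes>\<^bsub>cech_cochains n A i p\<^esub> x = x"
  proof (rule ext[OF cl[OF one x] x])
    fix \<sigma> assume s: "\<sigma> \<in> index_sets n i"
    interpret Ls: abelian_group "Loc \<sigma>" by (rule L[OF s])
    show "(\<one>\<^bsub>cech_cochains n A i p\<^esub> \<otimes>\<^bsub>cech_cochains n A i p\<^esub> x) \<sigma> = x \<sigma>"
      unfolding ap[OF s] using s pc(1)[OF x s] by (simp add: cech_cochains_def)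
  qed
  show "\<exists>y\<in>carrier (cech_cochains n A i p). y \<otimes>\<^bsub>cech_cochains n A i p\<^esub> x = \<one>\<^bsub>cech_cochains n A i p\<^esub>"
  proof
    let ?y = "\<lambda>\<sigma>\<in>index_sets n i. \<ominus>\<^bsub>Loc \<sigma>\<^esub> x \<sigma>"
    show y: "?y \<in> carrier (cech_cochains n A i p)"
      unfolding cc using part_uminus[OF index_setsD(1) pc(2)[OF x]] by (simp add: restrict_PiE_iff)
    show "?y \<otimes>\<^bsub>cech_cochains n A i p\<^esub> x = \<one>\<^bsub>cech_cochains n A i p\<^esub>"
    proof (rule ext[OF cl[OF y x] one])
      fix \<sigma> assume s: "\<sigma> \<in> index_sets n i"
      interpret Ls: abelian_group "Loc \<sigma>" by (rule L[OF s])
      show "(?y \<otimes>\<^bsub>cech_cochains n A i p\<^esub> x) \<sigma> = \<one>\<^bsub>cech_cochains n A i p\<^esub> \<sigma>"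
        unfolding ap[OF s] using s pc(1)[OF x s] by (simp add: cech_cochains_def Ls.l_neg)
    qed
  qed
  fix y z assume y: "y \<in> carrier (cech_cochains n A i p)" and z: "z \<in> carrier (cech_cochains n A i p)"
  show "x \<otimes>\<^bsub>cech_cochains n A i p\<^esub> y \<otimes>\<^bsub>cech_cochains n A i p\<^esub> z = x \<otimes>\<^bsub>cech_cochains n A i p\<^esub> (y \<otimes>\<^bsub>cech_cochains n A i p\<^esub> z)"
  proof (rule ext[OF cl[OF cl[OF x y] z] cl[OF x cl[OF y z]]])
    fix \<sigma> assume s: "\<sigma> \<in> index_sets n i"
    interpret Ls: abelian_group "Loc \<sigma>" by (rule L[OF s])
    show "(x \<otimes>\<^bsub>cech_cochains n A i p\<^esub> y \<otimes>\<^bsub>cech_cochains n A i p\<^esub> z) \<sigma> = (x \<otimes>\<^bsub>cech_cochains n A i p\<^esub> (y \<otimes>\<^bsub>cech_cochains n A i p\<^esub> z)) \<sigma>"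
      unfolding ap[OF s] using pc(1)[OF x s] pc(1)[OF y s] pc(1)[OF z s] by (simp add: Ls.a_assoc)
  qed
qed

lemma Var_xm: "j \<in> {1..n} \<Longrightarrow> var_prod A {j} = q (Var j)"
  by (simp add: var_prod_A Var_def ind_mon_def)

lemma coboundary_term:
  assumes t: "\<tau> \<subseteq> {1..n}" "j \<in> \<tau>" and a: "a \<in> polys n" and c: "c (\<tau> - {j}) = fr (xm (\<tau> - {j})) a m"
  shows "(let y = localization_map A (var_prod A (\<tau> - {j})) (var_prod A {j}) (c (\<tau> - {j}))
      in if even (card {l\<in>\<tau>. l < j}) then y else \<ominus>\<^bsub>Loc \<tau>\<^esub> y) = fr (xm \<tau>) (ksign j \<tau> * (a * Var j ^ m)) m"
proof -
  have j: "j \<in> {1..n}" and tj: "\<tau> - {j} \<subseteq> {1..n}" using t by blast+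
  have V: "Var j \<in> polys n" using j by (rule Var_closed)
  have "localization_map A (var_prod A (\<tau> - {j})) (var_prod A {j}) (c (\<tau> - {j})) = fr (xm \<tau>) (a * Var j ^ m) m"
    unfolding c var_prod_xm[OF tj] Var_xm[OF j] loc_map[OF xm_closed[OF tj] V a] xm_remove[OF t] ..
  moreover have "\<ominus>\<^bsub>Loc \<tau>\<^esub> fr (xm \<tau>) (a * Var j ^ m) m = fr (xm \<tau>) (- (a * Var j ^ m)) m"
    unfolding var_prod_xm[OF t(1)] using a V t by (intro loc_uminus) auto
  ultimately show ?thesis by (simp add: Let_def ksign_def)
qed

lemma coboundary_part:
  assumes c: "c \<in> carrier (cech_cochains n A i p)"
  shows "cech_coboundary n A i c \<in> carrier (cech_cochains n A (Suc i) p)"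
proof -
  have "finsum (Loc \<tau>) (\<lambda>j. let y = localization_map A (var_prod A (\<tau> - {j})) (var_prod A {j}) (c (\<tau> - {j}))
             in if even (card {l\<in>\<tau>. l < j}) then y else \<ominus>\<^bsub>Loc \<tau>\<^esub> y) \<tau> \<in> localization_part n A \<tau> p"
    (is "finsum _ ?f \<tau> \<in> _") if t: "\<tau> \<in> index_sets n (Suc i)" for \<tau>
  proof -
    note t1 = index_setsD[OF t]
    have fin: "finite \<tau>" using t1 finite_subset by blast
    interpret L: abelian_group "Loc \<tau>" using loc_abelian[OF xm_closed[OF t1(1)]] var_prod_xm[OF t1(1)] by simp
    have f: "?f j \<in> localization_part n A \<tau> p" if j: "j \<in> \<tau>" for j
    proof -
      have tj: "\<tau> - {j} \<in> index_sets n i" using t1 j fin by (auto simp: index_sets_def)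
      have "c \<in> (\<Pi>\<^sub>E \<sigma>\<in>index_sets n i. localization_part n A \<sigma> p)" using c by (simp add: cech_cochains_def)
      then have "c (\<tau> - {j}) \<in> localization_part n A (\<tau> - {j}) p" using tj by (rule PiE_mem)
      then obtain a m where a: "c (\<tau> - {j}) = fr (xm (\<tau> - {j})) a m" "a \<in> homogeneous_part n (p + int (m * i))"
        using index_setsD[OF tj] part_iff[of "\<tau> - {j}" p] by auto
      have "Var j \<in> homogeneous_part n 1" using j t1 by (intro homogeneous_Var) blast
      then have "a * Var j ^ m \<in> homogeneous_part n (p + int (m * card \<tau>))"
        using homogeneous_mult[OF a(2) homogeneous_pow[of "Var j" 1 m]] t1(2) by (simp add: algebra_simps)
      then have "ksign j \<tau> * (a * Var j ^ m) \<in> homogeneous_part n (p + int (m * card \<tau>))" by (rule homogeneous_ksign)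
      then show ?thesis
        unfolding coboundary_term[of \<tau> j a c m, OF t1(1) j homogeneous_part_carrier[OF a(2)] a(1)] part_iff[OF t1(1)]
        by blast
    qed
    have "finsum (Loc \<tau>) ?f X \<in> localization_part n A \<tau> p" if "X \<subseteq> \<tau>" for X
      using finite_subset[OF that fin] that
    proof (induction X rule: finite_induct)
      case empty
      then show ?case using part_zero[OF t1(1)] by simp
    next
      case (insert x X)
      have fc: "?f j \<in> carrier (Loc \<tau>)" if "j \<in> \<tau>" for j using f[OF that] part_carrier[OF t1(1)] by blast
      have "finsum (Loc \<tau>) ?f (insert x X) = ?f x \<oplus>\<^bsub>Loc \<tau>\<^esub> finsum (Loc \<tau>) ?f X"
        by (rule L.finsum_insert) (use insert fc in blast)+
      then show ?case using part_add[OF t1(1) f insert.IH] insert.prems by simp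
    qed
    then show ?thesis by simp
  qed
  then show ?thesis by (simp add: cech_cochains_def cech_coboundary_def restrict_PiE_iff)
qed

text \<open>With one exponent \<open>m\<close> in all denominators, the localization maps multiply
  numerators by X_j^m and the sum is taken over a single denominator.\<close>

lemma coboundary_common:
  assumes t: "\<tau> \<in> index_sets n (Suc i)"
    and B: "\<And>G. G \<in> index_sets n i \<Longrightarrow> B G \<in> polys n"
    and c: "\<And>G. G \<in> index_sets n i \<Longrightarrow> c G = fr (xm G) (B G) m"
  shows "cech_coboundary n A i c \<tau> = fr (xm \<tau>) (\<Sum>j\<in>\<tau>. ksign j \<tau> * (B (\<tau> - {j}) * Var j ^ m)) m"
proof -
  note t1 = index_setsD[OF t]
  have fin: "finite \<tau>" using t1 finite_subset by blast
  have tj: "\<tau> - {j} \<in> index_sets n i" if "j \<in> \<tau>" for j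
    using that t1 fin by (auto simp: index_sets_def)
  have cl: "ksign j \<tau> * (B (\<tau> - {j}) * Var j ^ m) \<in> polys n" if "j \<in> \<tau>" for j
  proof -
    have "j \<in> {1..n}" using that t1 by blast
    then have "ksign j \<tau> * Var j ^ m * B (\<tau> - {j}) \<in> polys n"
      by (intro poly_mult_closed homogeneous_part_carrier[OF homogeneous_ksign[OF homogeneous_pow[OF homogeneous_Var]]] B tj that)
    then show ?thesis by (simp add: mult_ac)
  qed
  interpret L: abelian_group "Loc \<tau>" using loc_abelian[OF xm_closed[OF t1(1)]] var_prod_xm[OF t1(1)] by simp
  have "cech_coboundary n A i c \<tau> = finsum (Loc \<tau>) (\<lambda>j. fr (xm \<tau>) (ksign j \<tau> * (B (\<tau> - {j}) * Var j ^ m)) m) \<tau>"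
    unfolding cech_coboundary_def restrict_apply'[OF t]
  proof (rule L.finsum_cong'[OF refl])
    show "(\<lambda>j. fr (xm \<tau>) (ksign j \<tau> * (B (\<tau> - {j}) * Var j ^ m)) m) \<in> \<tau> \<rightarrow> carrier (Loc \<tau>)"
      unfolding var_prod_xm[OF t1(1)] loc_simps using cl by blast
  qed (rule coboundary_term[OF t1(1)], assumption, rule B[OF tj], assumption, rule c[OF tj])
  also have "\<dots> = fr (xm \<tau>) (\<Sum>j\<in>\<tau>. ksign j \<tau> * (B (\<tau> - {j}) * Var j ^ m)) m"
    unfolding var_prod_xm[OF t1(1)] by (rule loc_finsum[OF xm_closed[OF t1(1)] fin cl])
  finally show ?thesis .
qed

text \<open>Such a \<open>p\<close> is killed by x_F and hence is zero in the localization at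
  \<open>F\<close>.\<close>

lemma nonface_mult:
  assumes F: "F \<subseteq> {1..n}" and p: "p \<in> polys n"
    and nf: "\<And>m. m \<in> keys p \<Longrightarrow> F \<union> keys m \<notin> \<Delta>"
  shows "xm F * p \<in> SRI"
proof -
  have fin: "finite F" using F finite_subset by blast
  have "keys a \<notin> \<Delta>" if "a \<in> keys (xm F * p)" for a
  proof -
    obtain u v where "a = u + v" "u \<in> keys (xm F)" "v \<in> keys p"
      using keys_mult[of "xm F" p] \<open>a \<in> _\<close> by blast
    then have "a = ind_mon F + v" "v \<in> keys p" by (auto simp: xm_def)
    then show ?thesis using nf[of v] fin by (simp add: keys_plus_nat)
  qed
  then show ?thesis using F p by (auto simp: I_iff in_keys_iff)
qed

text \<open>The exponent vector of \<open>xm F ^ m\<close>; as a numerator over that denominator it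
  stands for the fraction 1.\<close>

definition const_mon :: "nat \<Rightarrow> nat set \<Rightarrow> mon" where
  "const_mon m F = (\<Sum>i\<in>F. single i m)"

lemma lookup_const_mon: "finite F \<Longrightarrow> lookup (const_mon m F) i = (if i \<in> F then m else 0)"
  by (simp add: const_mon_def lookup_sum lookup_single when_def sum.delta)

lemma const_mon_keys: "finite F \<Longrightarrow> keys (const_mon m F) \<subseteq> F"
  by (auto simp: in_keys_iff lookup_const_mon split: if_splits)

lemma const_mon_degree: "finite F \<Longrightarrow> mon_degree (const_mon m F) = card F * m"
  using mon_degree_superset[of F "const_mon m F"] const_mon_keys[of F m] by (simp add: lookup_const_mon)

lemma Var_pow: "Var i ^ m = single (single i m) (1 :: 'k)"
  by (induction m) (simp_all add: Var_def mult_single single_add[symmetric])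

text \<open>In degree \<open>p \<ge> 0\<close> a monomial \<open>x\<^sup>a / x\<^sub>F\<^sup>m\<close> on a facet \<open>F\<close> has a positive exponent at some \<open>i\<close>,
  and then it comes from \<open>F - {i}\<close> alone, unless it is \<open>1\<close>, where the coboundary is that of \<open>\<Delta>\<close>.\<close>

lemma cech_coboundary_surj:
  assumes dim: "\<And>F. F \<in> \<Delta> \<Longrightarrow> card F \<le> Suc i"
    and top: "\<And>c :: nat set \<Rightarrow> 'k. \<exists>b. \<forall>F\<in>\<Delta>. card F = Suc i \<longrightarrow> (\<Sum>x\<in>F. ksign x F * b (F - {x})) = c F"
    and p: "p \<ge> 0" and c: "c \<in> carrier (cech_cochains n A (Suc i) p)"
  shows "c \<in> cech_coboundary n A i ` carrier (cech_cochains n A i p)"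
proof -
  let ?d = "Suc i"
  have finI: "finite (index_sets n k)" for k
    unfolding index_sets_def by (rule finite_subset[of _ "Pow {1..n}"]) auto
  have c': "c \<in> (\<Pi>\<^sub>E \<sigma>\<in>index_sets n ?d. localization_part n A \<sigma> p)" using c by (simp add: cech_cochains_def)
  have "\<exists>a m. c F = fr (xm F) a m \<and> a \<in> homogeneous_part n (p + int (m * ?d))" if F: "F \<in> index_sets n ?d" for F
  proof -
    have "c F \<in> {fr (xm F) a m |a m. a \<in> homogeneous_part n (p + int (m * card F))}"
      using PiE_mem[OF c' F] by (simp only: part_iff[OF index_setsD(1)[OF F]])
    then show ?thesis unfolding index_setsD(2)[OF F] by blast
  qed
  then obtain a0 m0 where am: "\<And>F. F \<in> index_sets n ?d \<Longrightarrow> c F = fr (xm F) (a0 F) (m0 F)"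
    "\<And>F. F \<in> index_sets n ?d \<Longrightarrow> a0 F \<in> homogeneous_part n (p + int (m0 F * ?d))" by metis
  \<comment> \<open>A common exponent for all denominators; the sum is a convenient upper
    bound.\<close>
  define m where "m = (\<Sum>F\<in>index_sets n ?d. m0 F)"
  have m0: "m0 F \<le> m" if "F \<in> index_sets n ?d" for F
    unfolding m_def using that finI by (intro member_le_sum) auto
  define P0 where "P0 F = a0 F * xm F ^ (m - m0 F)" for F
  \<comment> \<open>No face is larger than \<open>F\<close>, so a monomial with a variable outside
    \<open>F\<close> vanishes in this localization.\<close>
  define P where "P F = restr (\<lambda>a. keys a \<subseteq> F) (P0 F)" for F
  have P0: "P0 F \<in> homogeneous_part n (p + int (m * ?d))" if F: "F \<in> index_sets n ?d" for F
  proof -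
    have "P0 F \<in> homogeneous_part n (p + int (m0 F * ?d) + int (m - m0 F) * int (card F))"
      unfolding P0_def using index_setsD[OF F] by (intro homogeneous_mult am(2) F homogeneous_pow xm_homogeneous)
    moreover have "p + int (m0 F * ?d) + int (m - m0 F) * int (card F) = p + int (m * ?d)"
      using index_setsD(2)[OF F] m0[OF F] by (simp add: of_nat_diff algebra_simps)
    ultimately show ?thesis by (simp only:)
  qed
  have P: "P F \<in> homogeneous_part n (p + int (m * ?d))" if F: "F \<in> index_sets n ?d" for F
    using P0[OF F] by (auto simp: homogeneous_part_iff P_def lookup_restr)
  have Pkeys: "keys a \<subseteq> F" if "a \<in> keys (P F)" for a F
    using that by (auto simp: P_def in_keys_iff lookup_restr split: if_splits)
  have big: "F \<union> K \<notin> \<Delta>" if F: "F \<in> index_sets n ?d" and K: "\<not> K \<subseteq> F" for F K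
  proof
    assume FK: "F \<union> K \<in> \<Delta>"
    have "card F < card (F \<union> K)" using face_finite[OF FK] K by (intro psubset_card_mono) auto
    then show False using dim[OF FK] index_setsD(2)[OF F] by simp
  qed
  have cP: "c F = fr (xm F) (P F) m" if F: "F \<in> index_sets n ?d" for F
  proof -
    have xF: "xm F \<in> polys n" using index_setsD(1)[OF F] by simp
    have "c F = fr (xm F) (P0 F) m"
      unfolding am(1)[OF F]
    proof (rule fr_eqI0)
      show "P0 F * xm F ^ m0 F = a0 F * xm F ^ m"
        using m0[OF F] by (simp add: P0_def mult.assoc power_add[symmetric])
    qed (use xF homogeneous_part_carrier[OF am(2)[OF F]] homogeneous_part_carrier[OF P0[OF F]] in auto)
    also have "\<dots> = fr (xm F) (P F) m"
    proof (rule fr_eqI[of _ _ _ 1])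
      have "xm F * (P F - P0 F) \<in> SRI"
      proof (rule nonface_mult[OF index_setsD(1)[OF F]])
        show "P F - P0 F \<in> polys n"
          using homogeneous_part_carrier[OF P[OF F]] homogeneous_part_carrier[OF P0[OF F]] by auto
        show "F \<union> keys a \<notin> \<Delta>" if "a \<in> keys (P F - P0 F)" for a
          using that by (intro big[OF F]) (auto simp: in_keys_iff lookup_minus P_def lookup_restr split: if_splits)
      qed
      then have "(P F - P0 F) * xm F \<in> SRI" by (simp add: mult.commute)
      from I_mult[OF poly_pow_closed[OF xF] this] have "xm F ^ m * ((P F - P0 F) * xm F) \<in> SRI" .
      then show "xm F ^ 1 * (P F * xm F ^ m - P0 F * xm F ^ m) \<in> SRI" by (simp add: algebra_simps)
    qed (use xF homogeneous_part_carrier[OF P[OF F]] homogeneous_part_carrier[OF P0[OF F]] in auto)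
    finally show ?thesis .
  qed
  \<comment> \<open>As \<open>p \<ge> 0\<close>, the degree is at least m |F|; if no exponent
    exceeds \<open>m\<close>, they all equal \<open>m\<close>.\<close>
  have pickex: "\<exists>x\<in>F. m < lookup a x"
    if F: "F \<in> index_sets n ?d" and a: "a \<in> keys (P F)" "a \<noteq> const_mon m F" for F a
  proof (rule ccontr)
    assume "\<not> ?thesis"
    then have le: "\<And>x. x \<in> F \<Longrightarrow> lookup a x \<le> m" by (auto simp: not_less)
    have fin: "finite F" using index_setsD(1)[OF F] finite_subset by blast
    have "int (mon_degree a) = p + int (m * ?d)" using P[OF F] a(1) unfolding homogeneous_part_iff in_keys_iff by blast
    then have "int (m * ?d) \<le> int (mon_degree a)" using p by linarith
    then have "card F * m \<le> mon_degree a" using index_setsD(2)[OF F] by (simp only: of_nat_le_iff mult.commute)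
    then have ge: "(\<Sum>x\<in>F. m) \<le> (\<Sum>x\<in>F. lookup a x)"
      using mon_degree_superset[OF fin Pkeys[OF a(1)]] by simp
    have "lookup a x = m" if x: "x \<in> F" for x
    proof (rule ccontr)
      assume "lookup a x \<noteq> m"
      then have "lookup a x < m" using le[OF x] by simp
      then have "(\<Sum>x\<in>F. lookup a x) < (\<Sum>x\<in>F. m)"
        using le x by (intro sum_strict_mono_ex1[OF fin]) auto
      then show False using ge by simp
    qed
    moreover have "lookup a x = 0" if "x \<notin> F" for x
      using Pkeys[OF a(1)] that by (metis in_keys_iff subsetD)
    ultimately have "a = const_mon m F" by (intro poly_mapping_eqI) (simp add: lookup_const_mon[OF fin])
    then show False using a(2) by simp
  qed
  define pick where "pick F a = (SOME x. x \<in> F \<and> m < lookup a x)" for F and a :: mon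
  have pick: "pick F a \<in> F" "m < lookup a (pick F a)"
    if "F \<in> index_sets n ?d" "a \<in> keys (P F)" "a \<noteq> const_mon m F" for F a
    using someI_ex[of "\<lambda>x. x \<in> F \<and> m < lookup a x"] pickex[OF that] unfolding pick_def by auto
  define T where "T x F = {a \<in> keys (P F). a \<noteq> const_mon m F \<and> pick F a = x}" for x F
  \<comment> \<open>The terms of \<open>P F\<close> assigned to \<open>x\<close>, divided by X_x^m,
    form the share of \<open>F - {x}\<close>. Their exponent at \<open>x\<close> exceeded
    \<open>m\<close>, so X_x still divides them.\<close>
  define D where "D x F = (if F \<in> \<Delta> then \<Sum>a\<in>T x F. single (a - single x m) (lookup (P F) a) else 0)" for x F
  obtain \<gamma> where \<gamma>: "\<And>F. F \<in> \<Delta> \<Longrightarrow> card F = ?d \<Longrightarrow> (\<Sum>x\<in>F. ksign x F * \<gamma> (F - {x})) = lookup (P F) (const_mon m F)"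
    using top[of "\<lambda>F. lookup (P F) (const_mon m F)"] by blast
  \<comment> \<open>The shares of all facets over \<open>G\<close> are added; for p = 0 there is
    also a multiple of the fraction 1, given by a simplicial cochain whose coboundary matches the
    coefficients at \<open>const_mon m F\<close>.\<close>
  define B where "B G = (\<Sum>x\<in>{1..n} - G. ksign x G * D x (insert x G))
    + (if p = 0 then single (const_mon m G) (\<gamma> G) else 0)" for G
  have ins: "insert x G \<in> index_sets n ?d" if "G \<in> index_sets n i" "x \<in> {1..n} - G" for x G
  proof -
    have "finite G" using index_setsD(1)[OF that(1)] finite_subset by blast
    then show ?thesis using that by (auto simp: index_sets_def)
  qed
  have split: "a = single x m + (a - single x m)" if "m \<le> lookup a x" for a :: mon and x
    using that by (intro poly_mapping_eqI) (auto simp: lookup_add lookup_minus lookup_single when_def)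
  have Dhom: "D x F \<in> homogeneous_part n (p + int (m * i))" if F: "F \<in> index_sets n ?d" for x F
  proof -
    have "single (a - single x m) k \<in> homogeneous_part n (p + int (m * i))"
      if a: "a \<in> T x F" for a k
    proof (rule homogeneous_single)
      from a have x: "m < lookup a x" using pick(2)[OF F, of a] by (auto simp: T_def)
      have ak: "a \<in> keys (P F)" using a by (simp add: T_def)
      have kd: "keys a \<subseteq> {1..n}" "int (mon_degree a) = p + int (m * ?d)"
        using P[OF F] ak unfolding homogeneous_part_iff in_keys_iff by blast+
      have "keys (a - single x m) \<subseteq> keys a" by (auto simp: in_keys_iff lookup_minus)
      then show "keys (a - single x m) \<subseteq> {1..n}" using kd(1) by blast
      have "mon_degree a = m + mon_degree (a - single x m)"
        using mon_degree_plus[of "single x m" "a - single x m"] split[of a x] x by simp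
      then show "int (mon_degree (a - single x m)) = p + int (m * i)" using kd(2) by (simp add: algebra_simps)
    qed
    then show ?thesis unfolding D_def by (auto intro!: homogeneous_sum)
  qed
  have Dkeys: "x \<in> keys a" if F: "F \<in> index_sets n ?d" and a: "a \<in> keys (D x F)" for x F a
  proof -
    have "keys (D x F) \<subseteq> (\<lambda>a. a - single x m) ` T x F"
    proof
      fix b assume "b \<in> keys (D x F)"
      then have "F \<in> \<Delta>" "(\<Sum>a\<in>T x F. lookup (single (a - single x m) (lookup (P F) a)) b) \<noteq> 0"
        by (auto simp: D_def in_keys_iff lookup_sum split: if_splits)
      then obtain a where "a \<in> T x F" "lookup (single (a - single x m) (lookup (P F) a)) b \<noteq> 0"
        by (metis (no_types, lifting) sum.neutral)
      then show "b \<in> (\<lambda>a. a - single x m) ` T x F" by (auto simp: lookup_single when_def split: if_splits)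
    qed
    then obtain b where b: "b \<in> T x F" "a = b - single x m" using a by blast
    then have "m < lookup b x" using pick(2)[OF F, of b] by (auto simp: T_def)
    then show ?thesis by (simp add: b(2) in_keys_iff lookup_minus)
  qed
  have Bhom: "B G \<in> homogeneous_part n (p + int (m * i))" if G: "G \<in> index_sets n i" for G
  proof -
    have "finite G" using index_setsD(1)[OF G] finite_subset by blast
    then have "p = 0 \<Longrightarrow> single (const_mon m G) (\<gamma> G) \<in> homogeneous_part n (p + int (m * i))"
      using const_mon_keys[of G m] const_mon_degree[of G m] index_setsD[OF G] by (intro homogeneous_single) auto
    moreover have "(\<Sum>x\<in>{1..n} - G. ksign x G * D x (insert x G)) \<in> homogeneous_part n (p + int (m * i))"
      by (intro homogeneous_sum homogeneous_ksign Dhom ins[OF G])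
    ultimately show ?thesis unfolding B_def by (cases "p = 0") (simp_all only: if_True if_False add_0_right simp_thms homogeneous_add)
  qed
  define b where "b = (\<lambda>G\<in>index_sets n i. fr (xm G) (B G) m)"
  have b: "b \<in> carrier (cech_cochains n A i p)"
  proof -
    have "fr (xm G) (B G) m \<in> localization_part n A G p" if G: "G \<in> index_sets n i" for G
      unfolding part_iff[OF index_setsD(1)[OF G]] using Bhom[OF G] index_setsD(2)[OF G] by blast
    then show ?thesis by (simp add: b_def cech_cochains_def restrict_PiE_iff)
  qed
  have "cech_coboundary n A i b = c"
  proof (rule PiE_ext)
    show "c \<in> (\<Pi>\<^sub>E \<sigma>\<in>index_sets n ?d. localization_part n A \<sigma> p)" by (rule c')
    show "cech_coboundary n A i b \<in> (\<Pi>\<^sub>E \<sigma>\<in>index_sets n ?d. localization_part n A \<sigma> p)"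
      using coboundary_part[OF b] by (simp add: cech_cochains_def)
    fix F assume F: "F \<in> index_sets n ?d"
    note F1 = index_setsD[OF F]
    have fin: "finite F" using F1(1) finite_subset by blast
    let ?S = "\<Sum>j\<in>F. ksign j F * (B (F - {j}) * Var j ^ m)"
    have Fj: "F - {j} \<in> index_sets n i" if "j \<in> F" for j
      using that F1 fin by (auto simp: index_sets_def)
    have eq: "cech_coboundary n A i b F = fr (xm F) ?S m"
      by (rule coboundary_common[OF F]) (use homogeneous_part_carrier[OF Bhom] in \<open>auto simp: b_def\<close>)
    show "cech_coboundary n A i b F = c F"
    proof (cases "F \<in> \<Delta>")
      case False
      have "cech_coboundary n A i b F \<in> carrier (Loc F)" "c F \<in> carrier (Loc F)"
        using coboundary_part[OF b] F c' part_carrier[OF F1(1)] by (auto simp: cech_cochains_def)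
      then show ?thesis using loc_nonface[OF F1(1) False] by metis
    next
      case True
      \<comment> \<open>Cross terms: a share meant for another set \<open>insert x (F - {j})\<close>
        still contains X_x with x outside \<open>F\<close>, so x_F kills it.\<close>
      define R where "R j = (\<Sum>x\<in>{1..n} - F. ksign j F * (ksign x (F - {j}) * D x (insert x (F - {j})) * Var j ^ m))" for j
      have Rcl: "R j \<in> polys n" if j: "j \<in> F" for j
      proof -
        have "j \<in> {1..n}" using j F1(1) by blast
        then have "ksign x (F - {j}) * D x (insert x (F - {j})) * Var j ^ m \<in> homogeneous_part n (p + int (m * i) + int m * 1)"
          if "x \<in> {1..n} - F" for x
          using that by (intro homogeneous_mult homogeneous_ksign Dhom ins[OF Fj[OF j]] homogeneous_pow homogeneous_Var) auto
        then show ?thesis unfolding R_def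
          by (intro poly_sum_closed homogeneous_part_carrier[OF homogeneous_ksign]) blast
      qed
      have RI: "xm F * R j \<in> SRI" if j: "j \<in> F" for j
      proof (rule nonface_mult[OF F1(1) Rcl[OF j]])
        fix a assume "a \<in> keys (R j)"
        then have "(\<Sum>x\<in>{1..n} - F. lookup (ksign j F * (ksign x (F - {j}) * D x (insert x (F - {j})) * Var j ^ m)) a) \<noteq> 0"
          by (simp add: R_def in_keys_iff lookup_sum)
        then obtain x where x: "x \<in> {1..n} - F" "lookup (ksign j F * (ksign x (F - {j}) * D x (insert x (F - {j})) * Var j ^ m)) a \<noteq> 0"
          by (metis (no_types, lifting) sum.neutral)
        then have "lookup (D x (insert x (F - {j})) * Var j ^ m) a \<noteq> 0"
          by (auto simp: lookup_ksign_mult mult.assoc)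
        then obtain u v where "a = u + v" "u \<in> keys (D x (insert x (F - {j})))"
          using keys_mult[of "D x (insert x (F - {j}))" "Var j ^ m"] by (auto simp: in_keys_iff)
        moreover from this have "x \<in> keys u" using Dkeys[OF ins[OF Fj[OF j]]] x(1) by blast
        ultimately have "x \<in> keys a" by (simp add: keys_plus_nat)
        then show "F \<union> keys a \<notin> \<Delta>" using x(1) by (intro big[OF F]) blast
      qed
      have DF: "D j F * Var j ^ m = (\<Sum>a\<in>T j F. single a (lookup (P F) a))" for j
      proof -
        have "D j F * Var j ^ m = (\<Sum>a\<in>T j F. single (a - single j m) (lookup (P F) a) * Var j ^ m)"
          using True by (simp add: D_def sum_distrib_right)
        also have "\<dots> = (\<Sum>a\<in>T j F. single a (lookup (P F) a))"
        proof (rule sum.cong[OF refl])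
          fix a assume "a \<in> T j F"
          then have "m < lookup a j" using pick(2)[OF F, of a] by (auto simp: T_def)
          then have "a - single j m + single j m = a"
            using split[of a j] by (simp add: add.commute)
          then show "single (a - single j m) (lookup (P F) a) * Var j ^ m
              = single a (lookup (P F) a)"
            by (simp add: Var_pow mult_single)
        qed
        finally show ?thesis .
      qed
      have tm: "ksign j F * (B (F - {j}) * Var j ^ m) =
          D j F * Var j ^ m + R j + (if p = 0 then single (const_mon m F) (ksign j F * \<gamma> (F - {j})) else 0)"
        if j: "j \<in> F" for j
      proof -
        have jn: "j \<in> {1..n}" using j F1(1) by blast
        have set: "{1..n} - (F - {j}) = insert j ({1..n} - F)" using jn by blast
        have "(\<Sum>x\<in>{1..n} - (F - {j}). ksign x (F - {j}) * D x (insert x (F - {j})))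
          = ksign j F * D j F + (\<Sum>x\<in>{1..n} - F. ksign x (F - {j}) * D x (insert x (F - {j})))"
          unfolding set using j by (subst sum.insert) (auto simp: insert_absorb)
        then have "ksign j F * ((\<Sum>x\<in>{1..n} - (F - {j}). ksign x (F - {j}) * D x (insert x (F - {j}))) * Var j ^ m) =
          D j F * Var j ^ m + R j"
          by (simp add: R_def distrib_right distrib_left sum_distrib_right sum_distrib_left mult.assoc)
        moreover have "ksign j F * (single (const_mon m (F - {j})) (\<gamma> (F - {j})) * Var j ^ m)
          = single (const_mon m F) (ksign j F * \<gamma> (F - {j}))"
        proof -
          have "const_mon m (F - {j}) + single j m = const_mon m F"
            using fin j unfolding const_mon_def by (simp add: sum.remove add.commute)
          then show ?thesis
            by (intro poly_mapping_eqI) (simp add: lookup_ksign_mult Var_pow mult_single lookup_single when_def)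
        qed
        ultimately show ?thesis by (simp add: B_def distrib_left distrib_right)
      qed
      have "?S = (\<Sum>j\<in>F. D j F * Var j ^ m) + (\<Sum>j\<in>F. R j)
          + (if p = 0 then single (const_mon m F) (\<Sum>j\<in>F. ksign j F * \<gamma> (F - {j})) else 0)"
        by (simp add: tm sum.distrib single_sum)
      also have "(if p = 0 then single (const_mon m F) (\<Sum>j\<in>F. ksign j F * \<gamma> (F - {j})) else 0)
          = single (const_mon m F) (lookup (P F) (const_mon m F))"
      proof (cases "p = 0")
        case True
        then show ?thesis using \<gamma>[OF \<open>F \<in> \<Delta>\<close> F1(2)] by simp
      next
        case False
        then have "lookup (P F) (const_mon m F) = 0"
          using P[OF F] const_mon_degree[OF fin, of m] F1(2) by (auto simp: homogeneous_part_iff mult.commute)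
        then show ?thesis using False by simp
      qed
      \<comment> \<open>Every term except the one at \<open>const_mon m F\<close> was assigned to
        exactly one vertex of \<open>F\<close>.\<close>
      also have "(\<Sum>j\<in>F. D j F * Var j ^ m) = (\<Sum>a\<in>keys (P F) - {const_mon m F}. single a (lookup (P F) a))"
      proof -
        have "(\<Sum>j\<in>F. D j F * Var j ^ m) = (\<Sum>a\<in>(\<Union>j\<in>F. T j F). single a (lookup (P F) a))"
          unfolding DF by (rule sum.UNION_disjoint[symmetric]) (use fin in \<open>auto simp: T_def\<close>)
        also have "(\<Union>j\<in>F. T j F) = keys (P F) - {const_mon m F}"
          using pick(1)[OF F] by (auto simp: T_def)
        finally show ?thesis .
      qed
      finally have S: "?S = (\<Sum>a\<in>keys (P F) - {const_mon m F}. single a (lookup (P F) a))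
          + (\<Sum>j\<in>F. R j) + single (const_mon m F) (lookup (P F) (const_mon m F))" .
      have "(\<Sum>a\<in>keys (P F) - {const_mon m F}. single a (lookup (P F) a))
          + single (const_mon m F) (lookup (P F) (const_mon m F)) = P F"
        by (rule poly_mapping_eqI) (auto simp: lookup_add lookup_sum lookup_single when_def sum.delta in_keys_iff)
      then have S': "?S = P F + (\<Sum>j\<in>F. R j)" unfolding S by (simp add: algebra_simps)
      have Pc: "P F \<in> polys n" using P[OF F] by blast
      have Rc: "(\<Sum>j\<in>F. R j) \<in> polys n" by (rule poly_sum_closed[OF Rcl])
      have xF: "xm F \<in> polys n" using F1(1) by simp
      have "xm F ^ m * (- (\<Sum>j\<in>F. xm F * R j)) \<in> SRI"
        by (rule I_mult[OF poly_pow_closed[OF xF] I_uminus[OF I_sum[OF RI]]])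
      then have "xm F ^ m * (- (xm F * (\<Sum>j\<in>F. R j))) \<in> SRI" by (simp only: sum_distrib_left)
      then have "xm F ^ 1 * (P F * xm F ^ m - (P F + (\<Sum>j\<in>F. R j)) * xm F ^ m) \<in> SRI"
        by (simp add: algebra_simps)
      then have "fr (xm F) (P F + (\<Sum>j\<in>F. R j)) m = fr (xm F) (P F) m"
        by (rule fr_eqI[OF xF poly_add_closed[OF Pc Rc] Pc])
      then show ?thesis unfolding eq S' cP[OF F] .
    qed
  qed
  then show ?thesis using b by blast
qed

text \<open>In degrees p >= 0 every cochain of degree \<open>Suc i\<close> is a coboundary. It is
  also a cocycle, because larger sets are nonfaces and their localizations are zero. The quotient is
  a group modulo itself.\<close>

lemma local_cohomology_trivial:
  assumes dim: "\<And>F. F \<in> \<Delta> \<Longrightarrow> card F \<le> Suc i"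
    and top: "\<And>c :: nat set \<Rightarrow> 'k. \<exists>b. \<forall>F\<in>\<Delta>. card F = Suc i \<longrightarrow> (\<Sum>x\<in>F. ksign x F * b (F - {x})) = c F"
    and p: "p \<ge> 0"
  shows "carrier (local_cohomology n A (Suc i) p) = {\<one>\<^bsub>local_cohomology n A (Suc i) p\<^esub>}"
proof -
  let ?C = "cech_cochains n A (Suc i) p"
  interpret C: group ?C by (rule cochain_group)
  have bd: "cech_coboundaries n A (Suc i) p = carrier ?C"
    using coboundary_part cech_coboundary_surj[OF dim top p] by (auto simp: cech_coboundaries_def)
  have "cech_coboundary n A (Suc i) c = \<one>\<^bsub>cech_cochains n A (Suc (Suc i)) p\<^esub>" if c: "c \<in> carrier ?C" for c
  proof (rule PiE_ext)
    show "cech_coboundary n A (Suc i) c \<in> (\<Pi>\<^sub>E \<sigma>\<in>index_sets n (Suc (Suc i)). localization_part n A \<sigma> p)"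
      using coboundary_part[OF c] by (simp add: cech_cochains_def)
    have "\<one>\<^bsub>cech_cochains n A (Suc (Suc i)) p\<^esub> \<in> carrier (cech_cochains n A (Suc (Suc i)) p)"
      by (rule monoid.one_closed[OF group.is_monoid[OF cochain_group]])
    then show "\<one>\<^bsub>cech_cochains n A (Suc (Suc i)) p\<^esub> \<in> (\<Pi>\<^sub>E \<sigma>\<in>index_sets n (Suc (Suc i)). localization_part n A \<sigma> p)"
      by (simp add: cech_cochains_def)
    fix \<sigma> assume s: "\<sigma> \<in> index_sets n (Suc (Suc i))"
    have "\<sigma> \<notin> \<Delta>" using dim index_setsD(2)[OF s] by fastforce
    moreover have "cech_coboundary n A (Suc i) c \<sigma> \<in> carrier (Loc \<sigma>)"
      using coboundary_part[OF c] s part_carrier[OF index_setsD(1)[OF s]] by (auto simp: cech_cochains_def)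
    ultimately have "cech_coboundary n A (Suc i) c \<sigma> = \<zero>\<^bsub>Loc \<sigma>\<^esub>" by (rule loc_nonface[OF index_setsD(1)[OF s]])
    then show "cech_coboundary n A (Suc i) c \<sigma> = \<one>\<^bsub>cech_cochains n A (Suc (Suc i)) p\<^esub> \<sigma>"
      using s by (simp add: cech_cochains_def)
  qed
  then have "kernel ?C (cech_cochains n A (Suc (Suc i)) p) (cech_coboundary n A (Suc i)) = carrier ?C"
    by (auto simp: kernel_def)
  then have "cech_cocycles n A (Suc i) p = ?C" by (simp add: cech_cocycles_def)
  then have H: "local_cohomology n A (Suc i) p = ?C Mod carrier ?C" by (simp add: local_cohomology_def bd)
  have "rcosets\<^bsub>?C\<^esub> (carrier ?C) = {carrier ?C}"
    unfolding RCOSETS_def using C.coset_join2[OF _ C.subgroup_self] C.one_closed by auto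
  then show ?thesis by (simp add: H FactGroup_def)
qed

end

section \<open>Dimension and multiplicity\<close>

text \<open>Setting the variables outside \<open>G\<close> to 0 is multiplicative; primality of the
  ideals attached to faces rests on this.\<close>

lemma restr_mult:
  "restr (\<lambda>m. keys m \<subseteq> G) (p * p') = restr (\<lambda>m. keys m \<subseteq> G) p * restr (\<lambda>m. keys m \<subseteq> G) (p' :: 'k::comm_ring_1 mpoly)"
proof -
  let ?r = "restr (\<lambda>m. keys m \<subseteq> G) :: 'k mpoly \<Rightarrow> 'k mpoly"
  have add: "?r (a + b) = ?r a + ?r b" for a b
    by (rule poly_mapping_eqI) (simp add: lookup_restr lookup_add)
  have zero: "?r (a * b) = 0" if nk: "\<And>m. m \<in> keys a \<Longrightarrow> \<not> keys m \<subseteq> G" for a b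
  proof (rule poly_mapping_eqI)
    fix m
    have "lookup (a * b) m = 0" if m: "keys m \<subseteq> G"
    proof (rule ccontr)
      assume "lookup (a * b) m \<noteq> 0"
      then obtain u v where "m = u + v" "u \<in> keys a" using keys_mult[of a b] by (auto simp: in_keys_iff)
      then show False using nk[of u] m by (auto simp: keys_plus_nat)
    qed
    then show "lookup (?r (a * b)) m = lookup 0 m" by (simp add: lookup_restr)
  qed
  have keep: "?r (?r a * ?r b) = ?r a * ?r b" for a b
  proof (rule poly_mapping_eqI)
    fix m
    have "keys m \<subseteq> G" if "m \<in> keys (?r a * ?r b)"
      using keys_mult[of "?r a" "?r b"] that
      by (fastforce simp: in_keys_iff[of _ "?r a"] in_keys_iff[of _ "?r b"] lookup_restr keys_plus_nat split: if_splits)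
    then show "lookup (?r (?r a * ?r b)) m = lookup (?r a * ?r b) m"
      by (auto simp: lookup_restr in_keys_iff)
  qed
  have rest: "\<not> keys m \<subseteq> G" if "m \<in> keys (a - ?r a)" for a m
    using that by (auto simp: in_keys_iff lookup_minus lookup_restr)
  have "p * p' = ?r p * ?r p' + ((p - ?r p) * p' + (p' - ?r p') * ?r p)" by (simp add: algebra_simps)
  then have "?r (p * p') = ?r (?r p * ?r p') + (?r ((p - ?r p) * p') + ?r ((p' - ?r p') * ?r p))" by (simp only: add)
  then show ?thesis using rest by (simp add: keep zero)
qed

text \<open>The denominator uses \<open>Suc t\<close> because monomials of degree t + 1 with a given
  support of size k + 1 are counted by \<open>t choose k\<close>.\<close>

lemma binomial_asymptotics: "(\<lambda>t. real (t choose k) / real (Suc t) ^ k) \<longlonglongrightarrow> 1 / fact k"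
proof -
  have "(\<lambda>t. (real t - real i) / real (Suc t)) \<longlonglongrightarrow> 1" for i
  proof -
    have "(\<lambda>t. 1 - (1 + real i) * inverse (real (Suc t))) \<longlonglongrightarrow> 1 - (1 + real i) * 0"
      by (intro tendsto_intros LIMSEQ_inverse_real_of_nat)
    then show ?thesis by (simp add: field_simps)
  qed
  then have "(\<lambda>t. (\<Prod>i=0..<k. (real t - real i) / real (Suc t)) / fact k) \<longlonglongrightarrow> (\<Prod>i=0..<k. 1) / fact k"
    by (intro tendsto_divide tendsto_prod tendsto_const) auto
  moreover have "(\<Prod>i=0..<k. (real t - real i) / real (Suc t)) / fact k = real (t choose k) / real (Suc t) ^ k" for t
    by (simp add: binomial_gbinomial gbinomial_prod_rev prod_dividef)
  ultimately show ?thesis by simp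
qed

text \<open>For finite \<open>F\<close> this counts the compositions of \<open>t\<close> into |F|
  positive parts; it is the contribution of one face to the Hilbert function.\<close>

definition support_count :: "nat set \<Rightarrow> nat \<Rightarrow> nat" where
  "support_count F t = card {m :: mon. keys m = F \<and> mon_degree m = t}"

lemma finite_support: "finite {m :: mon. keys m = F \<and> mon_degree m = t}"
proof (cases "finite F")
  case True
  show ?thesis by (rule finite_subset[OF _ finite_monomials[OF True, of t]]) auto
next
  case False
  then have "{m :: mon. keys m = F \<and> mon_degree m = t} = {}" by auto
  then show ?thesis by (simp only: finite.emptyI)
qed

text \<open>Dividing by X_v leaves support \<open>F\<close> or \<open>insert v F\<close>, according
  to whether the exponent of \<open>v\<close> was 1 or larger. This is Pascal's rule.\<close>

lemma support_count_Suc: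
  assumes "finite F" "v \<notin> F"
  shows "support_count (insert v F) (Suc t) = support_count F t + support_count (insert v F) t"
proof -
  let ?X = "\<lambda>F t. {m :: mon. keys m = F \<and> mon_degree m = t}"
  have "bij_betw (\<lambda>m. m + single v 1) (?X F t \<union> ?X (insert v F) t) (?X (insert v F) (Suc t))"
  proof (rule bij_betw_imageI)
    show "(\<lambda>m. m + single v 1) ` (?X F t \<union> ?X (insert v F) t) = ?X (insert v F) (Suc t)"
    proof (intro equalityI subsetI)
      fix m assume m: "m \<in> ?X (insert v F) (Suc t)"
      then have v: "v \<in> keys m" by auto
      define m' where "m' = m - single v 1"
      have mm: "m = m' + single v 1" using single_le[OF v] by (simp add: m'_def add.commute)
      have "mon_degree m' = t" using m mon_degree_plus[of m' "single v 1"] mm by simp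
      moreover have "keys m' = F \<or> keys m' = insert v F"
      proof -
        have "insert v (keys m') = insert v F" using m mm keys_plus_nat[of m' "single v 1"] by auto
        then show ?thesis using assms(2) by (cases "v \<in> keys m'") (auto simp: insert_ident insert_absorb)
      qed
      ultimately show "m \<in> (\<lambda>m. m + single v 1) ` (?X F t \<union> ?X (insert v F) t)"
        by (intro image_eqI[where x = m'] mm) auto
    next
      fix m assume "m \<in> (\<lambda>m. m + single v 1) ` (?X F t \<union> ?X (insert v F) t)"
      then obtain m' where m': "m = m' + single v 1" "keys m' = F \<or> keys m' = insert v F"
        "mon_degree m' = t" by blast
      have "keys m = insert v (keys m')" by (simp add: m'(1) keys_plus_nat)
      then have "keys m = insert v F" using m'(2) by (elim disjE) simp_all
      moreover have "mon_degree m = Suc t" using m'(3) by (simp add: m'(1) mon_degree_plus)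
      ultimately show "m \<in> ?X (insert v F) (Suc t)" by simp
    qed
    show "inj_on (\<lambda>m. m + single v 1) (?X F t \<union> ?X (insert v F) t)" by (rule inj_onI) simp
  qed
  then have "card (?X F t \<union> ?X (insert v F) t) = card (?X (insert v F) (Suc t))" by (rule bij_betw_same_card)
  moreover have "card (?X F t \<union> ?X (insert v F) t) = card (?X F t) + card (?X (insert v F) t)"
    by (rule card_Un_disjoint) (use finite_support assms in auto)
  ultimately show ?thesis by (simp add: support_count_def)
qed

lemma support_count_empty: "support_count {} t = (if t = 0 then 1 else 0)"
proof -
  have "{m :: mon. keys m = {} \<and> mon_degree m = t} = (if t = 0 then {0} else {})"
    by auto
  then show ?thesis by (simp add: support_count_def)
qed

lemma support_count_zero: "F \<noteq> {} \<Longrightarrow> support_count F 0 = 0"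
  by (auto simp: support_count_def)

lemma support_count_eq: "finite F \<Longrightarrow> F \<noteq> {} \<Longrightarrow> support_count F (Suc t) = t choose (card F - 1)"
proof (induction t arbitrary: F)
  case 0
  then obtain v F' where F: "F = insert v F'" "v \<notin> F'" "finite F'" by (metis finite.cases finite_insert insert_absorb mk_disjoint_insert)
  then show ?case
    by (cases "F' = {}") (auto simp: support_count_Suc support_count_zero support_count_empty card_gt_0_iff)
next
  case (Suc t)
  then obtain v F' where F: "F = insert v F'" "v \<notin> F'" "finite F'" by (metis finite.cases finite_insert insert_absorb mk_disjoint_insert)
  show ?case
  proof (cases "F' = {}")
    case True
    then show ?thesis using Suc.IH[of F] F support_count_Suc[OF F(3,2)] by (simp add: support_count_empty)
  next
    case False
    then obtain k where "card F' = Suc k" using F(3) by (metis card_eq_0_iff not0_implies_Suc)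
    then show ?thesis using Suc.IH[of F] Suc.IH[of F'] F False support_count_Suc[OF F(3,2)] by simp
  qed
qed

context sr_complex
begin

text \<open>The quotient is the polynomial ring in the variables of \<open>G\<close>. The condition
  is independent of the representative since all subsets of \<open>G\<close> are faces.\<close>

lemma face_prime:
  assumes G: "G \<in> \<Delta>"
  shows "primeideal {q p |p. p \<in> polys n \<and> (\<forall>m. keys m \<subseteq> G \<longrightarrow> lookup p m = 0)} A"
    (is "primeideal ?P A")
proof (rule primeidealI[OF idealI cring_A])
  have mem: "q p \<in> ?P \<longleftrightarrow> (\<forall>m. keys m \<subseteq> G \<longrightarrow> lookup p m = 0)"
    if p: "p \<in> polys n" for p
  proof
    assume "q p \<in> ?P"
    then obtain p' where p': "q p = q p'" "p' \<in> polys n"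
      "\<And>m. keys m \<subseteq> G \<Longrightarrow> lookup p' m = 0" by auto
    then have "p - p' \<in> SRI" using q_eq_iff[OF p p'(2)] by simp
    then show "\<forall>m. keys m \<subseteq> G \<longrightarrow> lookup p m = 0"
      using p'(3) face_down[OF G] by (auto simp: I_iff lookup_minus)
  qed (use p in blast)
  have mem': "q p \<in> ?P \<longleftrightarrow> restr (\<lambda>m. keys m \<subseteq> G) p = 0" if p: "p \<in> polys n" for p
    unfolding mem[OF p] by (auto simp: poly_mapping_eq_iff fun_eq_iff lookup_restr)
  show "ring A" by (rule ring_axioms)
  have l: "x \<otimes>\<^bsub>A\<^esub> a \<in> ?P" if a: "a \<in> ?P" and x: "x \<in> carrier A" for a x
  proof -
    obtain p where p: "a = q p" "p \<in> polys n" using a by auto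
    obtain p' where p': "x = q p'" "p' \<in> polys n" using x by (elim carrier_A_E) auto
    have "restr (\<lambda>m. keys m \<subseteq> G) p = 0" using a mem'[OF p(2)] p(1) by simp
    then show ?thesis using mem'[of "p' * p"] p p' by (simp add: mult_q restr_mult)
  qed
  then show "x \<otimes>\<^bsub>A\<^esub> a \<in> ?P" if "a \<in> ?P" "x \<in> carrier A" for a x using that .
  have Pc: "?P \<subseteq> carrier A" by auto
  show "a \<otimes>\<^bsub>A\<^esub> x \<in> ?P" if "a \<in> ?P" "x \<in> carrier A" for a x
    using l[OF that] m_comm[of a x] Pc that by (metis (no_types, lifting) subsetD)
  show "subgroup ?P (add_monoid A)"
  proof (rule add.subgroupI)
    show "?P \<noteq> {}" by (auto intro!: exI[of _ "0 :: 'k mpoly"])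
    fix a b assume "a \<in> ?P" "b \<in> ?P"
    then obtain p p' where p: "a = q p" "p \<in> polys n" "\<And>m. keys m \<subseteq> G \<Longrightarrow> lookup p m = 0"
      "b = q p'" "p' \<in> polys n" "\<And>m. keys m \<subseteq> G \<Longrightarrow> lookup p' m = 0" by auto
    show "\<ominus>\<^bsub>A\<^esub> a \<in> ?P" using mem[of "- p"] p by (simp add: uminus_q)
    show "a \<oplus>\<^bsub>A\<^esub> b \<in> ?P" using mem[of "p + p'"] p by (simp add: add_q lookup_add)
  qed (use Pc in auto)
  have "q 1 \<notin> ?P" using mem[OF poly_one_closed] by (auto intro!: exI[of _ 0] simp: lookup_one)
  then show "carrier A \<noteq> ?P" using q_closed[OF poly_one_closed] by blast
  fix a b assume a: "a \<in> carrier A" and b: "b \<in> carrier A" and ab: "a \<otimes>\<^bsub>A\<^esub> b \<in> ?P"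
  obtain p where p: "a = q p" "p \<in> polys n" using a by (elim carrier_A_E) auto
  obtain p' where p': "b = q p'" "p' \<in> polys n" using b by (elim carrier_A_E) auto
  have "restr (\<lambda>m. keys m \<subseteq> G) (p * p') = 0" using ab mem'[of "p * p'"] p p' by (simp add: mult_q)
  then show "a \<in> ?P \<or> b \<in> ?P" using mem'[of p] mem'[of p'] p p' by (simp add: restr_mult)
qed

text \<open>Dropping the vertices of \<open>F\<close> one at a time adds one more variable to the
  prime each time, which gives a strict chain of length |F|.\<close>

lemma krull_dim_ge:
  assumes F: "F \<in> \<Delta>"
  shows "enat (card F) \<le> krull_dim A"
proof -
  define P where "P G = {q p |p. p \<in> polys n \<and> (\<forall>m. keys m \<subseteq> G \<longrightarrow> lookup p m = 0)}" for G
  obtain f where f: "bij_betw f {0..<card F} F" using ex_bij_betw_nat_finite[OF face_finite[OF F]] by blast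
  have prime: "primeideal (P (f ` {i..<card F})) A" for i
    unfolding P_def
  proof (rule face_prime[OF face_down[OF F]])
    show "f ` {i..<card F} \<subseteq> F" using bij_betw_imp_surj_on[OF f] by fastforce
  qed
  have strict: "P (f ` {i..<card F}) \<subset> P (f ` {Suc i..<card F})" if i: "i < card F" for i
  proof
    show "P (f ` {i..<card F}) \<subseteq> P (f ` {Suc i..<card F})"
    proof
      fix x assume "x \<in> P (f ` {i..<card F})"
      then obtain p where p: "x = q p" "p \<in> polys n"
        "\<And>m. keys m \<subseteq> f ` {i..<card F} \<Longrightarrow> lookup p m = 0" by (auto simp: P_def)
      have "f ` {Suc i..<card F} \<subseteq> f ` {i..<card F}" by auto
      then have "\<forall>m. keys m \<subseteq> f ` {Suc i..<card F} \<longrightarrow> lookup p m = 0"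
        using p(3) by (meson subset_trans)
      then show "x \<in> P (f ` {Suc i..<card F})" unfolding P_def using p(1,2) by (intro CollectI exI[of _ p]) simp
    qed
    have fi: "f i \<in> F" using bij_betwE[OF f] i by simp
    have v: "Var (f i) \<in> polys n" using face_subset[OF F] fi by (intro Var_closed) blast
    have notin: "f i \<notin> f ` {Suc i..<card F}"
    proof
      assume "f i \<in> f ` {Suc i..<card F}"
      then obtain k where "Suc i \<le> k" "k < card F" "f i = f k" by auto
      then show False using inj_onD[OF bij_betw_imp_inj_on[OF f], of i k] i by simp
    qed
    have "q (Var (f i)) \<in> P (f ` {Suc i..<card F})"
      unfolding P_def using v notin by (auto simp: Var_def lookup_single when_def intro!: exI[of _ "Var (f i)"])
    moreover have "q (Var (f i)) \<notin> P (f ` {i..<card F})"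
    proof
      assume "q (Var (f i)) \<in> P (f ` {i..<card F})"
      then obtain p where p: "q (Var (f i)) = q p" "p \<in> polys n"
        "\<And>m. keys m \<subseteq> f ` {i..<card F} \<Longrightarrow> lookup p m = 0" by (auto simp: P_def)
      then have "Var (f i) - p \<in> SRI" using q_eq_iff[OF v] by simp
      moreover have "{f i} \<in> \<Delta>" using face_down[OF F] fi by simp
      ultimately have "lookup (Var (f i) - p) (single (f i) 1) = 0" by (simp add: I_iff)
      moreover have "lookup p (single (f i) 1) = 0" using i by (intro p(3)) auto
      ultimately show False by (simp add: lookup_minus Var_def)
    qed
    ultimately show "P (f ` {i..<card F}) \<noteq> P (f ` {Suc i..<card F})" by blast
  qed
  have "enat (card F) \<in> {enat l |l. \<exists>P. (\<forall>i\<le>l. primeideal (P i) A) \<and> (\<forall>i<l. P i \<subset> P (Suc i))}"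
    using prime strict by (auto intro!: exI[of _ "\<lambda>i. P (f ` {i..<card F})"])
  then show ?thesis unfolding krull_dim_def by (rule Sup_upper)
qed

text \<open>For n = 0 the empty family is a complex. Its ring is zero, has no primes and gets
  dimension 0, so positive dimension forces \<open>{} \<in> \<Delta>\<close>.\<close>

lemma krull_dim_void:
  assumes "\<Delta> = {}"
  shows "krull_dim A = 0"
proof -
  have "p \<in> SRI" if "p \<in> polys n" for p unfolding I_iff using that assms by simp
  then have car: "carrier A = {\<zero>\<^bsub>A\<^esub>}" using q_eq_zero_iff by (auto simp: A_simps(1) image_iff intro!: bexI[of _ 0])
  have "\<not> primeideal P A" for P
  proof
    assume "primeideal P A"
    then interpret P: primeideal P A .
    have "P \<subseteq> {\<zero>\<^bsub>A\<^esub>}" using P.a_subset by (simp only: car)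
    moreover have "\<zero>\<^bsub>A\<^esub> \<in> P" by (rule additive_subgroup.zero_closed[OF P.is_additive_subgroup])
    ultimately have "carrier A = P" unfolding car by blast
    then show False using P.I_notcarr by simp
  qed
  then have "{enat l |l. \<exists>P. (\<forall>i\<le>l. primeideal (P i) A) \<and> (\<forall>i<l. P i \<subset> P (Suc i))} = {}" by blast
  then show ?thesis by (simp only: krull_dim_def Sup_empty bot_enat_def)
qed

section \<open>Hilbert function and multiplicity\<close>

definition hilb :: "nat \<Rightarrow> nat" where
  "hilb t = card {m :: mon. keys m \<in> \<Delta> \<and> mon_degree m = t}"

lemma hilbert_monomials_finite: "finite {m :: mon. keys m \<in> \<Delta> \<and> mon_degree m = t}"
proof (rule finite_subset)
  show "{m :: mon. keys m \<in> \<Delta> \<and> mon_degree m = t} \<subseteq> (\<Union>F\<in>\<Delta>. {m. keys m = F \<and> mon_degree m = t})"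
    by auto
qed (use finite_\<Delta> finite_support in auto)

lemma graded_part_0: "graded_part n A 0 = {q (single 0 c) |c. True}"
proof -
  have "homogeneous_part n 0 = {single 0 c |c :: 'k. True}"
    using homogeneous_const by (auto intro: homogeneous_single)
  then show ?thesis by (auto simp: graded_part_A)
qed

text \<open>Over a subfield the dimension of a graded component is unique, as the definite
  description in \<open>hilbert_function\<close> requires.\<close>

lemma subfield_graded_part_0:
  assumes "{} \<in> \<Delta>"
  shows "subfield (graded_part n A 0) A"
proof (rule subfieldI)
  let ?K = "graded_part n A 0"
  have z: "q (single 0 c) = \<zero>\<^bsub>A\<^esub> \<longleftrightarrow> c = 0" for c
    using assms by (auto simp: q_eq_zero_iff I_iff lookup_single when_def split: if_splits)
  show "subcring ?K A"
  proof (rule subcringI'[OF subringI])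
    show "?K \<subseteq> carrier A" by (auto simp: graded_part_0)
    show "\<one>\<^bsub>A\<^esub> \<in> ?K" by (auto simp: graded_part_0 A_simps intro!: exI[of _ 1])
    fix h assume "h \<in> ?K"
    then show "\<ominus>\<^bsub>A\<^esub> h \<in> ?K" by (auto simp: graded_part_0 uminus_q single_uminus[symmetric])
    fix h' assume "h' \<in> ?K"
    then show "h \<otimes>\<^bsub>A\<^esub> h' \<in> ?K" "h \<oplus>\<^bsub>A\<^esub> h' \<in> ?K"
      using \<open>h \<in> ?K\<close> by (auto simp: graded_part_0 mult_q add_q mult_single single_add[symmetric])
  qed
  show "Units (A\<lparr>carrier := ?K\<rparr>) = ?K - {\<zero>\<^bsub>A\<^esub>}"
  proof (intro equalityI subsetI)
    fix x assume "x \<in> Units (A\<lparr>carrier := ?K\<rparr>)"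
    then obtain y where xy: "x \<in> ?K" "y \<in> ?K" "y \<otimes>\<^bsub>A\<^esub> x = \<one>\<^bsub>A\<^esub>" by (auto simp: Units_def)
    have "\<one>\<^bsub>A\<^esub> \<noteq> \<zero>\<^bsub>A\<^esub>" using z[of 1] by (simp add: A_simps)
    moreover have "y \<in> carrier A" using xy by (auto simp: graded_part_0)
    ultimately have "x \<noteq> \<zero>\<^bsub>A\<^esub>" using xy(3) r_null by metis
    then show "x \<in> ?K - {\<zero>\<^bsub>A\<^esub>}" using xy by simp
  next
    fix x assume x: "x \<in> ?K - {\<zero>\<^bsub>A\<^esub>}"
    then obtain c where "x = q (single 0 c)" unfolding graded_part_0 by blast
    moreover from this have "c \<noteq> 0" using x z[of c] by simp
    ultimately have c: "x = q (single 0 c)" "c \<noteq> 0" by simp_all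
    then have "q (single 0 (inverse c)) \<otimes>\<^bsub>A\<^esub> x = \<one>\<^bsub>A\<^esub>" "x \<otimes>\<^bsub>A\<^esub> q (single 0 (inverse c)) = \<one>\<^bsub>A\<^esub>"
      by (simp_all add: mult_q mult_single A_simps)
    moreover have "q (single 0 (inverse c)) \<in> ?K" by (auto simp: graded_part_0)
    ultimately show "x \<in> Units (A\<lparr>carrier := ?K\<rparr>)" using x by (auto simp: Units_def)
  qed
qed

text \<open>Monomials supported on faces are independent modulo the ideal; they are added one at a
  time as line extensions.\<close>

lemma dimension_monomials:
  assumes "finite M" "\<And>m. m \<in> M \<Longrightarrow> keys m \<in> \<Delta>"
  shows "ring.dimension A (card M) (graded_part n A 0) {q p |p. p \<in> polys n \<and> keys p \<subseteq> M}"
  using assms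
proof (induction M rule: finite_induct)
  case empty
  have "{q p |p. p \<in> polys n \<and> keys p \<subseteq> {}} = {\<zero>\<^bsub>A\<^esub>}" by (auto simp: A_simps)
  then show ?case by (simp add: zero_dim)
next
  case (insert m M)
  let ?E = "\<lambda>M. {q p |p. p \<in> polys n \<and> keys p \<subseteq> M}"
  let ?v = "q (single m 1)"
  have km: "keys m \<subseteq> {1..n}" using insert.prems face_subset by blast
  have vc: "single m c \<in> polys n" for c :: 'k using km by (rule single_closed)
  have "?v \<notin> ?E M"
  proof
    assume "?v \<in> ?E M"
    then obtain p where p: "?v = q p" "p \<in> polys n" "keys p \<subseteq> M" by auto
    have "single m 1 - p \<in> SRI" by (rule iffD1[OF q_eq_iff[OF vc p(2)] p(1)])
    then have "lookup (single m 1 - p) m = 0" using insert.prems by (simp add: I_iff)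
    moreover have "lookup p m = 0" using p(3) insert.hyps by (auto simp: in_keys_iff)
    ultimately show False by (simp add: lookup_minus)
  qed
  moreover have "line_extension (graded_part n A 0) ?v (?E M) = ?E (insert m M)"
  proof (intro equalityI subsetI)
    fix x assume "x \<in> line_extension (graded_part n A 0) ?v (?E M)"
    then obtain c p where x: "x = q (single 0 c) \<otimes>\<^bsub>A\<^esub> ?v \<oplus>\<^bsub>A\<^esub> q p" "p \<in> polys n" "keys p \<subseteq> M"
      by (auto simp: line_extension_def set_add_def' r_coset_def graded_part_0)
    then have "x = q (single m c + p)" using vc by (simp add: mult_q add_q mult_single)
    moreover have "keys (single m c + p) \<subseteq> insert m M"
      using keys_add[of "single m c" p] x(3) by (auto split: if_splits)
    ultimately show "x \<in> ?E (insert m M)" using vc x(2) by blast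
  next
    fix x assume "x \<in> ?E (insert m M)"
    then obtain p where p: "x = q p" "p \<in> polys n" "keys p \<subseteq> insert m M" by auto
    define p' where "p' = p - single m (lookup p m)"
    have p': "p' \<in> polys n" using p(2) vc by (auto simp: p'_def)
    have "keys p' \<subseteq> M"
    proof
      fix a assume "a \<in> keys p'"
      then have "a \<noteq> m" "a \<in> keys p" by (auto simp: p'_def in_keys_iff lookup_minus lookup_single when_def split: if_splits)
      then show "a \<in> M" using p(3) by blast
    qed
    then have "q p' \<in> ?E M" using p' by blast
    moreover have "x = q (single 0 (lookup p m)) \<otimes>\<^bsub>A\<^esub> ?v \<oplus>\<^bsub>A\<^esub> q p'"
      using vc p' by (simp add: p(1) mult_q add_q mult_single) (simp add: p'_def)
    ultimately show "x \<in> line_extension (graded_part n A 0) ?v (?E M)"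
      unfolding line_extension_def set_add_def' r_coset_def graded_part_0 by blast
  qed
  ultimately show ?case
    using Suc_dim[of ?v "?E M" "card M" "graded_part n A 0"] insert vc by simp
qed

lemma hilbert_function_eq:
  assumes "{} \<in> \<Delta>"
  shows "hilbert_function n A t = hilb t"
proof -
  let ?M = "{m :: mon. keys m \<in> \<Delta> \<and> mon_degree m = t}"
  have "graded_part n A (int t) = {q p |p. p \<in> polys n \<and> keys p \<subseteq> ?M}"
  proof (intro equalityI subsetI)
    fix x assume "x \<in> graded_part n A (int t)"
    then obtain p where p: "p \<in> homogeneous_part n (int t)" "x = q p" by (auto simp: graded_part_A)
    have pc: "p \<in> polys n" using p(1) by blast
    \<comment> \<open>Dropping the terms on nonfaces does not change the residue class.\<close>
    let ?p = "restr (\<lambda>m. keys m \<in> \<Delta>) p"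
    have "keys ?p \<subseteq> keys p" by (auto simp: in_keys_iff lookup_restr split: if_splits)
    then have c: "?p \<in> polys n" using pc unfolding carrier_poly_ring by blast
    then have "p - ?p \<in> SRI" using pc by (auto simp: I_iff lookup_minus lookup_restr)
    then have "x = q ?p" using p(2) q_eq_iff[OF pc c] by simp
    moreover have "keys ?p \<subseteq> ?M"
      using p(1) by (auto simp: in_keys_iff lookup_restr homogeneous_part_iff split: if_splits)
    ultimately show "x \<in> {q p |p. p \<in> polys n \<and> keys p \<subseteq> ?M}" using c by blast
  next
    fix x assume "x \<in> {q p |p. p \<in> polys n \<and> keys p \<subseteq> ?M}"
    then obtain p where p: "x = q p" "p \<in> polys n" "keys p \<subseteq> ?M" by auto
    then have "p \<in> homogeneous_part n (int t)" by (auto simp: homogeneous_part_def)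
    then show "x \<in> graded_part n A (int t)" by (simp add: graded_part_A p(1))
  qed
  then have "ring.dimension A (hilb t) (graded_part n A 0) (graded_part n A (int t))"
    using dimension_monomials[OF hilbert_monomials_finite[of t]] by (simp add: hilb_def)
  then show ?thesis
    unfolding hilbert_function_def
    by (intro the_equality) (auto intro: dimension_is_inj[OF subfield_graded_part_0[OF assms]])
qed

lemma hilb_eq: "hilb t = (\<Sum>F\<in>\<Delta>. support_count F t)"
proof -
  have "{m :: mon. keys m \<in> \<Delta> \<and> mon_degree m = t} = (\<Union>F\<in>\<Delta>. {m. keys m = F \<and> mon_degree m = t})"
    by auto
  then show ?thesis unfolding hilb_def support_count_def
    by (simp only:) (subst card_UN_disjoint, auto simp: finite_\<Delta> finite_support)
qed

text \<open>Each face of size d contributes a binomial coefficient growing like t^(d - 1) / (d -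
  1)!, and smaller faces contribute terms of lower order that vanish in the limit.\<close>

lemma hilbert_multiplicity_eq:
  assumes d: "krull_dim A = enat d" "d \<ge> 1" and dim: "\<And>F. F \<in> \<Delta> \<Longrightarrow> card F \<le> d" and e: "{} \<in> \<Delta>"
  shows "hilbert_multiplicity n A = real (card {F\<in>\<Delta>. card F = d})"
proof -
  have lim: "(\<lambda>t. real (support_count F (Suc t)) / real (Suc t) ^ (d - 1)) \<longlonglongrightarrow> (if card F = d then 1 / fact (d - 1) else 0)"
    if F: "F \<in> \<Delta>" for F
  proof (cases "F = {}")
    case True
    then show ?thesis using d(2) by (simp add: support_count_empty)
  next
    case False
    have fin: "finite F" by (rule face_finite[OF F])
    then have pos: "card F > 0" using False by (simp add: card_gt_0_iff)
    note b = binomial_asymptotics[of "card F - 1"]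
    show ?thesis
    proof (cases "card F = d")
      case True
      then show ?thesis using b by (simp add: support_count_eq[OF fin False])
    next
      case neq: False
      define k where "k = d - card F"
      have k: "k > 0" "d - 1 = (card F - 1) + k" using neq dim[OF F] pos by (auto simp: k_def)
      have "(\<lambda>t. real (t choose (card F - 1)) / real (Suc t) ^ (card F - 1) * inverse (real (Suc t)) ^ k) \<longlonglongrightarrow> 1 / fact (card F - 1) * 0 ^ k"
        by (intro tendsto_mult b tendsto_power LIMSEQ_inverse_real_of_nat)
      moreover have "real (t choose (card F - 1)) / real (Suc t) ^ (card F - 1) * inverse (real (Suc t)) ^ k
          = real (support_count F (Suc t)) / real (Suc t) ^ (d - 1)" for t
        unfolding k(2) power_add support_count_eq[OF fin False] by (simp add: power_inverse divide_simps)
      ultimately show ?thesis using neq k(1) by (simp add: zero_power)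
    qed
  qed
  have "(\<lambda>t. \<Sum>F\<in>\<Delta>. real (support_count F (Suc t)) / real (Suc t) ^ (d - 1)) \<longlonglongrightarrow> (\<Sum>F\<in>\<Delta>. if card F = d then 1 / fact (d - 1) else 0)"
    by (intro tendsto_sum lim)
  also have "(\<Sum>F\<in>\<Delta>. if card F = d then 1 / fact (d - 1) else 0 :: real) = real (card {F\<in>\<Delta>. card F = d}) / fact (d - 1)"
    using finite_\<Delta> by (simp add: sum.inter_filter[symmetric])
  finally have "(\<lambda>t. real (hilb (Suc t)) / real (Suc t) ^ (d - 1)) \<longlonglongrightarrow> real (card {F\<in>\<Delta>. card F = d}) / fact (d - 1)"
    by (simp add: hilb_eq sum_divide_distrib)
  then have "(\<lambda>t. real (hilb t) / real t ^ (d - 1)) \<longlonglongrightarrow> real (card {F\<in>\<Delta>. card F = d}) / fact (d - 1)"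
    by (rule LIMSEQ_imp_Suc)
  then show ?thesis
    unfolding hilbert_multiplicity_def Let_def hilbert_function_eq[OF e] d(1) the_enat.simps
    by (subst limI) auto
qed

end

section \<open>Linear resolution and negativity of the a-invariant\<close>

theorem theorem3p3:
  fixes n d :: nat and \<Delta> :: "nat set set"
    and A :: "('k::field mpoly, 'k mpoly set) module"
  assumes "simplicial_complex n \<Delta>"
    and "A = stanley_reisner_ring n \<Delta>"
    and "krull_dim A = enat d" and "d \<ge> 2"
    and "initial_degree n A = enat d" and "relation_type n A = enat d"
    and "hilbert_multiplicity n A \<le> 2 * real d - 1"
  shows "has_q_linear_resolution n d A \<and> a_invariant n A < 0"
proof -
  interpret sr_complex n \<Delta> A using assms(1,2) by unfold_locales
  have "\<Delta> \<noteq> {}" using krull_dim_void assms(3,4) by (auto simp: zero_enat_def)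
  then have e: "{} \<in> \<Delta>" using face_down by blast
  have dim: "card F \<le> d" if "F \<in> \<Delta>" for F using krull_dim_ge[OF that] assms(3) by simp
  have few: "card {F\<in>\<Delta>. card F = d} < 2 * d"
  proof -
    have "real (card {F\<in>\<Delta>. card F = d}) \<le> 2 * real d - 1"
      using hilbert_multiplicity_eq[OF assms(3) _ dim e] assms(4,7) by simp
    then show ?thesis by linarith
  qed
  have "\<exists>\<epsilon> \<phi>. minimal_graded_free_resolution n A (betti n A) \<epsilon> \<phi>"
    unfolding betti_def by (rule someI_ex[OF minimal_resolution_exists[OF e]])
  then obtain \<epsilon> \<phi> where res: "minimal_graded_free_resolution n A (betti n A) \<epsilon> \<phi>" by blast
  interpret sr_resolution n \<Delta> A "betti n A" \<epsilon> \<phi> by unfold_locales (rule res, rule e)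
  have coll: "collapsible d \<Delta>"
  proof (rule collapsibleI)
    \<comment> \<open>A full boundary on \<open>W\<close> would make \<open>W\<close> a minimal
      nonface and produce a relation of degree d + 1, beyond the relation type.\<close>
    show "\<not> (\<exists>W. finite W \<and> card W = Suc d \<and> (\<forall>x\<in>W. W - {x} \<in> \<Delta>))"
    proof
      assume "\<exists>W. finite W \<and> card W = Suc d \<and> (\<forall>x\<in>W. W - {x} \<in> \<Delta>)"
      then obtain W where W: "finite W" "card W = Suc d" "\<And>x. x \<in> W \<Longrightarrow> W - {x} \<in> \<Delta>" by auto
      have "W \<notin> \<Delta>" using dim[of W] W(2) by auto
      moreover have "W \<subseteq> {1..n}"
      proof
        fix x assume x: "x \<in> W"
        \<comment> \<open>A second vertex \<open>y\<close> is wanted, so that \<open>x\<close> lies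
          in the face \<open>W - {y}\<close>.\<close>
        have "card {x} < card W" using W(2) assms(4) by simp
        then obtain y where "y \<in> W" "y \<noteq> x" using W(1) x by (metis card_subset_eq less_irrefl singletonI subsetI subset_singletonD empty_iff insertE)
        then show "x \<in> {1..n}" using face_subset[OF W(3)[of y]] x by blast
      qed
      ultimately have "betti n A 1 (Suc d) \<noteq> 0" using betti_minimal_nonface[of W] W by simp
      then have "enat (Suc d) \<le> relation_type n A" unfolding relation_type_def by (intro Sup_upper) blast
      then show False using assms(6) by simp
    qed
  qed (use assms(4) finite_\<Delta> face_finite dim face_down few in auto)
  \<comment> \<open>The infimum of a nonempty set of extended naturals is attained.\<close>
  have "betti n A 1 d \<noteq> 0"
  proof -
    let ?S = "{enat j |j. betti n A 1 j \<noteq> 0}"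
    have "?S \<noteq> {}"
    proof
      assume "?S = {}"
      then have "initial_degree n A = \<infinity>" unfolding initial_degree_def by (simp only: Inf_empty top_enat_def)
      then show False using assms(5) by simp
    qed
    then obtain s where "s \<in> ?S" by blast
    then have "Inf ?S \<in> ?S" by (rule wellorder_InfI)
    then have "enat d \<in> ?S" using assms(5) unfolding initial_degree_def by simp
    then show ?thesis by auto
  qed
  then have attained: "ereal (real d - 1) \<in> {ereal (real j - real i) |i j. betti n A i j \<noteq> 0}"
    by (intro CollectI exI[of _ "1::nat"] exI[of _ d]) simp
  have "regularity n A = ereal (real d - 1)"
    unfolding regularity_def
  proof (intro antisym Sup_least Sup_upper)
    fix x assume "x \<in> {ereal (real j - real i) |i j. betti n A i j \<noteq> 0}"
    then obtain i j where "x = ereal (real j - real i)" "betti n A i j \<noteq> 0" by auto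
    moreover from this have "j < i + d" using betti_bound[OF coll] by blast
    ultimately show "x \<le> ereal (real d - 1)" by simp
  qed (rule attained)
  then have "has_q_linear_resolution n d A"
    using assms(5) by (simp add: has_q_linear_resolution_def has_linear_resolution_def one_ereal_def)
  \<comment> \<open>Integrality gives the bound -1, which survives the supremum, whereas negativity
    of each degree alone would give only a bound by 0. The empty set is covered as well.\<close>
  moreover have "a_invariant n A \<le> - 1"
    unfolding a_invariant_def assms(3) the_enat.simps Let_def
  proof (rule Sup_least)
    obtain i where i: "d = Suc i" using assms(4) by (cases d) auto
    fix x assume "x \<in> {ereal (real_of_int p) |p. carrier (local_cohomology n A d p) \<noteq> {\<one>\<^bsub>local_cohomology n A d p\<^esub>}}"
    then obtain p where p: "x = ereal (real_of_int p)" "carrier (local_cohomology n A d p) \<noteq> {\<one>\<^bsub>local_cohomology n A d p\<^esub>}" by auto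
    have "\<not> p \<ge> 0"
      using p(2) local_cohomology_trivial[of i p] dim collapsible_top_cochain[OF coll] unfolding i by blast
    then have "real_of_int p \<le> - 1" by linarith
    then show "x \<le> - 1" by (simp add: p(1) one_ereal_def)
  qed
  then have "a_invariant n A < 0" by (rule le_less_trans) simp
  ultimately show ?thesis by blast
qed

end
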